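(* Let $S=[0,1]$ and let $\nu_0\in M_1(S)$ have topological support equal to $S$. Let $\xi_1,\xi_2,\dots$ be i.i.d. with law $\nu_0$ and, for each $n\ge1$, independently let $(X_{n1},\dots,X_{nn})$ have the Dirichlet$(1,\dots,1)$ distribution; set $\mathcal{W}_{n,\nu_0}=\sum_{i=1}^n X_{ni}\delta_{\xi_i}$. Then the family of laws of $\{\mathcal{W}_{n,\nu_0}:n\ge1\}$ satisfies a large deviation principle on $M_1(S)$ (with speed $n$) with good rate function $$J(\mu,\nu_0)=\inf_{\upsilon\in M_1(S)}\{H(\upsilon|\mu)+H(\upsilon|\nu_0)\},\qquad \mu\in M_1(S).$$
   Context: $M_1(S)$ is the space of Borel probability measures on $S$ with the weak topology; $\delta_x$ is the Dirac measure at $x$. The weights are $X_{ni}=W_{ni}/\sum_{k=1}^nW_{nk}$ with $W_{n1},\dots,W_{nn}$ i.i.d. exponential with parameter $1$, independent of $(\xi_i)$; equivalently $(X_{n1},\dots,X_{nn})$ is Dirichlet$(1,\dots,1)$. The relative entropy is $H(\mu|\nu)=\sup\{\langle\mu,f\rangle-\log\langle\nu,e^f\rangle: f\in C(S)\}\in[0,\infty]$, where $\langle\mu,f\rangle=\int f\,d\mu$ and $C(S)$ is the space of continuous real functions on $S$. Large deviation principle with speed $n$ and rate function $I$ for laws $\Pi_n$: $\limsup_n \frac1n\log\Pi_n(C)\le-\inf_C I$ for closed $C$ and $\liminf_n\frac1n\log\Pi_n(G)\ge-\inf_G I$ for open $G$; good means the sublevel sets $\{I\le c\}$, $c<\infty$,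 are compact. *)

theory Defs
  imports "HOL-Probability.Probability"
begin

abbreviation unit_ivl :: "real set" where
  "unit_ivl \<equiv> {0..1}"

abbreviation borel_unit :: "real measure" where
  "borel_unit \<equiv> restrict_space borel unit_ivl"

definition M1 :: "real measure set" where
  "M1 = space (prob_algebra borel_unit)"

text \<open>No boundedness condition is needed on the test functions, as \<^term>\<open>unit_ivl\<close> is compact.\<close>

definition C_unit :: "(real \<Rightarrow> real) set" where
  "C_unit = {f. continuous_on unit_ivl f}"

definition weak_topology :: "real measure topology" where
  "weak_topology = topology_generated_by
     {{\<mu> \<in> M1. (\<integral>x. f x \<partial>\<mu>) \<in> U} | f U. f \<in> C_unit \<and> open U}"

definition borel_sigma :: "'a topology \<Rightarrow> 'a measure" where
  "borel_sigma T = sigma (topspace T) {U. openin T U}"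

definition topological_support :: "'a::topological_space measure \<Rightarrow> 'a set" where
  "topological_support \<nu> =
     {x \<in> space \<nu>. \<forall>U. open U \<longrightarrow> x \<in> U \<longrightarrow> 0 < emeasure \<nu> (U \<inter> space \<nu>)}"

definition relative_entropy :: "real measure \<Rightarrow> real measure \<Rightarrow> ereal" where
  "relative_entropy \<mu> \<nu> =
     (SUP f\<in>C_unit. ereal ((\<integral>x. f x \<partial>\<mu>) - ln (\<integral>x. exp (f x) \<partial>\<nu>)))"

definition J :: "real measure \<Rightarrow> real measure \<Rightarrow> ereal" where
  "J \<mu> \<nu> = (INF \<upsilon>\<in>M1. relative_entropy \<upsilon> \<mu> + relative_entropy \<upsilon> \<nu>)"

text \<open>The real \<^term>\<open>ln 0\<close> is \<^term>\<open>0\<close>; events of probability zero need the value \<^term>\<open>-\<infinity>\<close>.\<close>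

definition log_prob :: "real \<Rightarrow> ereal" where
  "log_prob p = (if p = 0 then -\<infinity> else ereal (ln p))"

definition LDP_speed_n :: "'a topology \<Rightarrow> (nat \<Rightarrow> 'a measure) \<Rightarrow> ('a \<Rightarrow> ereal) \<Rightarrow> bool" where
  "LDP_speed_n T L I \<longleftrightarrow>
     (\<forall>C. closedin T C \<longrightarrow>
        limsup (\<lambda>n. ereal (1 / real n) * log_prob (measure (L n) C)) \<le> - (INF x\<in>C. I x)) \<and>
     (\<forall>G. openin T G \<longrightarrow>
        liminf (\<lambda>n. ereal (1 / real n) * log_prob (measure (L n) G)) \<ge> - (INF x\<in>G. I x))"

definition good_rate_function :: "'a topology \<Rightarrow> ('a \<Rightarrow> ereal) \<Rightarrow> bool" where
  "good_rate_function T I \<longleftrightarrow>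
     (\<forall>x\<in>topspace T. 0 \<le> I x) \<and>
     (\<forall>c::real. compactin T {x \<in> topspace T. I x \<le> ereal c})"

text \<open>The Dirichlet(1, ..., 1) distribution, as the law of
  \<open>(W\<^sub>1 / \<Sum>\<^sub>k W\<^sub>k, \<dots>, W\<^sub>n / \<Sum>\<^sub>k W\<^sub>k)\<close> for i.i.d. exponential variables \<open>W\<^sub>i\<close> with parameter 1.\<close>

definition dirichlet_ones :: "nat \<Rightarrow> (nat \<Rightarrow> real) measure" where
  "dirichlet_ones n =
     distr (\<Pi>\<^sub>M i\<in>{1..n}. density lborel (exponential_density 1)) (\<Pi>\<^sub>M i\<in>{1..n}. borel)
       (\<lambda>w. \<lambda>i\<in>{1..n}. w i / (\<Sum>k=1..n. w k))"

text \<open>The measure \<open>\<Sum>\<^sub>i x\<^sub>i \<delta>\<^bsub>y\<^sub>i\<^esub>\<close>; the Dirac measure is \<^const>\<open>return\<close>.\<close>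

definition weighted_empirical :: "nat \<Rightarrow> (nat \<Rightarrow> real) \<Rightarrow> (nat \<Rightarrow> real) \<Rightarrow> real measure" where
  "weighted_empirical n x y =
     measure_of (space borel_unit) (sets borel_unit)
       (\<lambda>A. \<Sum>i=1..n. ennreal (x i) * emeasure (return borel_unit (y i)) A)"

end

theory Submission
  imports Defs
begin

text \<open>For a continuous \<open>h > 0\<close> put \<open>I\<^sub>h(\<mu>) = - ln \<integral>h d\<mu> - ln \<integral>1/h d\<nu>\<^sub>0\<close>. Choosing \<open>ln h\<close> and \<open>- ln h\<close> as test
  functions in the two entropies gives \<open>J \<ge> sup\<^sub>h I\<^sub>h\<close>, and in fact equality holds, both sides being
  \<open>- 2 ln\<close> of the Hellinger affinity of \<open>\<mu>\<close> and \<open>\<nu>\<^sub>0\<close>. To avoid densities, the affinity is discretised by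
  a partition of unity into hat functions: \<open>A\<^sub>m(\<mu>) = \<Sum>\<^sub>l sqrt (p\<^sub>l q\<^sub>l)\<close>, where \<open>p\<^sub>l\<close> and \<open>q\<^sub>l\<close> are the masses
  that \<open>\<mu>\<close> and \<open>\<nu>\<^sub>0\<close> give to the hats. Taking \<open>h = \<Sum>\<^sub>l sqrt (q\<^sub>l / p\<^sub>l) hat\<^sub>l\<close> shows \<open>sup\<^sub>h I\<^sub>h \<ge> - 2 ln A\<^sub>m\<close>, and a
  weak limit of the discrete measures with masses \<open>sqrt (p\<^sub>l q\<^sub>l) / A\<^sub>m\<close> is a measure \<open>\<upsilon>\<close> showing
  \<open>J \<le> sup\<^sub>m (- 2 ln A\<^sub>m)\<close>. Lower semicontinuity of \<open>J\<close> and compactness of \<open>M\<^sub>1(S)\<close> make \<open>J\<close> good.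

  With exponential weights \<open>w\<^sub>i\<close>, the event \<open>\<langle>W\<^sub>n, h\<rangle> < s\<close> reads \<open>\<Sum>\<^sub>i w\<^sub>i (1 - h(\<xi>\<^sub>i)/s) > 0\<close> and has probability
  at most \<open>(s \<integral>1/h d\<nu>\<^sub>0)\<^sup>n\<close> by Chernoff's bound; a finite cover by such events gives the upper bound.
  For the lower bound, every \<open>\<mu>\<close> is approximated by measures \<open>g \<nu>\<^sub>0\<close> with \<open>g > 0\<close> continuous and no larger
  rate in the limit, and \<open>g \<nu>\<^sub>0\<close> becomes typical after tilting the pairs \<open>(w, y)\<close> by \<open>exp (w (1 - h(y)))\<close> with
  \<open>h\<close> proportional to \<open>1 / sqrt g\<close>.\<close>

section \<open>Probability measures on the unit interval\<close>

lemma M1_iff: "\<mu> \<in> M1 \<longleftrightarrow> prob_space \<mu> \<and> sets \<mu> = sets borel_unit"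
  by (auto simp: M1_def space_prob_algebra)

lemma M1_prob_space: "\<mu> \<in> M1 \<Longrightarrow> prob_space \<mu>"
  by (simp add: M1_iff)

lemma M1_sets: "\<mu> \<in> M1 \<Longrightarrow> sets \<mu> = sets borel_unit"
  by (simp add: M1_iff)

lemma M1_space: "\<mu> \<in> M1 \<Longrightarrow> space \<mu> = unit_ivl"
  by (auto simp: M1_iff dest: sets_eq_imp_space_eq)

lemma M1_measurable:
  fixes f :: "real \<Rightarrow> real"
  assumes "\<mu> \<in> M1" "continuous_on unit_ivl f"
  shows "f \<in> borel_measurable \<mu>"
  using borel_measurable_continuous_on_restrict[OF assms(2)]
  by (simp cong: measurable_cong_sets add: M1_sets[OF assms(1)])

lemma continuous_on_unit_bounded:
  fixes f :: "real \<Rightarrow> real"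
  assumes "continuous_on unit_ivl f"
  obtains B where "B > 0" "\<And>x. x \<in> unit_ivl \<Longrightarrow> \<bar>f x\<bar> \<le> B"
proof -
  have "bounded (f ` unit_ivl)"
    using assms by (intro compact_imp_bounded compact_continuous_image) auto
  then obtain B where "B > 0" "\<And>x. x \<in> f ` unit_ivl \<Longrightarrow> norm x \<le> B"
    unfolding bounded_pos by auto
  then show ?thesis by (intro that) auto
qed

lemma continuous_on_unit_pos_lower_bound:
  fixes f :: "real \<Rightarrow> real"
  assumes "continuous_on unit_ivl f" and "\<And>x. x \<in> unit_ivl \<Longrightarrow> f x > 0"
  obtains b where "b > 0" "\<And>x. x \<in> unit_ivl \<Longrightarrow> b \<le> f x"
proof -
  obtain x where "x \<in> unit_ivl" "\<And>y. y \<in> unit_ivl \<Longrightarrow> f x \<le> f y"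
    using continuous_attains_inf[of unit_ivl f] assms(1) by auto
  with assms(2) show ?thesis by (intro that[of "f x"]) auto
qed

lemma M1_integrable:
  fixes f :: "real \<Rightarrow> real"
  assumes \<mu>: "\<mu> \<in> M1" and f: "continuous_on unit_ivl f"
  shows "integrable \<mu> f"
proof -
  interpret prob_space \<mu> using \<mu> by (rule M1_prob_space)
  obtain B where "\<And>x. x \<in> unit_ivl \<Longrightarrow> \<bar>f x\<bar> \<le> B"
    using continuous_on_unit_bounded[OF f] by metis
  then show ?thesis
    by (intro integrable_const_bound[of _ B] AE_I2 M1_measurable[OF \<mu> f]) (auto simp: M1_space[OF \<mu>])
qed

lemma M1_measure_space [simp]: "\<mu> \<in> M1 \<Longrightarrow> measure \<mu> (space \<mu>) = 1"
  by (simp add: prob_space.prob_space M1_prob_space)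

lemma M1_integral_mono:
  fixes f g :: "real \<Rightarrow> real"
  assumes "\<mu> \<in> M1" "continuous_on unit_ivl f" "continuous_on unit_ivl g"
    and "\<And>x. x \<in> unit_ivl \<Longrightarrow> f x \<le> g x"
  shows "(\<integral>x. f x \<partial>\<mu>) \<le> (\<integral>x. g x \<partial>\<mu>)"
  using assms by (intro integral_mono M1_integrable) (auto simp: M1_space)

lemma M1_integral_pos:
  fixes f :: "real \<Rightarrow> real"
  assumes \<mu>: "\<mu> \<in> M1" and f: "continuous_on unit_ivl f" "\<And>x. x \<in> unit_ivl \<Longrightarrow> f x > 0"
  shows "(\<integral>x. f x \<partial>\<mu>) > 0"
proof -
  obtain b where b: "b > 0" "\<And>x. x \<in> unit_ivl \<Longrightarrow> b \<le> f x"
    using continuous_on_unit_pos_lower_bound[OF f] by metis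
  have "(\<integral>x. b \<partial>\<mu>) \<le> (\<integral>x. f x \<partial>\<mu>)"
    using b f by (intro M1_integral_mono[OF \<mu>]) auto
  with b \<mu> show ?thesis by simp
qed

lemma M1_integral_dist_le:
  fixes f g :: "real \<Rightarrow> real"
  assumes \<mu>: "\<mu> \<in> M1" and fg: "continuous_on unit_ivl f" "continuous_on unit_ivl g"
    and le: "\<And>x. x \<in> unit_ivl \<Longrightarrow> \<bar>f x - g x\<bar> \<le> e"
  shows "\<bar>(\<integral>x. f x \<partial>\<mu>) - (\<integral>x. g x \<partial>\<mu>)\<bar> \<le> e"
proof -
  have "(\<integral>x. f x - g x \<partial>\<mu>) \<le> (\<integral>x. e \<partial>\<mu>)"
    by (intro M1_integral_mono[OF \<mu>] continuous_intros fg) (use le in \<open>auto simp: abs_le_iff\<close>)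
  moreover have "(\<integral>x. g x - f x \<partial>\<mu>) \<le> (\<integral>x. e \<partial>\<mu>)"
    by (intro M1_integral_mono[OF \<mu>] continuous_intros fg) (use le in \<open>auto simp: abs_le_iff\<close>)
  ultimately show ?thesis
    using M1_integrable[OF \<mu> fg(1)] M1_integrable[OF \<mu> fg(2)] by (simp add: \<mu> abs_le_iff)
qed

section \<open>The weak topology\<close>

text \<open>By Weierstrass the moments determine the weak topology on the compact
  \<open>unit_ivl\<close>. One map into the sequence space \<open>nat \<Rightarrow> real\<close>,
  whose product topology is metrizable, thus replaces uncountably many test functions and serves
  both compactness and measurability.\<close>

definition moments :: "real measure \<Rightarrow> nat \<Rightarrow> real" where
  "moments \<mu> k = (\<integral>x. x ^ k \<partial>\<mu>)"

lemma topspace_weak_topology [simp]: "topspace weak_topology = M1"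
proof -
  have "M1 \<in> {{\<mu> \<in> M1. (\<integral>x. f x \<partial>\<mu>) \<in> U} | f U. f \<in> C_unit \<and> open U}"
    by (rule CollectI, rule exI[of _ "\<lambda>_. 0"], rule exI[of _ UNIV]) (auto simp: C_unit_def)
  then show ?thesis unfolding weak_topology_def topology_generated_by_topspace by blast
qed

lemma openin_weak_topology_basic:
  fixes f :: "real \<Rightarrow> real"
  assumes "continuous_on unit_ivl f" "open U"
  shows "openin weak_topology {\<mu> \<in> M1. (\<integral>x. f x \<partial>\<mu>) \<in> U}"
  unfolding weak_topology_def
  by (rule topology_generated_by_Basis, rule CollectI, rule exI[of _ f], rule exI[of _ U])
     (use assms in \<open>auto simp: C_unit_def\<close>)

text \<open>A subbasic set constrains one integral, an intersection merges two families under the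
  smaller tolerance, and a union needs only one member. Induction over the generated topology thus
  reaches a finite family with a common \<delta>.\<close>

lemma weak_topology_nbhd:
  assumes "openin weak_topology G" "\<mu> \<in> G"
  shows "\<exists>(F :: (real \<Rightarrow> real) set) \<delta>. finite F \<and> (\<forall>f\<in>F. continuous_on unit_ivl f) \<and> \<delta> > 0 \<and>
    (\<forall>\<mu>'\<in>M1. (\<forall>f\<in>F. \<bar>(\<integral>x. f x \<partial>\<mu>') - (\<integral>x. f x \<partial>\<mu>)\<bar> < \<delta>) \<longrightarrow> \<mu>' \<in> G)"
proof -
  have "generate_topology_on {{\<mu> \<in> M1. (\<integral>x. f x \<partial>\<mu>) \<in> U} | f U. f \<in> C_unit \<and> open U} G"
    using assms(1) unfolding weak_topology_def by (rule openin_topology_generated_by)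
  then show ?thesis using assms(2)
  proof (induction rule: generate_topology_on.induct)
    case Empty
    then show ?case by simp
  next
    case (Int a b)
    then have \<mu>: "\<mu> \<in> a" "\<mu> \<in> b" by auto
    obtain F :: "(real \<Rightarrow> real) set" and \<delta> where 1: "finite F" "\<forall>f\<in>F. continuous_on unit_ivl f" "\<delta> > 0"
      "\<forall>\<mu>'\<in>M1. (\<forall>f\<in>F. \<bar>(\<integral>x. f x \<partial>\<mu>') - (\<integral>x. f x \<partial>\<mu>)\<bar> < \<delta>) \<longrightarrow> \<mu>' \<in> a"
      using Int.IH(1)[OF \<mu>(1)] by blast
    obtain F' :: "(real \<Rightarrow> real) set" and \<delta>' where 2: "finite F'" "\<forall>f\<in>F'. continuous_on unit_ivl f" "\<delta>' > 0"
      "\<forall>\<mu>'\<in>M1. (\<forall>f\<in>F'. \<bar>(\<integral>x. f x \<partial>\<mu>') - (\<integral>x. f x \<partial>\<mu>)\<bar> < \<delta>') \<longrightarrow> \<mu>' \<in> b"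
      using Int.IH(2)[OF \<mu>(2)] by blast
    show ?case
      by (rule exI[of _ "F \<union> F'"], rule exI[of _ "min \<delta> \<delta>'"]) (use 1 2 in auto)
  next
    case (UN K)
    then obtain k where k: "k \<in> K" "\<mu> \<in> k" by auto
    from UN.IH[OF this] obtain F :: "(real \<Rightarrow> real) set" and \<delta> where *: "finite F" "\<forall>f\<in>F. continuous_on unit_ivl f" "\<delta> > 0"
      "\<forall>\<mu>'\<in>M1. (\<forall>f\<in>F. \<bar>(\<integral>x. f x \<partial>\<mu>') - (\<integral>x. f x \<partial>\<mu>)\<bar> < \<delta>) \<longrightarrow> \<mu>' \<in> k"
      by blast
    show ?case
      by (rule exI[of _ F], rule exI[of _ \<delta>]) (use * k in auto)
  next
    case (Basis s)
    then obtain f U where *: "s = {\<mu> \<in> M1. integral\<^sup>L \<mu> f \<in> U}" "f \<in> C_unit" "open U"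
      unfolding mem_Collect_eq by (elim exE conjE) rule
    note s = *(1) *(2)[unfolded C_unit_def mem_Collect_eq] *(3)
    with Basis obtain \<delta> where \<delta>: "\<delta> > 0" "\<And>y. dist y (\<integral>x. f x \<partial>\<mu>) < \<delta> \<Longrightarrow> y \<in> U"
      by (auto simp: open_dist)
    show ?case
      by (rule exI[of _ "{f}"], rule exI[of _ \<delta>]) (use s \<delta> in \<open>auto simp: dist_real_def\<close>)
  qed
qed

text \<open>Finitely many test functions describe a neighbourhood; each is uniformly close to a
  polynomial, whose integral is a linear form in finitely many moments. So the neighbourhood
  contains one that is open in the moments.\<close>

lemma weak_topology_pullback_moments:
  assumes "openin weak_topology G"
  obtains V where "open V" "G = {\<mu> \<in> M1. moments \<mu> \<in> V}"
proof -
  have local: "\<exists>V. open V \<and> moments \<mu> \<in> V \<and> {\<mu> \<in> M1. moments \<mu> \<in> V} \<subseteq> G" if \<mu>G: "\<mu> \<in> G" for \<mu>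
  proof -
    have \<mu>: "\<mu> \<in> M1" using openin_subset[OF assms] that by auto
    obtain F :: "(real \<Rightarrow> real) set" and \<delta> where F: "finite F" "\<forall>f\<in>F. continuous_on unit_ivl f" "\<delta> > 0"
      "\<forall>\<mu>'\<in>M1. (\<forall>f\<in>F. \<bar>(\<integral>x. f x \<partial>\<mu>') - (\<integral>x. f x \<partial>\<mu>)\<bar> < \<delta>) \<longrightarrow> \<mu>' \<in> G"
      using weak_topology_nbhd[OF assms \<mu>G] by blast
    have "\<forall>f\<in>F. \<exists>g. real_polynomial_function g \<and> (\<forall>x\<in>unit_ivl. \<bar>f x - g x\<bar> < \<delta> / 4)"
    proof
      fix f assume "f \<in> F"
      with F have "continuous_on unit_ivl f" "\<delta> / 4 > 0" by auto
      from Stone_Weierstrass_real_polynomial_function[OF compact_Icc this]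
      show "\<exists>g. real_polynomial_function g \<and> (\<forall>x\<in>unit_ivl. \<bar>f x - g x\<bar> < \<delta> / 4)" by metis
    qed
    then have "\<forall>f\<in>F. \<exists>a n. \<forall>x\<in>unit_ivl. \<bar>f x - (\<Sum>i\<le>n. a i * x^i)\<bar> < \<delta> / 4"
      unfolding real_polynomial_function_iff_sum by metis
    then obtain a n where an: "\<And>f x. f \<in> F \<Longrightarrow> x \<in> unit_ivl \<Longrightarrow>
        \<bar>f x - (\<Sum>i\<le>(n f::nat). a f i * x^i)\<bar> < \<delta> / 4"
      by metis
    define q where "q f s = (\<Sum>i\<le>n f. a f i * s i)" for f and s :: "nat \<Rightarrow> real"
    have q: "\<bar>(\<integral>x. f x \<partial>\<mu>') - q f (moments \<mu>')\<bar> \<le> \<delta> / 4" if "f \<in> F" "\<mu>' \<in> M1" for f \<mu>'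
    proof -
      have "q f (moments \<mu>') = (\<integral>x. (\<Sum>i\<le>n f. a f i * x^i) \<partial>\<mu>')"
        unfolding q_def moments_def using that(2)
        by (subst Bochner_Integration.integral_sum)
           (auto intro!: M1_integrable continuous_intros)
      also have "\<bar>(\<integral>x. f x \<partial>\<mu>') - \<dots>\<bar> \<le> \<delta> / 4"
        using F(2) an[OF that(1)] that
        by (intro M1_integral_dist_le) (auto intro!: continuous_intros less_imp_le)
      finally show ?thesis .
    qed
    \<comment> \<open>The form \<open>q f\<close> replaces the integral of \<open>f\<close> with
      error \<delta>/4 at \<open>\<mu>\<close> and again at \<open>\<mu>'\<close>; with the
      \<delta>/4 from \<open>V\<close> this makes 3\<delta>/4 < \<delta>.\<close>
    define V where "V = (\<Inter>f\<in>F. {s. \<bar>q f s - q f (moments \<mu>)\<bar> < \<delta> / 4})"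
    have "open V" unfolding V_def
    proof (intro open_INT F ballI)
      fix f
      have "continuous_on UNIV (q f)"
        unfolding q_def by (intro continuous_intros continuous_on_product_coordinates)
      then show "open {s. \<bar>q f s - q f (moments \<mu>)\<bar> < \<delta> / 4}"
        by (intro open_Collect_less continuous_intros)
    qed
    moreover have "moments \<mu> \<in> V" using F by (auto simp: V_def)
    moreover have "{\<mu> \<in> M1. moments \<mu> \<in> V} \<subseteq> G"
    proof safe
      fix \<mu>' assume \<mu>': "\<mu>' \<in> M1" "moments \<mu>' \<in> V"
      have "\<bar>(\<integral>x. f x \<partial>\<mu>') - (\<integral>x. f x \<partial>\<mu>)\<bar> < \<delta>" if "f \<in> F" for f
      proof -
        have "\<bar>q f (moments \<mu>') - q f (moments \<mu>)\<bar> < \<delta> / 4" using \<mu>' that by (auto simp: V_def)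
        then show ?thesis using q[OF that \<mu>'(1)] q[OF that \<mu>] by linarith
      qed
      with F \<mu>' show "\<mu>' \<in> G" by blast
    qed
    ultimately show ?thesis by blast
  qed
  define V where "V = \<Union>{V. open V \<and> {\<mu> \<in> M1. moments \<mu> \<in> V} \<subseteq> G}"
  have "open V" unfolding V_def by (intro open_Union) auto
  moreover have "G = {\<mu> \<in> M1. moments \<mu> \<in> V}"
    using local openin_subset[OF assms] by (fastforce simp: V_def)
  ultimately show ?thesis by (rule that)
qed

text \<open>The retraction of the line onto the interval. Composition with it extends a test
  function to the line, pushing forward returns a measure to the interval, and differences of its
  shifts give the hat functions.\<close>

definition unit_clamp :: "real \<Rightarrow> real" where
  "unit_clamp x = max 0 (min 1 x)"

lemma unit_clamp_in [simp]: "unit_clamp x \<in> unit_ivl"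
  by (auto simp: unit_clamp_def)

lemma unit_clamp_ident: "x \<in> unit_ivl \<Longrightarrow> unit_clamp x = x"
  by (auto simp: unit_clamp_def)

lemma continuous_on_unit_clamp [continuous_intros]:
  "continuous_on A f \<Longrightarrow> continuous_on A (\<lambda>x. unit_clamp (f x))"
  unfolding unit_clamp_def by (intro continuous_intros)

text \<open>Helly selection on the real line: moved there, the measures are tight because all mass
  sits in a fixed window.\<close>

lemma M1_seq_compact:
  assumes "\<And>n. \<mu> n \<in> M1"
  obtains \<upsilon> and r :: "nat \<Rightarrow> nat" where "strict_mono r" "\<upsilon> \<in> M1"
    "\<And>f::real \<Rightarrow> real. continuous_on unit_ivl f \<Longrightarrow> (\<lambda>n. \<integral>x. f x \<partial>\<mu> (r n)) \<longlonglongrightarrow> (\<integral>x. f x \<partial>\<upsilon>)"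
proof -
  define \<mu>' where "\<mu>' n = distr (\<mu> n) borel (\<lambda>x. x)" for n
  have id: "(\<lambda>x. x) \<in> measurable (\<mu> n) borel" for n
    using M1_measurable[OF assms[of n], of "\<lambda>x. x"] by auto
  have rd: "real_distribution (\<mu>' n)" for n
    unfolding \<mu>'_def
    by (intro prob_space.real_distribution_distr id M1_prob_space assms)
  have "tight \<mu>'"
    unfolding tight_def
  proof (intro conjI allI impI rd)
    fix \<epsilon> :: real assume "\<epsilon> > 0"
    \<comment> \<open>The window is open on the left, so it starts at -1 in order to contain
      0.\<close>
    have "measure (\<mu>' n) {-1<..1} = 1" for n
    proof -
      have "measure (\<mu>' n) {-1<..1} = measure (\<mu> n) (space (\<mu> n))"
        unfolding \<mu>'_def by (subst measure_distr) (auto intro!: id arg_cong[of _ _ "measure (\<mu> n)"] simp: M1_space[OF assms])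
      then show ?thesis using prob_space.prob_space[OF M1_prob_space[OF assms]] by simp
    qed
    then show "\<exists>a b. a < b \<and> (\<forall>n. 1 - \<epsilon> < measure (\<mu>' n) {a<..b})"
      using \<open>\<epsilon> > 0\<close> by (intro exI[of _ "-1"] exI[of _ 1]) auto
  qed
  from tight_imp_convergent_subsubsequence[OF this, of id]
  obtain r M where r: "strict_mono (r :: nat \<Rightarrow> nat)" and M: "real_distribution M"
    and conv: "weak_conv_m (\<mu>' \<circ> r) M"
    by (auto simp: strict_mono_def)
  interpret M: real_distribution M by fact
  \<comment> \<open>Clamping returns the limit to the interval without first locating its support;
    the test functions are composed with the clamp, so the integrals agree.\<close>
  define \<upsilon> where "\<upsilon> = distr M borel_unit unit_clamp"
  have clamp_meas: "unit_clamp \<in> measurable M borel_unit"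
    unfolding unit_clamp_def by (rule measurable_restrict_space2) auto
  have "\<upsilon> \<in> M1"
    using M.prob_space_distr[OF clamp_meas] by (simp add: M1_iff \<upsilon>_def)
  moreover have "(\<lambda>n. \<integral>x. f x \<partial>\<mu> (r n)) \<longlonglongrightarrow> (\<integral>x. f x \<partial>\<upsilon>)" if f: "continuous_on unit_ivl f" for f :: "real \<Rightarrow> real"
  proof -
    obtain B where B: "\<And>x. x \<in> unit_ivl \<Longrightarrow> \<bar>f x\<bar> \<le> B"
      using continuous_on_unit_bounded[OF f] by metis
    have cont: "continuous_on UNIV (\<lambda>x. f (unit_clamp x))"
      by (rule continuous_on_compose2[OF f]) (auto intro!: continuous_intros simp del: atLeastAtMost_iff)
    have "(\<lambda>n. integral\<^sup>L ((\<mu>' \<circ> r) n) (\<lambda>x. f (unit_clamp x))) \<longlonglongrightarrow> integral\<^sup>L M (\<lambda>x. f (unit_clamp x))"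
    proof (rule weak_conv_imp_integral_bdd_continuous_conv)
      show "isCont (\<lambda>x. f (unit_clamp x)) x" for x
        using cont by (simp add: continuous_on_eq_continuous_at)
      show "norm (f (unit_clamp x)) \<le> B" for x using B[OF unit_clamp_in] by simp
    qed (use rd M conv in \<open>auto simp: comp_def\<close>)
    moreover have "integral\<^sup>L ((\<mu>' \<circ> r) n) (\<lambda>x. f (unit_clamp x)) = (\<integral>x. f x \<partial>\<mu> (r n))" for n
    proof -
      have "integral\<^sup>L ((\<mu>' \<circ> r) n) (\<lambda>x. f (unit_clamp x)) = (\<integral>x. f (unit_clamp x) \<partial>\<mu> (r n))"
        unfolding \<mu>'_def o_def
        using borel_measurable_continuous_onI[OF cont] by (intro integral_distr id)
      also have "\<dots> = (\<integral>x. f x \<partial>\<mu> (r n))"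
        by (intro Bochner_Integration.integral_cong) (auto simp: M1_space[OF assms] unit_clamp_ident)
      finally show ?thesis .
    qed
    moreover have "(\<integral>x. f x \<partial>\<upsilon>) = (\<integral>x. f (unit_clamp x) \<partial>M)"
      unfolding \<upsilon>_def
      by (intro integral_distr clamp_meas borel_measurable_continuous_on_restrict f)
    ultimately show ?thesis by simp
  qed
  ultimately show ?thesis using that r by blast
qed

lemma compact_moments: "compact (moments ` M1)"
  unfolding compact_eq_seq_compact_metric seq_compact_def
proof (intro allI impI)
  fix s :: "nat \<Rightarrow> nat \<Rightarrow> real" assume "\<forall>n. s n \<in> moments ` M1"
  then have "\<forall>n. \<exists>\<mu>. \<mu> \<in> M1 \<and> s n = moments \<mu>" by blast
  then obtain \<mu> where \<mu>: "\<And>n. \<mu> n \<in> M1" "\<And>n. s n = moments (\<mu> n)" by metis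
  obtain \<upsilon> and r :: "nat \<Rightarrow> nat" where r: "strict_mono r" "\<upsilon> \<in> M1"
    "\<And>f::real \<Rightarrow> real. continuous_on unit_ivl f \<Longrightarrow> (\<lambda>n. \<integral>x. f x \<partial>\<mu> (r n)) \<longlonglongrightarrow> (\<integral>x. f x \<partial>\<upsilon>)"
    using M1_seq_compact[of \<mu>, OF \<mu>(1)] by blast
  have "((s \<circ> r) \<longlongrightarrow> moments \<upsilon>) sequentially"
  proof -
    have "limitin (product_topology (\<lambda>i. euclidean) UNIV) (s \<circ> r) (moments \<upsilon>) sequentially"
      by (auto simp: \<mu>(2) moments_def limitin_componentwise intro!: r(3) continuous_intros)
    then show ?thesis
      by (simp add: euclidean_product_topology)
  qed
  with r show "\<exists>l\<in>moments ` M1. \<exists>r. strict_mono r \<and> (s \<circ> r) \<longlonglongrightarrow> l" by blast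
qed

text \<open>Weakly open sets are pullbacks along \<open>moments\<close>, so an open cover of
  \<open>M1\<close> gives one of the compact moment set, and a finite subcover pulls back.\<close>

lemma compactin_M1: "compactin weak_topology M1"
  unfolding compactin_def
proof (intro conjI allI impI)
  fix \<U> assume \<U>: "(\<forall>U\<in>\<U>. openin weak_topology U) \<and> M1 \<subseteq> \<Union>\<U>"
  then have "\<forall>U\<in>\<U>. \<exists>V. open V \<and> U = {\<mu> \<in> M1. moments \<mu> \<in> V}"
    using weak_topology_pullback_moments by metis
  then obtain V where V: "\<And>U. U \<in> \<U> \<Longrightarrow> open (V U)" "\<And>U. U \<in> \<U> \<Longrightarrow> U = {\<mu> \<in> M1. moments \<mu> \<in> V U}"
    by metis
  have "moments ` M1 \<subseteq> (\<Union>U\<in>\<U>. V U)" using \<U> V(2) by blast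
  then obtain \<F> where "\<F> \<subseteq> \<U>" "finite \<F>" "moments ` M1 \<subseteq> (\<Union>U\<in>\<F>. V U)"
    using compactE_image[OF compact_moments, of \<U> V] V(1) by metis
  then show "\<exists>\<F>. finite \<F> \<and> \<F> \<subseteq> \<U> \<and> M1 \<subseteq> \<Union>\<F>"
    using V(2) by (intro exI[of _ \<F>]) blast
qed simp

section \<open>Weighted empirical measures\<close>

text \<open>Seen as the image of a density on a finite index set, the set function in the definition
  is countably additive; masses and integrals then follow by change of variables.\<close>

lemma weighted_empirical_eq_distr:
  assumes "\<And>i. i \<in> {1..n} \<Longrightarrow> y i \<in> unit_ivl"
  shows "weighted_empirical n x y =
    distr (density (count_space {1..n}) (\<lambda>i. ennreal (x i))) borel_unit y" (is "_ = ?D")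
proof -
  have y: "y \<in> measurable (density (count_space {1..n}) (\<lambda>i. ennreal (x i))) borel_unit"
    using assms by auto
  have "emeasure ?D A = (\<Sum>i=1..n. ennreal (x i) * emeasure (return borel_unit (y i)) A)"
    if A: "A \<in> sets borel_unit" for A
  proof -
    have "emeasure ?D A = (\<integral>\<^sup>+i. ennreal (x i) * indicator (y -` A \<inter> {1..n}) i \<partial>count_space {1..n})"
      using A by (subst emeasure_distr[OF y]) (auto simp: emeasure_density)
    also have "\<dots> = (\<Sum>i=1..n. ennreal (x i) * emeasure (return borel_unit (y i)) A)"
      using A by (subst nn_integral_count_space_finite) (auto intro!: sum.cong simp: indicator_def)
    finally show ?thesis .
  qed
  note eq = this
  have "weighted_empirical n x y = measure_of (space borel_unit) (sets borel_unit) (emeasure ?D)"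
    unfolding weighted_empirical_def
    by (rule measure_of_eq[OF sets.space_closed]) (simp only: sets.sigma_sets_eq eq)
  also have "\<dots> = measure_of (space ?D) (sets ?D) (emeasure ?D)"
    by (simp only: sets_distr space_distr)
  also have "\<dots> = ?D" by (rule measure_of_of_measure)
  finally show ?thesis .
qed

lemma sets_weighted_empirical [simp]: "sets (weighted_empirical n x y) = sets borel_unit"
  unfolding weighted_empirical_def by (rule sets.sets_measure_of_eq)

text \<open>Weights enter through \<open>ennreal\<close>, which sends negative reals to 0; hence the
  truncation \<open>max 0\<close>.\<close>

lemma integral_weighted_empirical:
  fixes f :: "real \<Rightarrow> real"
  assumes y: "\<And>i. i \<in> {1..n} \<Longrightarrow> y i \<in> unit_ivl" and f: "continuous_on unit_ivl f"
  shows "(\<integral>t. f t \<partial>weighted_empirical n x y) = (\<Sum>i=1..n. max 0 (x i) * f (y i))"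
proof -
  have eq: "weighted_empirical n x y =
      distr (density (count_space {1..n}) (\<lambda>i. ennreal (x i))) borel_unit y"
    using y by (rule weighted_empirical_eq_distr)
  have "(\<integral>t. f t \<partial>weighted_empirical n x y) =
      (\<integral>i. f (y i) \<partial>density (count_space {1..n}) (\<lambda>i. ennreal (x i)))"
    unfolding eq
    using y by (intro integral_distr borel_measurable_continuous_on_restrict f) auto
  also have "density (count_space {1..n}) (\<lambda>i. ennreal (x i)) =
      density (count_space {1..n}) (\<lambda>i. ennreal (max 0 (x i)))"
    by (intro arg_cong[of _ _ "density _"] ext) (simp add: max_def ennreal_neg)
  also have "(\<integral>i. f (y i) \<partial>\<dots>) = (\<Sum>i=1..n. max 0 (x i) * f (y i))"
    by (subst integral_density) (auto simp: lebesgue_integral_count_space_finite)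
  finally show ?thesis .
qed

text \<open>The only obstruction is the total mass. Dirichlet weights are nonnegative with sum 1
  only almost surely, so membership in \<open>M1\<close> has to be an explicit condition on the
  weights.\<close>

lemma weighted_empirical_in_M1_iff:
  assumes y: "\<And>i. i \<in> {1..n} \<Longrightarrow> y i \<in> unit_ivl"
  shows "weighted_empirical n x y \<in> M1 \<longleftrightarrow> (\<Sum>i=1..n. max 0 (x i)) = 1"
proof -
  have eq: "weighted_empirical n x y =
      distr (density (count_space {1..n}) (\<lambda>i. ennreal (x i))) borel_unit y"
    using y by (rule weighted_empirical_eq_distr)
  have "prob_space (weighted_empirical n x y) \<longleftrightarrow>
      emeasure (weighted_empirical n x y) (space (weighted_empirical n x y)) = 1"
    using prob_spaceI prob_space.emeasure_space_1 by blast
  also have "emeasure (weighted_empirical n x y) (space (weighted_empirical n x y)) =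
      (\<integral>\<^sup>+i. ennreal (x i) \<partial>count_space {1..n})"
    unfolding eq
    using y by (subst emeasure_distr)
      (auto simp: emeasure_density sets_restrict_space_iff intro!: nn_integral_cong split: split_indicator)
  also have "\<dots> = (\<Sum>i=1..n. ennreal (max 0 (x i)))"
    by (subst nn_integral_count_space_finite, simp, rule sum.cong) (auto simp: max_def ennreal_neg)
  also have "\<dots> = ennreal (\<Sum>i=1..n. max 0 (x i))"
    by (rule sum_ennreal) simp
  finally show ?thesis
    by (simp add: M1_iff)
qed

section \<open>A continuous partition of unity\<close>

text \<open>For \<open>m \<ge> 1\<close> this is the tent of height 1 at the node
  \<open>l / m\<close> with half-width \<open>1 / m\<close>. As a difference of clamped ramps it
  telescopes when summed over \<open>l\<close>.\<close>

definition hat :: "nat \<Rightarrow> nat \<Rightarrow> real \<Rightarrow> real" where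
  "hat m l x = unit_clamp (real m * x - real l + 1) - unit_clamp (real m * x - real l)"

lemma hat_nonneg: "hat m l x \<ge> 0"
  by (auto simp: hat_def unit_clamp_def)

lemma continuous_on_hat [continuous_intros]: "continuous_on A (hat m l)"
  unfolding hat_def by (intro continuous_intros)

lemma sum_hat:
  assumes "x \<in> unit_ivl"
  shows "(\<Sum>l\<le>m. hat m l x) = 1"
proof -
  define g where "g l = unit_clamp (real m * x - real l + 1)" for l
  have "real m * x \<le> real m" "real m * x \<ge> 0" using assms by (auto simp: mult_left_le)
  then have "g 0 - g (Suc m) = 1"
    by (auto simp: g_def unit_clamp_def)
  moreover have "(\<Sum>l\<le>m. hat m l x) = (\<Sum>l\<le>m. g l - g (Suc l))"
    by (intro sum.cong) (auto simp: hat_def g_def)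
  ultimately show ?thesis by (simp add: sum_telescope)
qed

lemma hat_support: "hat m l x \<noteq> 0 \<Longrightarrow> \<bar>real m * x - real l\<bar> < 1"
  by (auto simp: hat_def unit_clamp_def max_def min_def split: if_splits)

text \<open>Where the hat is nonzero, \<open>x\<close> lies within \<open>1 / m\<close> of the node
  and uniform continuity applies; elsewhere the factor \<open>hat m l x\<close> makes the bound
  trivial.\<close>

lemma hat_interpolation:
  fixes f :: "real \<Rightarrow> real"
  assumes f: "continuous_on unit_ivl f" and "e > 0"
  shows "\<forall>\<^sub>F m in sequentially. \<forall>x\<in>unit_ivl. \<forall>l\<le>m. hat m l x * \<bar>f x - f (real l / real m)\<bar> \<le> hat m l x * e"
proof -
  have "uniformly_continuous_on unit_ivl f"
    using f by (intro compact_uniformly_continuous) auto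
  then obtain d where d: "d > 0"
    "\<And>x x'. x \<in> unit_ivl \<Longrightarrow> x' \<in> unit_ivl \<Longrightarrow> dist x' x < d \<Longrightarrow> dist (f x') (f x) < e"
    using \<open>e > 0\<close> unfolding uniformly_continuous_on_def by metis
  obtain M :: nat where M: "1 / d < real M" using reals_Archimedean2 by blast
  show ?thesis
  proof (rule eventually_sequentiallyI[of M], intro ballI allI impI)
    fix m x l assume *: "M \<le> m" "x \<in> unit_ivl" "l \<le> m"
    have m: "1 / d < real m" using M *(1) by linarith
    moreover have "1 / d > 0" using d(1) by simp
    ultimately have m0: "real m > 0" by linarith
    show "hat m l x * \<bar>f x - f (real l / real m)\<bar> \<le> hat m l x * e"
    proof (cases "hat m l x = 0")
      case False
      then have "\<bar>real m * x - real l\<bar> < 1" by (rule hat_support)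
      then have "real m * \<bar>x - real l / real m\<bar> < 1"
        using m0 by (simp add: abs_mult_pos' right_diff_distrib flip: abs_mult)
      also have "\<dots> < real m * d" using m m0 d(1) by (simp add: field_simps)
      finally have "dist x (real l / real m) < d" using m0 by (simp add: dist_real_def)
      then have "dist (f x) (f (real l / real m)) < e"
        using * m0 by (intro d) auto
      then show ?thesis by (intro mult_left_mono hat_nonneg) (simp add: dist_real_def)
    qed simp
  qed
qed

text \<open>The sum is the integral of the interpolant of \<open>f\<close> at the nodes, which
  converges to \<open>f\<close> uniformly.\<close>

lemma integral_hat_interpolation:
  fixes f :: "real \<Rightarrow> real"
  assumes \<mu>: "\<mu> \<in> M1" and f: "continuous_on unit_ivl f"
  shows "(\<lambda>m. \<Sum>l\<le>m. (\<integral>x. hat m l x \<partial>\<mu>) * f (real l / real m)) \<longlonglongrightarrow> (\<integral>x. f x \<partial>\<mu>)"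
proof (rule tendstoI)
  fix e :: real assume "e > 0"
  then have "e / 2 > 0" by simp
  from hat_interpolation[OF f this]
  show "\<forall>\<^sub>F m in sequentially. dist (\<Sum>l\<le>m. (\<integral>x. hat m l x \<partial>\<mu>) * f (real l / real m)) (\<integral>x. f x \<partial>\<mu>) < e"
  proof eventually_elim
    case (elim m)
    have "(\<Sum>l\<le>m. (\<integral>x. hat m l x \<partial>\<mu>) * f (real l / real m)) =
        (\<integral>x. (\<Sum>l\<le>m. hat m l x * f (real l / real m)) \<partial>\<mu>)"
      using \<mu> by (subst Bochner_Integration.integral_sum) (auto intro!: M1_integrable continuous_intros)
    moreover have "\<bar>(\<integral>x. (\<Sum>l\<le>m. hat m l x * f (real l / real m)) \<partial>\<mu>) - (\<integral>x. f x \<partial>\<mu>)\<bar> \<le> e / 2"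
    proof (intro M1_integral_dist_le[OF \<mu>] f)
      fix x assume x: "x \<in> unit_ivl"
      have "(\<Sum>l\<le>m. hat m l x * f (real l / real m)) - f x =
          (\<Sum>l\<le>m. hat m l x * (f (real l / real m) - f x))"
        using sum_hat[OF x, of m] by (simp add: right_diff_distrib sum_subtractf flip: sum_distrib_right)
      also have "\<bar>\<dots>\<bar> \<le> (\<Sum>l\<le>m. hat m l x * \<bar>f x - f (real l / real m)\<bar>)"
        by (rule sum_abs[THEN order_trans]) (simp add: abs_mult hat_nonneg abs_minus_commute)
      also have "\<dots> \<le> (\<Sum>l\<le>m. hat m l x * (e / 2))"
        using elim x by (intro sum_mono) auto
      also have "\<dots> = e / 2" using sum_hat[OF x, of m] by (simp flip: sum_distrib_right sum_divide_distrib)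
      finally show "\<bar>(\<Sum>l\<le>m. hat m l x * f (real l / real m)) - f x\<bar> \<le> e / 2" .
    qed (auto intro!: continuous_intros)
    ultimately show ?case using \<open>e > 0\<close> by (simp add: dist_real_def)
  qed
qed

lemma sum_integral_hat: "\<mu> \<in> M1 \<Longrightarrow> (\<Sum>l\<le>m. (\<integral>x. hat m l x \<partial>\<mu>)) = 1"
proof -
  assume \<mu>: "\<mu> \<in> M1"
  have "(\<Sum>l\<le>m. (\<integral>x. hat m l x \<partial>\<mu>)) = (\<integral>x. (\<Sum>l\<le>m. hat m l x) \<partial>\<mu>)"
    using \<mu> by (subst Bochner_Integration.integral_sum) (auto intro!: M1_integrable continuous_intros)
  also have "\<dots> = (\<integral>x. 1 \<partial>\<mu>)"
    by (intro Bochner_Integration.integral_cong refl sum_hat) (simp add: M1_space[OF \<mu>])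
  finally show ?thesis using \<mu> by simp
qed

lemma integral_hat_nonneg: "0 \<le> (\<integral>x. hat m l x \<partial>\<mu>)"
  by (intro integral_nonneg_AE) (simp add: hat_nonneg)

section \<open>Elementary inequalities\<close>

text \<open>Cauchy-Schwarz for \<open>sqrt (w i * c i)\<close> and \<open>sqrt (w i / c i)\<close>.
  It serves to compare the interpolant of \<open>1 / c\<close> with the reciprocal of the
  interpolant of \<open>c\<close>.\<close>

lemma sum_mult_sum_inverse_ge:
  fixes w c :: "'i \<Rightarrow> real"
  assumes "\<And>i. i \<in> I \<Longrightarrow> w i \<ge> 0" "\<And>i. i \<in> I \<Longrightarrow> c i > 0" "(\<Sum>i\<in>I. w i) = 1"
  shows "1 \<le> (\<Sum>i\<in>I. w i * c i) * (\<Sum>i\<in>I. w i / c i)"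
proof -
  have "(\<Sum>i\<in>I. w i) = (\<Sum>i\<in>I. sqrt (w i * c i) * sqrt (w i / c i))"
    using assms by (intro sum.cong refl) (force simp flip: real_sqrt_mult)
  also have "\<dots>\<^sup>2 \<le> (\<Sum>i\<in>I. (sqrt (w i * c i))\<^sup>2) * (\<Sum>i\<in>I. (sqrt (w i / c i))\<^sup>2)"
    by (rule Cauchy_Schwarz_ineq_sum)
  also have "\<dots> = (\<Sum>i\<in>I. w i * c i) * (\<Sum>i\<in>I. w i / c i)"
    using assms by (intro arg_cong2[of _ _ _ _ "(*)"] sum.cong) (auto simp: less_imp_le)
  finally show ?thesis using assms(3) by simp
qed

text \<open>Concavity of the square root, obtained from Cauchy-Schwarz for \<open>sqrt (w i)\<close>
  and \<open>sqrt (w i * c i)\<close>.\<close>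

lemma sum_sqrt_le_sqrt_sum:
  fixes w c :: "'i \<Rightarrow> real"
  assumes "\<And>i. i \<in> I \<Longrightarrow> w i \<ge> 0" "\<And>i. i \<in> I \<Longrightarrow> c i \<ge> 0" "(\<Sum>i\<in>I. w i) = 1"
  shows "(\<Sum>i\<in>I. w i * sqrt (c i)) \<le> sqrt (\<Sum>i\<in>I. w i * c i)"
proof (rule real_le_rsqrt)
  have "(\<Sum>i\<in>I. w i * sqrt (c i)) = (\<Sum>i\<in>I. sqrt (w i) * sqrt (w i * c i))"
    using assms by (intro sum.cong refl) (auto simp: real_sqrt_mult)
  also have "\<dots>\<^sup>2 \<le> (\<Sum>i\<in>I. (sqrt (w i))\<^sup>2) * (\<Sum>i\<in>I. (sqrt (w i * c i))\<^sup>2)"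
    by (rule Cauchy_Schwarz_ineq_sum)
  also have "\<dots> = (\<Sum>i\<in>I. w i) * (\<Sum>i\<in>I. w i * c i)"
    using assms by (intro arg_cong2[of _ _ _ _ "(*)"] sum.cong) auto
  finally show "(\<Sum>i\<in>I. w i * sqrt (c i))\<^sup>2 \<le> (\<Sum>i\<in>I. w i * c i)" using assms(3) by simp
qed

text \<open>Jensen's inequality, from the tangent to \<open>exp\<close> at the weighted mean
  \<open>T\<close>.\<close>

lemma exp_sum_le_sum_exp:
  fixes w t :: "'i \<Rightarrow> real"
  assumes "\<And>i. i \<in> I \<Longrightarrow> w i \<ge> 0" "(\<Sum>i\<in>I. w i) = 1"
  shows "exp (\<Sum>i\<in>I. w i * t i) \<le> (\<Sum>i\<in>I. w i * exp (t i))"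
proof -
  define T where "T = (\<Sum>i\<in>I. w i * t i)"
  have "(\<Sum>i\<in>I. w i * (exp T * (1 + (t i - T)))) =
      (\<Sum>i\<in>I. exp T * (w i + w i * t i - T * w i))"
    by (intro sum.cong) (auto simp: algebra_simps)
  also have "\<dots> = exp T * (sum w I + T - T * sum w I)"
    by (simp add: sum.distrib sum_subtractf T_def flip: sum_distrib_left)
  finally have "exp T = (\<Sum>i\<in>I. w i * (exp T * (1 + (t i - T))))" using assms(2) by simp
  also have "\<dots> \<le> (\<Sum>i\<in>I. w i * (exp T * exp (t i - T)))"
    using assms by (intro sum_mono mult_left_mono exp_ge_add_one_self) auto
  also have "\<dots> = (\<Sum>i\<in>I. w i * exp (t i))"
    by (simp flip: exp_add)
  finally show ?thesis by (simp add: T_def)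
qed

section \<open>The rate function\<close>

lemma relative_entropy_ge:
  assumes "continuous_on unit_ivl f"
  shows "ereal ((\<integral>x. f x \<partial>\<mu>) - ln (\<integral>x. exp (f x) \<partial>\<nu>)) \<le> relative_entropy \<mu> \<nu>"
  unfolding relative_entropy_def using assms by (intro SUP_upper) (simp add: C_unit_def)

lemma relative_entropy_nonneg:
  assumes "\<nu> \<in> M1"
  shows "0 \<le> relative_entropy \<mu> \<nu>"
  using relative_entropy_ge[of "\<lambda>_. 0" \<mu> \<nu>] assms by (simp add: zero_ereal_def)

lemma J_nonneg:
  assumes "\<mu> \<in> M1" "\<nu> \<in> M1"
  shows "0 \<le> J \<mu> \<nu>"
  unfolding J_def using assms by (intro INF_greatest add_nonneg_nonneg relative_entropy_nonneg)

text \<open>The integrals of \<open>ln h\<close> and \<open>- ln h\<close> against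
  \<open>\<upsilon>\<close> cancel in the sum of the two entropies, so what remains survives the
  infimum over \<open>\<upsilon>\<close>.\<close>

lemma J_ge:
  fixes h :: "real \<Rightarrow> real"
  assumes \<mu>: "\<mu> \<in> M1" and \<nu>: "\<nu> \<in> M1"
    and h: "continuous_on unit_ivl h" "\<And>x. x \<in> unit_ivl \<Longrightarrow> h x > 0"
  shows "ereal (- ln (\<integral>x. h x \<partial>\<mu>) - ln (\<integral>x. 1 / h x \<partial>\<nu>)) \<le> J \<mu> \<nu>"
  unfolding J_def
proof (rule INF_greatest)
  fix \<upsilon> assume \<upsilon>: "\<upsilon> \<in> M1"
  have c: "continuous_on unit_ivl (\<lambda>x. ln (h x))"
    using h by (intro continuous_intros) force+
  have "ereal ((\<integral>x. ln (h x) \<partial>\<upsilon>) - ln (\<integral>x. exp (ln (h x)) \<partial>\<mu>)) \<le> relative_entropy \<upsilon> \<mu>"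
    by (intro relative_entropy_ge c)
  moreover have "ereal ((\<integral>x. - ln (h x) \<partial>\<upsilon>) - ln (\<integral>x. exp (- ln (h x)) \<partial>\<nu>)) \<le> relative_entropy \<upsilon> \<nu>"
    by (intro relative_entropy_ge continuous_intros c)
  moreover have "(\<integral>x. exp (ln (h x)) \<partial>\<mu>) = (\<integral>x. h x \<partial>\<mu>)"
    using h by (intro Bochner_Integration.integral_cong refl) (simp add: M1_space[OF \<mu>])
  moreover have "(\<integral>x. exp (- ln (h x)) \<partial>\<nu>) = (\<integral>x. 1 / h x \<partial>\<nu>)"
    using h by (intro Bochner_Integration.integral_cong refl)
      (simp add: M1_space[OF \<nu>] exp_minus inverse_eq_divide)
  ultimately have "ereal ((\<integral>x. ln (h x) \<partial>\<upsilon>) - ln (\<integral>x. h x \<partial>\<mu>)) +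
      ereal ((\<integral>x. - ln (h x) \<partial>\<upsilon>) - ln (\<integral>x. 1 / h x \<partial>\<nu>)) \<le> relative_entropy \<upsilon> \<mu> + relative_entropy \<upsilon> \<nu>"
    by (intro add_mono) simp_all
  then show "ereal (- ln (\<integral>x. h x \<partial>\<mu>) - ln (\<integral>x. 1 / h x \<partial>\<nu>)) \<le> relative_entropy \<upsilon> \<mu> + relative_entropy \<upsilon> \<nu>"
    by simp
qed

section \<open>The discretised Hellinger affinity and its relation to \<open>J\<close>\<close>

locale reference_law =
  fixes \<nu> :: "real measure"
  assumes \<nu>: "\<nu> \<in> M1"

locale full_support = reference_law +
  assumes support: "topological_support \<nu> = unit_ivl"
begin

text \<open>The hat is at least 1/2 on the neighbourhood \<open>U\<close> of its node, and the node
  is a point of the support, so \<open>U\<close> has positive mass.\<close>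

lemma integral_hat_pos:
  assumes "m \<ge> 1" "l \<le> m"
  shows "0 < (\<integral>x. hat m l x \<partial>\<nu>)"
proof -
  interpret prob_space \<nu> using \<nu> by (rule M1_prob_space)
  define U where "U = {x. \<bar>real m * x - real l\<bar> < 1 / 2}"
  have U: "open U"
    unfolding U_def by (intro open_Collect_less continuous_intros)
  have x: "real l / real m \<in> unit_ivl" "real l / real m \<in> U"
    using assms by (auto simp: U_def)
  then have "real l / real m \<in> topological_support \<nu>" by (simp add: support)
  then have "emeasure \<nu> (U \<inter> space \<nu>) > 0"
    unfolding topological_support_def using U x(2) by blast
  moreover have sets: "U \<inter> space \<nu> \<in> sets \<nu>"
    using U by (auto simp: M1_sets[OF \<nu>] M1_space[OF \<nu>] sets_restrict_space_iff)
  ultimately have "measure \<nu> (U \<inter> space \<nu>) > 0"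
    by (simp add: emeasure_eq_measure)
  then have "0 < (\<integral>x. (1 / 2 :: real) * indicator (U \<inter> space \<nu>) x \<partial>\<nu>)"
    using sets by simp
  also have "\<dots> \<le> (\<integral>x. hat m l x \<partial>\<nu>)"
  proof (rule integral_mono)
    show "integrable \<nu> (hat m l)" by (intro M1_integrable[OF \<nu>] continuous_intros)
    fix x assume "x \<in> space \<nu>"
    show "(1 / 2 :: real) * indicator (U \<inter> space \<nu>) x \<le> hat m l x"
      by (auto simp: hat_nonneg U_def hat_def unit_clamp_def max_def min_def field_simps split: split_indicator)
  next
    show "integrable \<nu> (\<lambda>x. (1 / 2 :: real) * indicator (U \<inter> space \<nu>) x)"
      using sets by (intro integrable_mult_right integrable_real_indicator) (auto simp: less_top[symmetric])
  qed
  finally show ?thesis .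
qed

definition hat_affinity :: "nat \<Rightarrow> real measure \<Rightarrow> real" where
  "hat_affinity m \<mu> = (\<Sum>l\<le>m. sqrt ((\<integral>x. hat m l x \<partial>\<mu>) * (\<integral>x. hat m l x \<partial>\<nu>)))"

lemma hat_affinity_pos:
  assumes \<mu>: "\<mu> \<in> M1" and m: "m \<ge> 1"
  shows "hat_affinity m \<mu> > 0"
proof -
  have "\<exists>l\<in>{..m}. (\<integral>x. hat m l x \<partial>\<mu>) \<noteq> 0"
    using sum_integral_hat[OF \<mu>, of m] by (metis sum.neutral zero_neq_one)
  then obtain l where l: "l \<le> m" "(\<integral>x. hat m l x \<partial>\<mu>) \<noteq> 0" by auto
  then have "(\<integral>x. hat m l x \<partial>\<mu>) > 0" using integral_hat_nonneg[of \<mu> m l] by linarith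
  then show ?thesis
    unfolding hat_affinity_def using l integral_hat_pos[OF m l(1)]
    by (intro sum_pos2[of _ l]) (auto intro!: mult_nonneg_nonneg integral_hat_nonneg)
qed

lemma hat_affinity_imp_test_function:
  assumes \<mu>: "\<mu> \<in> M1" and m: "m \<ge> 1" and a: "a < - 2 * ln (hat_affinity m \<mu>)"
  obtains h where "continuous_on unit_ivl h" "\<And>x. x \<in> unit_ivl \<Longrightarrow> h x > 0"
    "a < - ln (\<integral>x. h x \<partial>\<mu>) - ln (\<integral>x. 1 / h x \<partial>\<nu>)"
proof -
  define A where "A = hat_affinity m \<mu>"
  have A: "A > 0" using hat_affinity_pos[OF \<mu> m] by (simp add: A_def)
  define p where "p l = (\<integral>x. hat m l x \<partial>\<mu>)" for l
  define q where "q l = (\<integral>x. hat m l x \<partial>\<nu>)" for l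
  have p: "p l \<ge> 0" for l by (simp add: p_def integral_hat_nonneg)
  have q: "q l > 0" if "l \<le> m" for l using integral_hat_pos[OF m that] by (simp add: q_def)
  have "A < exp (- a / 2)"
  proof -
    have "ln A < - a / 2" using a by (simp add: A_def)
    then show ?thesis using A by (metis exp_less_cancel_iff exp_ln)
  qed
  \<comment> \<open>Half the gap, so that \<open>A + \<delta>\<close> stays below
    \<open>exp (- a / 2)\<close>.\<close>
  define \<delta> where "\<delta> = (exp (- a / 2) - A) / 2"
  have \<delta>: "\<delta> > 0" "A + \<delta> < exp (- a / 2)"
    using \<open>A < exp (- a / 2)\<close> by (simp_all add: \<delta>_def field_simps)
  \<comment> \<open>A hat may carry no mass of \<open>\<mu>\<close>, and \<open>q l / p l\<close>
    would be meaningless. Adding \<open>\<delta>\<^sup>2 * q l\<close> cures this and raises the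
    affinity by at most \<delta>, because the square root is subadditive and the \<open>q l\<close>
    sum to 1.\<close>
  define p' where "p' l = p l + \<delta>\<^sup>2 * q l" for l
  have p': "p' l > 0" "p l \<le> p' l" if "l \<le> m" for l
    using p[of l] q[OF that] \<delta> by (auto simp: p'_def intro!: add_nonneg_pos)
  define c where "c l = sqrt (q l / p' l)" for l
  have c: "c l > 0" if "l \<le> m" for l using p'[OF that] q[OF that] by (simp add: c_def)
  have A': "(\<Sum>l\<le>m. sqrt (p' l * q l)) \<le> A + \<delta>"
  proof -
    have "sqrt (p' l * q l) \<le> sqrt (p l * q l) + \<delta> * q l" if "l \<le> m" for l
    proof -
      have "sqrt (p' l * q l) = sqrt (p l * q l + (\<delta> * q l)\<^sup>2)"
        by (simp add: p'_def algebra_simps power2_eq_square)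
      also have "\<dots> \<le> sqrt (p l * q l) + sqrt ((\<delta> * q l)\<^sup>2)"
        using p[of l] q[OF that] by (intro sqrt_add_le_add_sqrt) auto
      also have "sqrt ((\<delta> * q l)\<^sup>2) = \<delta> * q l" using q[OF that] \<delta> by simp
      finally show ?thesis .
    qed
    then have "(\<Sum>l\<le>m. sqrt (p' l * q l)) \<le> (\<Sum>l\<le>m. sqrt (p l * q l) + \<delta> * q l)"
      by (intro sum_mono) auto
    also have "\<dots> = A + \<delta> * (\<Sum>l\<le>m. q l)"
      by (simp add: sum.distrib A_def hat_affinity_def p_def q_def sum_distrib_left)
    finally show ?thesis using sum_integral_hat[OF \<nu>, of m] by (simp add: q_def)
  qed
  \<comment> \<open>\<open>h\<close> and \<open>h'\<close> interpolate \<open>c\<close> and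
    \<open>1 / c\<close>. Cauchy-Schwarz gives \<open>1 / h \<le> h'\<close>, and the choice of
    \<open>c\<close> bounds the integral of \<open>h\<close> against \<open>\<mu>\<close> and that
    of \<open>h'\<close> against \<open>\<nu>\<close> by the same sum of
    \<open>sqrt (p' l * q l)\<close>.\<close>
  define h where "h x = (\<Sum>l\<le>m. hat m l x * c l)" for x
  define h' where "h' x = (\<Sum>l\<le>m. hat m l x / c l)" for x
  have cont: "continuous_on unit_ivl h" "continuous_on unit_ivl h'"
    unfolding h_def h'_def divide_inverse by (intro continuous_intros)+
  have hh': "h x > 0" "1 / h x \<le> h' x" if "x \<in> unit_ivl" for x
  proof -
    have "1 \<le> h x * h' x"
      unfolding h_def h'_def using c sum_hat[OF that, of m]
      by (intro sum_mult_sum_inverse_ge) (auto simp: hat_nonneg)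
    moreover have "h x \<ge> 0"
      unfolding h_def using c by (intro sum_nonneg mult_nonneg_nonneg) (auto simp: hat_nonneg less_imp_le)
    ultimately show "h x > 0" by (cases "h x = 0") auto
    then show "1 / h x \<le> h' x" using \<open>1 \<le> h x * h' x\<close> by (simp add: field_simps)
  qed
  have pos: "(\<integral>x. h x \<partial>\<mu>) > 0" "(\<integral>x. 1 / h x \<partial>\<nu>) > 0"
    using hh' by (intro M1_integral_pos \<mu> \<nu> continuous_intros cont; force)+
  have "(\<integral>x. h x \<partial>\<mu>) = (\<Sum>l\<le>m. p l * c l)"
    unfolding h_def p_def using \<mu>
    by (subst Bochner_Integration.integral_sum) (auto intro!: M1_integrable continuous_intros)
  also have "\<dots> \<le> (\<Sum>l\<le>m. sqrt (p' l * q l))"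
  proof (intro sum_mono)
    fix l assume "l \<in> {..m}"
    then have l: "l \<le> m" by simp
    have "p l * c l \<le> p' l * c l" using p'[OF l] c[OF l] by simp
    also have "\<dots> = sqrt (p' l * q l)"
      using p'(1)[OF l] q[OF l] by (simp add: c_def real_sqrt_divide real_sqrt_mult field_simps)
    finally show "p l * c l \<le> sqrt (p' l * q l)" .
  qed
  finally have 1: "(\<integral>x. h x \<partial>\<mu>) < exp (- a / 2)" using A' \<delta> by linarith
  have "(\<integral>x. 1 / h x \<partial>\<nu>) \<le> (\<integral>x. h' x \<partial>\<nu>)"
    using hh' by (intro M1_integral_mono \<nu> continuous_intros cont) force+
  also have "\<dots> = (\<Sum>l\<le>m. q l / c l)"
    unfolding h'_def q_def using \<nu>
    by (subst Bochner_Integration.integral_sum)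
       (auto intro!: M1_integrable continuous_intros simp: divide_inverse)
  also have "\<dots> = (\<Sum>l\<le>m. sqrt (p' l * q l))"
  proof (intro sum.cong refl)
    fix l assume "l \<in> {..m}"
    then have l: "l \<le> m" by simp
    then show "q l / c l = sqrt (p' l * q l)"
      using p'(1)[OF l] q[OF l] by (simp add: c_def real_sqrt_divide real_sqrt_mult field_simps)
  qed
  finally have 2: "(\<integral>x. 1 / h x \<partial>\<nu>) < exp (- a / 2)" using A' \<delta> by linarith
  have "ln (\<integral>x. h x \<partial>\<mu>) < - a / 2" "ln (\<integral>x. 1 / h x \<partial>\<nu>) < - a / 2"
    using 1 2 pos by (metis ln_exp ln_less_cancel_iff exp_gt_zero)+
  then have "a < - ln (\<integral>x. h x \<partial>\<mu>) - ln (\<integral>x. 1 / h x \<partial>\<nu>)" by linarith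
  then show ?thesis using that cont(1) hh'(1) by blast
qed

lemma J_ge_hat_affinity:
  assumes \<mu>: "\<mu> \<in> M1" and m: "m \<ge> 1"
  shows "ereal (- 2 * ln (hat_affinity m \<mu>)) \<le> J \<mu> \<nu>"
proof (rule ccontr)
  assume "\<not> ?thesis"
  then have less: "J \<mu> \<nu> < ereal (- 2 * ln (hat_affinity m \<mu>))" by simp
  with J_nonneg[OF \<mu> \<nu>] obtain j where j: "J \<mu> \<nu> = ereal j"
    by (cases "J \<mu> \<nu>") auto
  with less have "j < - 2 * ln (hat_affinity m \<mu>)" by simp
  from hat_affinity_imp_test_function[OF \<mu> m this]
  obtain h where "continuous_on unit_ivl h" "\<And>x. x \<in> unit_ivl \<Longrightarrow> h x > 0"
    "j < - ln (\<integral>x. h x \<partial>\<mu>) - ln (\<integral>x. 1 / h x \<partial>\<nu>)" by metis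
  with J_ge[OF \<mu> \<nu> this(1,2)] j show False by simp
qed

lemma J_le:
  assumes \<mu>: "\<mu> \<in> M1" and r: "\<And>m. m \<ge> 1 \<Longrightarrow> - 2 * ln (hat_affinity m \<mu>) \<le> r"
  shows "J \<mu> \<nu> \<le> ereal r"
proof -
  define p where "p m l = (\<integral>x. hat m l x \<partial>\<mu>)" for m l
  define q where "q m l = (\<integral>x. hat m l x \<partial>\<nu>)" for m l
  have pq: "p m l \<ge> 0" "q m l \<ge> 0" for m l by (simp_all add: p_def q_def integral_hat_nonneg)
  define u where "u m l = sqrt (p m l * q m l) / hat_affinity m \<mu>" for m l
  have A: "hat_affinity m \<mu> > 0" if "m \<ge> 1" for m using hat_affinity_pos[OF \<mu> that] .
  have u: "u m l \<ge> 0" if "m \<ge> 1" for m l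
    using A[OF that] pq by (simp add: u_def)
  have sum_u: "(\<Sum>l\<le>m. u m l) = 1" if "m \<ge> 1" for m
    using A[OF that] by (simp add: u_def hat_affinity_def p_def q_def flip: sum_divide_distrib)
  \<comment> \<open>\<open>weighted_empirical\<close> counts its points from 1, so node
    \<open>l\<close> has index \<open>l + 1\<close>; the level \<open>Suc n\<close> is never 0 and
    has \<open>Suc (Suc n)\<close> nodes.\<close>
  define \<upsilon> where "\<upsilon> n = weighted_empirical (Suc (Suc n)) (\<lambda>i. u (Suc n) (i - 1)) (\<lambda>i. real (i - 1) / real (Suc n))" for n
  have reindex: "(\<Sum>i=1..Suc m. g (i - 1)) = (\<Sum>l\<le>m. g l)" for m and g :: "nat \<Rightarrow> real"
    by (rule sum.reindex_bij_witness[of _ Suc "\<lambda>i. i - 1"]) auto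
  have unit: "real (i - 1) / real (Suc n) \<in> unit_ivl" if "i \<in> {1..Suc (Suc n)}" for i n
    using that by auto
  have \<upsilon>_M1: "\<upsilon> n \<in> M1" for n
    unfolding \<upsilon>_def using reindex[of "\<lambda>l. max 0 (u (Suc n) l)" "Suc n"] sum_u[of "Suc n"] u[of "Suc n"]
    by (subst weighted_empirical_in_M1_iff[OF unit]) (auto simp: max_absorb2)
  have \<upsilon>_integral: "(\<integral>x. f x \<partial>\<upsilon> n) = (\<Sum>l\<le>Suc n. u (Suc n) l * f (real l / real (Suc n)))"
    if "continuous_on unit_ivl f" for f n
    unfolding \<upsilon>_def
    using reindex[of "\<lambda>l. max 0 (u (Suc n) l) * f (real l / real (Suc n))" "Suc n"] u[of "Suc n"]
    by (subst integral_weighted_empirical[OF unit that]) (auto simp: max_absorb2)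
  obtain v and s :: "nat \<Rightarrow> nat" where s: "strict_mono s" and v: "v \<in> M1" and
    conv: "\<And>f::real \<Rightarrow> real. continuous_on unit_ivl f \<Longrightarrow> (\<lambda>n. \<integral>x. f x \<partial>\<upsilon> (s n)) \<longlonglongrightarrow> (\<integral>x. f x \<partial>v)"
    using M1_seq_compact[of \<upsilon>, OF \<upsilon>_M1] by blast
  \<comment> \<open>The bound is proved for each pair of test functions before any supremum is
    taken: first at a fixed level, then in the limit along the subsequence.\<close>
  have key: "(\<integral>x. \<psi> x \<partial>v) - ln (\<integral>x. exp (\<psi> x) \<partial>\<mu>) + ((\<integral>x. \<phi> x \<partial>v) - ln (\<integral>x. exp (\<phi> x) \<partial>\<nu>)) \<le> r"
    if \<phi>: "continuous_on unit_ivl \<phi>" and \<psi>: "continuous_on unit_ivl \<psi>" for \<phi> \<psi>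
  proof -
    define a where "a m = (\<Sum>l\<le>m. p m l * exp (\<psi> (real l / real m)))" for m
    define b where "b m = (\<Sum>l\<le>m. q m l * exp (\<phi> (real l / real m)))" for m
    have lim_a: "a \<longlonglongrightarrow> (\<integral>x. exp (\<psi> x) \<partial>\<mu>)"
      unfolding a_def p_def using \<psi> by (intro integral_hat_interpolation \<mu> continuous_intros)
    have lim_b: "b \<longlonglongrightarrow> (\<integral>x. exp (\<phi> x) \<partial>\<nu>)"
      unfolding b_def q_def using \<phi> by (intro integral_hat_interpolation \<nu> continuous_intros)
    have pos: "(\<integral>x. exp (\<psi> x) \<partial>\<mu>) > 0" "(\<integral>x. exp (\<phi> x) \<partial>\<nu>) > 0"
      using \<phi> \<psi> by (auto intro!: M1_integral_pos \<mu> \<nu> continuous_intros)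
    have le: "(\<integral>x. \<psi> x \<partial>\<upsilon> n) + (\<integral>x. \<phi> x \<partial>\<upsilon> n) \<le> ln (a (Suc n)) + ln (b (Suc n)) + r" for n
    proof -
      define m where "m = Suc n"
      have m: "m \<ge> 1" by (simp add: m_def)
      \<comment> \<open>Half the sum, since \<open>exp (t l)\<close> then splits into the square
        roots of \<open>exp \<psi>\<close> and \<open>exp \<phi>\<close> at the node; Cauchy-Schwarz
        keeps the first with \<open>p\<close> and the second with \<open>q\<close>.\<close>
      define t where "t l = (\<psi> (real l / real m) + \<phi> (real l / real m)) / 2" for l
      define T where "T = (\<Sum>l\<le>m. u m l * t l)"
      have "exp T \<le> (\<Sum>l\<le>m. u m l * exp (t l))"
        unfolding T_def using u[OF m] sum_u[OF m] by (intro exp_sum_le_sum_exp) auto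
      then have "(hat_affinity m \<mu> * exp T)\<^sup>2 \<le> (hat_affinity m \<mu> * (\<Sum>l\<le>m. u m l * exp (t l)))\<^sup>2"
        using A[OF m] by (intro power_mono mult_left_mono) auto
      also have "hat_affinity m \<mu> * (\<Sum>l\<le>m. u m l * exp (t l)) =
          (\<Sum>l\<le>m. sqrt (p m l * exp (\<psi> (real l / real m))) * sqrt (q m l * exp (\<phi> (real l / real m))))"
        unfolding sum_distrib_left
      proof (intro sum.cong refl)
        fix l
        have "exp (t l) = sqrt (exp (\<psi> (real l / real m)) * exp (\<phi> (real l / real m)))"
          by (rule real_sqrt_unique[symmetric]) (simp_all add: t_def power2_eq_square flip: exp_add)
        then show "hat_affinity m \<mu> * (u m l * exp (t l)) =
          sqrt (p m l * exp (\<psi> (real l / real m))) * sqrt (q m l * exp (\<phi> (real l / real m)))"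
          using A[OF m] by (simp add: u_def real_sqrt_mult)
      qed
      also have "\<dots>\<^sup>2 \<le> (\<Sum>l\<le>m. (sqrt (p m l * exp (\<psi> (real l / real m))))\<^sup>2) *
          (\<Sum>l\<le>m. (sqrt (q m l * exp (\<phi> (real l / real m))))\<^sup>2)"
        by (rule Cauchy_Schwarz_ineq_sum)
      also have "\<dots> = a m * b m"
        using pq by (simp add: a_def b_def)
      finally have ab: "(hat_affinity m \<mu> * exp T)\<^sup>2 \<le> a m * b m" .
      have "a m \<ge> 0" "b m \<ge> 0" using pq by (auto simp: a_def b_def intro!: sum_nonneg)
      moreover have sq: "(hat_affinity m \<mu> * exp T)\<^sup>2 > 0" using A[OF m] by simp
      ultimately have ab_pos: "a m > 0" "b m > 0"
        using ab by (metis less_le_trans mult_zero_left mult_zero_right less_eq_real_def order.irrefl)+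
      have "ln ((hat_affinity m \<mu> * exp T)\<^sup>2) \<le> ln (a m * b m)"
        using ab sq by (subst ln_le_cancel_iff; linarith)
      then have "2 * ln (hat_affinity m \<mu>) + 2 * T \<le> ln (a m) + ln (b m)"
        using A[OF m] ab_pos by (simp add: ln_mult ln_realpow)
      moreover have "2 * T = (\<integral>x. \<psi> x \<partial>\<upsilon> n) + (\<integral>x. \<phi> x \<partial>\<upsilon> n)"
        unfolding \<upsilon>_integral[OF \<phi>] \<upsilon>_integral[OF \<psi>] T_def t_def m_def sum_distrib_left
          sum.distrib[symmetric]
        by (intro sum.cong refl) (simp add: algebra_simps)
      ultimately show ?thesis using r[OF m] by (simp add: m_def)
    qed
    have suc: "filterlim (\<lambda>n. Suc (s n)) sequentially sequentially"
      using s by (intro filterlim_subseq) (auto simp: strict_mono_def)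
    have "(\<integral>x. \<psi> x \<partial>v) + (\<integral>x. \<phi> x \<partial>v) \<le> ln (\<integral>x. exp (\<psi> x) \<partial>\<mu>) + ln (\<integral>x. exp (\<phi> x) \<partial>\<nu>) + r"
    proof (rule LIMSEQ_le)
      show "(\<lambda>n. (\<integral>x. \<psi> x \<partial>\<upsilon> (s n)) + (\<integral>x. \<phi> x \<partial>\<upsilon> (s n))) \<longlonglongrightarrow> (\<integral>x. \<psi> x \<partial>v) + (\<integral>x. \<phi> x \<partial>v)"
        by (intro tendsto_add conv \<phi> \<psi>)
      show "(\<lambda>n. ln (a (Suc (s n))) + ln (b (Suc (s n))) + r) \<longlonglongrightarrow>
          ln (\<integral>x. exp (\<psi> x) \<partial>\<mu>) + ln (\<integral>x. exp (\<phi> x) \<partial>\<nu>) + r"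
        using pos
        by (intro tendsto_add tendsto_ln tendsto_const filterlim_compose[OF lim_a suc] filterlim_compose[OF lim_b suc]) auto
    qed (use le in blast)
    then show ?thesis by linarith
  qed
  have "relative_entropy v \<mu> + relative_entropy v \<nu> \<le> ereal r"
  proof -
    \<comment> \<open>Separating the suprema: for fixed \<open>\<phi>\<close> the supremum over
      \<open>\<psi>\<close> is the entropy relative to \<open>\<mu>\<close>. Taking
      \<open>\<phi> = 0\<close> shows that it is finite, so it can be moved to the other side before
      \<open>\<phi>\<close> varies.\<close>
    have "relative_entropy v \<mu> \<le> ereal r - ereal ((\<integral>x. \<phi> x \<partial>v) - ln (\<integral>x. exp (\<phi> x) \<partial>\<nu>))"
      if \<phi>: "continuous_on unit_ivl \<phi>" for \<phi>
      unfolding relative_entropy_def[of v \<mu>]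
    proof (rule SUP_least)
      fix \<psi> assume "\<psi> \<in> C_unit"
      then show "ereal ((\<integral>x. \<psi> x \<partial>v) - ln (\<integral>x. exp (\<psi> x) \<partial>\<mu>)) \<le>
          ereal r - ereal ((\<integral>x. \<phi> x \<partial>v) - ln (\<integral>x. exp (\<phi> x) \<partial>\<nu>))"
        using key[OF \<phi>, of \<psi>] by (simp add: C_unit_def)
    qed
    note bound = this
    obtain e where e: "relative_entropy v \<mu> = ereal e"
      using bound[of "\<lambda>_. 0"] relative_entropy_nonneg[OF \<mu>, of v]
      by (cases "relative_entropy v \<mu>") auto
    have "relative_entropy v \<nu> \<le> ereal (r - e)"
      unfolding relative_entropy_def[of v \<nu>]
      by (rule SUP_least) (use bound in \<open>force simp: C_unit_def e\<close>)
    then have "relative_entropy v \<mu> + relative_entropy v \<nu> \<le> ereal e + ereal (r - e)"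
      unfolding e by (rule add_left_mono)
    then show ?thesis by simp
  qed
  moreover have "J \<mu> \<nu> \<le> relative_entropy v \<mu> + relative_entropy v \<nu>"
    unfolding J_def by (rule INF_lower[OF v])
  ultimately show ?thesis by (rule order_trans[rotated])
qed

text \<open>Turns \<open>J \<mu> \<nu> > a\<close> into a strict bound on one integral, a weakly
  open condition. The threshold \<open>s = exp (- a) / Z\<close>, with \<open>Z\<close> the integral
  of \<open>1 / h\<close>, is the one for which Chernoff's bound on this event is
  \<open>exp (- a) ^ n\<close>.\<close>

lemma J_gt_nbhd:
  assumes \<mu>: "\<mu> \<in> M1" and a: "ereal a < J \<mu> \<nu>"
  obtains h s where "continuous_on unit_ivl h" "\<And>x. x \<in> unit_ivl \<Longrightarrow> h x > 0" "s > 0"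
    "(\<integral>x. h x \<partial>\<mu>) < s" "s * (\<integral>x. 1 / h x \<partial>\<nu>) \<le> exp (- a)"
proof -
  have "\<not> (\<forall>m\<ge>1. - 2 * ln (hat_affinity m \<mu>) \<le> a)"
  proof
    assume "\<forall>m\<ge>1. - 2 * ln (hat_affinity m \<mu>) \<le> a"
    then have "J \<mu> \<nu> \<le> ereal a" by (intro J_le[OF \<mu>]) blast
    with a show False by simp
  qed
  then obtain m where m: "m \<ge> 1" "a < - 2 * ln (hat_affinity m \<mu>)" by force
  obtain h where h: "continuous_on unit_ivl h" "\<And>x. x \<in> unit_ivl \<Longrightarrow> h x > 0"
    "a < - ln (\<integral>x. h x \<partial>\<mu>) - ln (\<integral>x. 1 / h x \<partial>\<nu>)"
    using hat_affinity_imp_test_function[OF \<mu> m] by metis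
  define Z where "Z = (\<integral>x. 1 / h x \<partial>\<nu>)"
  have pos: "(\<integral>x. h x \<partial>\<mu>) > 0" "Z > 0"
    unfolding Z_def using h(1,2) by (intro M1_integral_pos \<mu> \<nu> continuous_intros; force)+
  have "(\<integral>x. h x \<partial>\<mu>) < exp (- a) / Z"
  proof -
    have "ln (\<integral>x. h x \<partial>\<mu>) < ln (exp (- a) / Z)"
      using h(3) pos by (simp add: ln_div Z_def)
    then show ?thesis using pos by simp
  qed
  then show ?thesis
    using h pos by (intro that[of h "exp (- a) / Z"]) (auto simp: Z_def)
qed

text \<open>\<open>J_ge\<close> with the same \<open>h\<close> applies to every measure in the
  neighbourhood found above, so the set where \<open>J\<close> exceeds \<open>a\<close> is
  open.\<close>

lemma J_gt_of_integral_less: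
  assumes \<mu>: "\<mu> \<in> M1" and h: "continuous_on unit_ivl h" "\<And>x. x \<in> unit_ivl \<Longrightarrow> h x > 0"
    and s: "(\<integral>x. h x \<partial>\<mu>) < s" "s * (\<integral>x. 1 / h x \<partial>\<nu>) \<le> exp (- a)"
  shows "ereal a < J \<mu> \<nu>"
proof -
  define Z where "Z = (\<integral>x. 1 / h x \<partial>\<nu>)"
  have pos: "(\<integral>x. h x \<partial>\<mu>) > 0" "Z > 0"
    unfolding Z_def using h by (intro M1_integral_pos \<mu> \<nu> continuous_intros; force)+
  have "(\<integral>x. h x \<partial>\<mu>) * Z < s * Z" using s pos by simp
  also have "\<dots> \<le> exp (- a)" using s by (simp add: Z_def)
  finally have "ln ((\<integral>x. h x \<partial>\<mu>) * Z) < - a"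
    using pos by (metis ln_exp ln_less_cancel_iff exp_gt_zero mult_pos_pos)
  then have "a < - ln (\<integral>x. h x \<partial>\<mu>) - ln Z" using pos by (simp add: ln_mult)
  then have "ereal a < ereal (- ln (\<integral>x. h x \<partial>\<mu>) - ln Z)" by simp
  also have "\<dots> \<le> J \<mu> \<nu>" unfolding Z_def by (rule J_ge[OF \<mu> \<nu> h])
  finally show ?thesis .
qed

lemma good_rate_function_J: "good_rate_function weak_topology (\<lambda>\<mu>. J \<mu> \<nu>)"
  unfolding good_rate_function_def
proof (intro conjI ballI allI)
  fix \<mu> assume "\<mu> \<in> topspace weak_topology"
  then show "0 \<le> J \<mu> \<nu>" using J_nonneg \<nu> by simp
next
  fix c :: real
  have "openin weak_topology {\<mu> \<in> M1. ereal c < J \<mu> \<nu>}"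
  proof (subst openin_subopen, intro ballI)
    fix \<mu> assume "\<mu> \<in> {\<mu> \<in> M1. ereal c < J \<mu> \<nu>}"
    then have \<mu>: "\<mu> \<in> M1" "ereal c < J \<mu> \<nu>" by auto
    obtain h s where h: "continuous_on unit_ivl h" "\<And>x. x \<in> unit_ivl \<Longrightarrow> h x > 0"
      "(\<integral>x. h x \<partial>\<mu>) < s" "s * (\<integral>x. 1 / h x \<partial>\<nu>) \<le> exp (- c)"
      using J_gt_nbhd[OF \<mu>] by metis
    show "\<exists>T. openin weak_topology T \<and> \<mu> \<in> T \<and> T \<subseteq> {\<mu> \<in> M1. ereal c < J \<mu> \<nu>}"
      using openin_weak_topology_basic[OF h(1), of "{..<s}"] \<mu> h
      by (intro exI[of _ "{\<mu> \<in> M1. (\<integral>x. h x \<partial>\<mu>) \<in> {..<s}}"])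
         (auto intro: J_gt_of_integral_less[OF _ h(1,2)])
  qed
  then have "closedin weak_topology (M1 - {\<mu> \<in> M1. ereal c < J \<mu> \<nu>})"
    by (metis closedin_def closedin_diff closedin_topspace topspace_weak_topology)
  also have "M1 - {\<mu> \<in> M1. ereal c < J \<mu> \<nu>} = {\<mu> \<in> topspace weak_topology. J \<mu> \<nu> \<le> ereal c}"
    by auto
  finally show "compactin weak_topology {\<mu> \<in> topspace weak_topology. J \<mu> \<nu> \<le> ereal c}"
    by (rule closed_compactin[OF compactin_M1, rotated]) auto
qed

end

section \<open>Approximation by measures with a continuous density\<close>

lemma integral_density_M1:
  fixes f g :: "real \<Rightarrow> real"
  assumes \<nu>: "\<nu> \<in> M1" and g: "continuous_on unit_ivl g" "\<And>x. x \<in> unit_ivl \<Longrightarrow> g x \<ge> 0"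
    and f: "continuous_on unit_ivl f"
  shows "(\<integral>x. f x \<partial>density \<nu> (\<lambda>x. ennreal (g x))) = (\<integral>x. g x * f x \<partial>\<nu>)"
  using g(2) by (subst integral_density) (auto intro!: M1_measurable[OF \<nu>] f g AE_I2 simp: M1_space[OF \<nu>])

lemma density_in_M1:
  fixes g :: "real \<Rightarrow> real"
  assumes \<nu>: "\<nu> \<in> M1" and g: "continuous_on unit_ivl g" "\<And>x. x \<in> unit_ivl \<Longrightarrow> g x \<ge> 0"
    and 1: "(\<integral>x. g x \<partial>\<nu>) = 1"
  shows "density \<nu> (\<lambda>x. ennreal (g x)) \<in> M1"
proof -
  have "emeasure (density \<nu> (\<lambda>x. ennreal (g x))) (space \<nu>) = (\<integral>\<^sup>+x. ennreal (g x) \<partial>\<nu>)"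
    using M1_measurable[OF \<nu> g(1)] by (subst emeasure_density) (auto intro!: nn_integral_cong)
  also have "\<dots> = ennreal (\<integral>x. g x \<partial>\<nu>)"
    using g by (intro nn_integral_eq_integral M1_integrable[OF \<nu>] AE_I2) (auto simp: M1_space[OF \<nu>])
  finally show ?thesis
    using \<nu> 1 by (auto simp: M1_iff intro!: prob_spaceI)
qed

context full_support
begin

text \<open>Spreading the mass that \<open>\<mu>\<close> gives to a hat over \<open>\<nu>\<close> yields a measure close to \<open>\<mu>\<close> with a
  continuous density; concavity of the square root shows that its affinity with \<open>\<nu>\<close> is no smaller than
  that of \<open>\<mu>\<close>. This is where the full support of \<open>\<nu>\<close> enters, as \<open>\<mu>\<close> may be singular to \<open>\<nu>\<close>.\<close>

lemma approximation_by_continuous_density: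
  assumes G: "openin weak_topology G" and \<mu>G: "\<mu> \<in> G" and r: "J \<mu> \<nu> \<le> ereal r" and \<eta>: "\<eta> > 0"
  obtains g where "continuous_on unit_ivl g" "\<And>x. x \<in> unit_ivl \<Longrightarrow> g x > 0" "(\<integral>x. g x \<partial>\<nu>) = 1"
    "density \<nu> (\<lambda>x. ennreal (g x)) \<in> G" "- 2 * ln (\<integral>x. sqrt (g x) \<partial>\<nu>) \<le> r + \<eta>"
proof -
  have \<mu>: "\<mu> \<in> M1" using openin_subset[OF G] \<mu>G by auto
  obtain F :: "(real \<Rightarrow> real) set" and \<delta> where F: "finite F" "\<forall>f\<in>F. continuous_on unit_ivl f" "\<delta> > 0"
    "\<forall>\<mu>'\<in>M1. (\<forall>f\<in>F. \<bar>(\<integral>x. f x \<partial>\<mu>') - (\<integral>x. f x \<partial>\<mu>)\<bar> < \<delta>) \<longrightarrow> \<mu>' \<in> G"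
    using weak_topology_nbhd[OF G \<mu>G] by blast
  \<comment> \<open>One level \<open>m\<close> serves the whole finite family: replacing
    \<open>f\<close> by its node values costs at most \<delta>/4 against \<open>d \<nu>\<close> and
    less than \<delta>/4 against \<open>\<mu>\<close>, which leaves room for the later
    mixing.\<close>
  have "\<forall>\<^sub>F m in sequentially. \<forall>f\<in>F. (\<forall>x\<in>unit_ivl. \<forall>l\<le>m. hat m l x * \<bar>f x - f (real l / real m)\<bar> \<le> hat m l x * (\<delta> / 4))
      \<and> dist (\<Sum>l\<le>m. (\<integral>x. hat m l x \<partial>\<mu>) * f (real l / real m)) (\<integral>x. f x \<partial>\<mu>) < \<delta> / 4"
    using F by (intro eventually_ball_finite ballI eventually_conj hat_interpolation
        tendstoD[OF integral_hat_interpolation[OF \<mu>]]) auto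
  from eventually_happens'[OF sequentially_bot eventually_conj[OF this eventually_ge_at_top[of 1]]]
  obtain m where m: "m \<ge> 1"
    and interp: "\<And>f x l. f \<in> F \<Longrightarrow> x \<in> unit_ivl \<Longrightarrow> l \<le> m \<Longrightarrow>
      hat m l x * \<bar>f x - f (real l / real m)\<bar> \<le> hat m l x * (\<delta> / 4)"
    and close: "\<And>f. f \<in> F \<Longrightarrow>
      dist (\<Sum>l\<le>m. (\<integral>x. hat m l x \<partial>\<mu>) * f (real l / real m)) (\<integral>x. f x \<partial>\<mu>) < \<delta> / 4"
    by blast
  define p where "p l = (\<integral>x. hat m l x \<partial>\<mu>)" for l
  define q where "q l = (\<integral>x. hat m l x \<partial>\<nu>)" for l
  have p: "p l \<ge> 0" for l by (simp add: p_def integral_hat_nonneg)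
  have q: "q l > 0" if "l \<le> m" for l using integral_hat_pos[OF m that] by (simp add: q_def)
  \<comment> \<open>With these coefficients the \<open>l\<close>-th term of \<open>d\<close> has
    integral \<open>p l\<close> against \<open>\<nu>\<close>, so \<open>d\<close> is a probability
    density.\<close>
  define c where "c l = p l / q l" for l
  have c: "c l \<ge> 0" "q l * c l = p l" if "l \<le> m" for l
    using p[of l] q[OF that] by (auto simp: c_def)
  define d where "d x = (\<Sum>l\<le>m. hat m l x * c l)" for x
  have d_cont: "continuous_on unit_ivl d"
    unfolding d_def by (intro continuous_intros)
  have d_nonneg: "d x \<ge> 0" for x
    unfolding d_def using c by (intro sum_nonneg mult_nonneg_nonneg hat_nonneg) (auto simp: less_imp_le)
  have d_int: "(\<integral>x. d x \<partial>\<nu>) = 1"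
  proof -
    have "(\<integral>x. d x \<partial>\<nu>) = (\<Sum>l\<le>m. q l * c l)"
      unfolding d_def q_def using \<nu>
      by (subst Bochner_Integration.integral_sum) (auto intro!: M1_integrable continuous_intros)
    also have "\<dots> = (\<Sum>l\<le>m. p l)" by (intro sum.cong) (simp_all add: c)
    finally show ?thesis using sum_integral_hat[OF \<mu>, of m] by (simp add: p_def)
  qed
  have d_f: "\<bar>(\<integral>x. d x * f x \<partial>\<nu>) - (\<integral>x. f x \<partial>\<mu>)\<bar> < \<delta>" if f: "f \<in> F" for f
  proof -
    have fc: "continuous_on unit_ivl f" using F f by blast
    have "\<bar>(\<integral>x. d x * f x \<partial>\<nu>) - (\<Sum>l\<le>m. p l * f (real l / real m))\<bar> \<le> \<delta> / 4"
    proof -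
      have "(\<integral>x. d x * f x \<partial>\<nu>) - (\<Sum>l\<le>m. p l * f (real l / real m)) =
          (\<integral>x. (\<Sum>l\<le>m. c l * (hat m l x * (f x - f (real l / real m)))) \<partial>\<nu>)"
      proof -
        have "(\<Sum>l\<le>m. p l * f (real l / real m)) = (\<Sum>l\<le>m. c l * (q l * f (real l / real m)))"
          by (intro sum.cong) (auto simp flip: c(2))
        also have "\<dots> = (\<integral>x. (\<Sum>l\<le>m. c l * (hat m l x * f (real l / real m))) \<partial>\<nu>)"
          unfolding q_def using \<nu>
          by (subst Bochner_Integration.integral_sum) (auto intro!: M1_integrable continuous_intros)
        finally have "(\<integral>x. d x * f x \<partial>\<nu>) - (\<Sum>l\<le>m. p l * f (real l / real m)) =
            (\<integral>x. d x * f x - (\<Sum>l\<le>m. c l * (hat m l x * f (real l / real m))) \<partial>\<nu>)"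
          using \<nu> by (subst Bochner_Integration.integral_diff)
            (auto intro!: M1_integrable continuous_intros d_cont fc)
        also have "\<dots> = (\<integral>x. (\<Sum>l\<le>m. c l * (hat m l x * (f x - f (real l / real m)))) \<partial>\<nu>)"
          by (intro Bochner_Integration.integral_cong refl)
             (simp add: d_def sum_distrib_right sum_distrib_left algebra_simps diff_divide_distrib flip: sum_subtractf)
        finally show ?thesis .
      qed
      also have "\<bar>\<dots> - (\<integral>x. 0 \<partial>\<nu>)\<bar> \<le> (\<integral>x. d x * (\<delta> / 4) \<partial>\<nu>)"
      proof -
        have "\<bar>\<Sum>l\<le>m. c l * (hat m l x * (f x - f (real l / real m)))\<bar> \<le> d x * (\<delta> / 4)"
          if x: "x \<in> unit_ivl" for x
        proof -
          have "\<bar>\<Sum>l\<le>m. c l * (hat m l x * (f x - f (real l / real m)))\<bar>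
              \<le> (\<Sum>l\<le>m. c l * (hat m l x * \<bar>f x - f (real l / real m)\<bar>))"
            using c by (intro order_trans[OF sum_abs] sum_mono)
              (auto simp: abs_mult hat_nonneg less_imp_le)
          also have "\<dots> \<le> (\<Sum>l\<le>m. c l * (hat m l x * (\<delta> / 4)))"
            by (rule sum_mono, rule mult_left_mono) (use interp[OF f x] c in auto)
          also have "\<dots> = d x * (\<delta> / 4)"
            unfolding d_def sum_distrib_right by (intro sum.cong) auto
          finally show ?thesis .
        qed
        then have "(\<integral>x. (\<Sum>l\<le>m. c l * (hat m l x * (f x - f (real l / real m)))) \<partial>\<nu>) \<le> (\<integral>x. d x * (\<delta> / 4) \<partial>\<nu>)"
          "(\<integral>x. - (\<Sum>l\<le>m. c l * (hat m l x * (f x - f (real l / real m)))) \<partial>\<nu>) \<le> (\<integral>x. d x * (\<delta> / 4) \<partial>\<nu>)"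
          by (intro M1_integral_mono[OF \<nu>] continuous_intros d_cont fc; fastforce simp: abs_le_iff)+
        then show ?thesis by simp
      qed
      also have "(\<integral>x. d x * (\<delta> / 4) \<partial>\<nu>) = \<delta> / 4" using d_int by simp
      finally show ?thesis by simp
    qed
    moreover have "\<bar>(\<Sum>l\<le>m. p l * f (real l / real m)) - (\<integral>x. f x \<partial>\<mu>)\<bar> < \<delta> / 4"
      using close[OF f] by (auto simp: dist_real_def p_def)
    ultimately show ?thesis using F(3) by linarith
  qed
  \<comment> \<open>\<open>d\<close> may vanish, so a share \<open>e\<close> of \<open>\<nu>\<close>
    is mixed in: the density becomes at least \<open>e\<close>, and the rate exceeds
    \<open>- 2 * ln (hat_affinity m \<mu>)\<close> by at most
    \<open>- ln (1 - e) < \<eta>\<close>.\<close>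
  have "\<forall>\<^sub>F e in at_right (0::real). (\<forall>f\<in>F. \<bar>((1 - e) * (\<integral>x. d x * f x \<partial>\<nu>) + e * (\<integral>x. f x \<partial>\<nu>)) - (\<integral>x. f x \<partial>\<mu>)\<bar> < \<delta>)
      \<and> - ln (1 - e) < \<eta> \<and> 0 < e \<and> e < 1"
  proof (intro eventually_conj eventually_ball_finite F ballI)
    fix f assume f: "f \<in> F"
    have "((\<lambda>e. \<bar>((1 - e) * (\<integral>x. d x * f x \<partial>\<nu>) + e * (\<integral>x. f x \<partial>\<nu>)) - (\<integral>x. f x \<partial>\<mu>)\<bar>)
        \<longlongrightarrow> \<bar>((1 - 0) * (\<integral>x. d x * f x \<partial>\<nu>) + 0 * (\<integral>x. f x \<partial>\<nu>)) - (\<integral>x. f x \<partial>\<mu>)\<bar>) (at_right (0::real))"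
      by (intro tendsto_intros)
    then show "\<forall>\<^sub>F e in at_right 0. \<bar>((1 - e) * (\<integral>x. d x * f x \<partial>\<nu>) + e * (\<integral>x. f x \<partial>\<nu>)) - (\<integral>x. f x \<partial>\<mu>)\<bar> < \<delta>"
      using d_f[OF f] by (intro order_tendstoD(2)) auto
  next
    have "((\<lambda>e::real. - ln (1 - e)) \<longlongrightarrow> - ln (1 - 0)) (at_right 0)"
      by (intro tendsto_intros) auto
    then show "\<forall>\<^sub>F e::real in at_right 0. - ln (1 - e) < \<eta>"
      using \<eta> by (intro order_tendstoD(2)) auto
  next
    show "\<forall>\<^sub>F e::real in at_right 0. 0 < e" by (simp add: eventually_at_filter)
  next
    show "\<forall>\<^sub>F e::real in at_right 0. e < 1"
      by (rule eventually_at_rightI[of 0 1]) auto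
  qed
  from eventually_happens'[OF trivial_limit_at_right_real this]
  obtain e :: real where e: "\<And>f. f \<in> F \<Longrightarrow> \<bar>((1 - e) * (\<integral>x. d x * f x \<partial>\<nu>) + e * (\<integral>x. f x \<partial>\<nu>)) - (\<integral>x. f x \<partial>\<mu>)\<bar> < \<delta>"
    "- ln (1 - e) < \<eta>" "0 < e" "e < 1"
    by blast
  define g where "g x = (1 - e) * d x + e" for x
  have g_cont: "continuous_on unit_ivl g" unfolding g_def by (intro continuous_intros d_cont)
  have g_pos: "g x > 0" for x unfolding g_def using e d_nonneg[of x] by (intro add_nonneg_pos) auto
  have g_int: "(\<integral>x. g x * f x \<partial>\<nu>) = (1 - e) * (\<integral>x. d x * f x \<partial>\<nu>) + e * (\<integral>x. f x \<partial>\<nu>)"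
    if "continuous_on unit_ivl f" for f
  proof -
    have "(\<integral>x. g x * f x \<partial>\<nu>) = (\<integral>x. (1 - e) * (d x * f x) + e * f x \<partial>\<nu>)"
      by (simp add: g_def algebra_simps)
    also have "\<dots> = (1 - e) * (\<integral>x. d x * f x \<partial>\<nu>) + e * (\<integral>x. f x \<partial>\<nu>)"
      using \<nu> that by (subst Bochner_Integration.integral_add)
        (auto intro!: M1_integrable continuous_intros d_cont)
    finally show ?thesis .
  qed
  have g1: "(\<integral>x. g x \<partial>\<nu>) = 1" using g_int[of "\<lambda>_. 1"] d_int \<nu> by simp
  have "density \<nu> (\<lambda>x. ennreal (g x)) \<in> G"
  proof -
    have "\<bar>(\<integral>x. f x \<partial>density \<nu> (\<lambda>x. ennreal (g x))) - (\<integral>x. f x \<partial>\<mu>)\<bar> < \<delta>" if "f \<in> F" for f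
      using e(1)[OF that] F(2) that g_pos
      by (subst integral_density_M1[OF \<nu> g_cont]) (auto simp: g_int less_imp_le)
    moreover have "density \<nu> (\<lambda>x. ennreal (g x)) \<in> M1"
      using g_pos by (intro density_in_M1 \<nu> g_cont g1) (simp add: less_imp_le)
    ultimately show ?thesis using F(4) by blast
  qed
  moreover have "- 2 * ln (\<integral>x. sqrt (g x) \<partial>\<nu>) \<le> r + \<eta>"
  proof -
    have "sqrt (1 - e) * hat_affinity m \<mu> = (\<integral>x. sqrt (1 - e) * (\<Sum>l\<le>m. hat m l x * sqrt (c l)) \<partial>\<nu>)"
    proof -
      have "(\<integral>x. (\<Sum>l\<le>m. hat m l x * sqrt (c l)) \<partial>\<nu>) = (\<Sum>l\<le>m. q l * sqrt (c l))"
        unfolding q_def using \<nu>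
        by (subst Bochner_Integration.integral_sum) (auto intro!: M1_integrable continuous_intros)
      also have "\<dots> = (\<Sum>l\<le>m. sqrt (p l * q l))"
      proof (intro sum.cong refl)
        fix l assume "l \<in> {..m}"
        then have "q l > 0" using q by simp
        then show "q l * sqrt (c l) = sqrt (p l * q l)"
          by (simp add: c_def real_sqrt_divide real_sqrt_mult field_simps)
      qed
      finally show ?thesis by (simp add: hat_affinity_def p_def q_def)
    qed
    also have "\<dots> \<le> (\<integral>x. sqrt (g x) \<partial>\<nu>)"
    proof (intro M1_integral_mono \<nu> continuous_intros g_cont)
      fix x assume x: "x \<in> unit_ivl"
      have "(\<Sum>l\<le>m. hat m l x * sqrt (c l)) \<le> sqrt (d x)"
        unfolding d_def using c sum_hat[OF x, of m]
        by (intro sum_sqrt_le_sqrt_sum) (auto simp: hat_nonneg less_imp_le)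
      then have "sqrt (1 - e) * (\<Sum>l\<le>m. hat m l x * sqrt (c l)) \<le> sqrt (1 - e) * sqrt (d x)"
        using e by (intro mult_left_mono) auto
      also have "\<dots> \<le> sqrt (g x)"
        using e by (simp add: g_def flip: real_sqrt_mult)
      finally show "sqrt (1 - e) * (\<Sum>l\<le>m. hat m l x * sqrt (c l)) \<le> sqrt (g x)" .
    qed
    finally have le: "sqrt (1 - e) * hat_affinity m \<mu> \<le> (\<integral>x. sqrt (g x) \<partial>\<nu>)" .
    have A: "hat_affinity m \<mu> > 0" by (rule hat_affinity_pos[OF \<mu> m])
    have pos: "sqrt (1 - e) * hat_affinity m \<mu> > 0" using A e by simp
    have "ln (sqrt (1 - e) * hat_affinity m \<mu>) \<le> ln (\<integral>x. sqrt (g x) \<partial>\<nu>)"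
      using le pos by (subst ln_le_cancel_iff; linarith)
    then have "ln (1 - e) + 2 * ln (hat_affinity m \<mu>) \<le> 2 * ln (\<integral>x. sqrt (g x) \<partial>\<nu>)"
      using A e by (simp add: ln_mult ln_sqrt)
    moreover have "- 2 * ln (hat_affinity m \<mu>) \<le> r"
      using J_ge_hat_affinity[OF \<mu> m] r by (metis ereal_less_eq(3) order_trans)
    ultimately show ?thesis using e(2) by linarith
  qed
  ultimately show ?thesis using that[OF g_cont] g_pos g1 by blast
qed

end

section \<open>Finite product measures\<close>

lemma indicator_PiE_eq_prod:
  assumes "finite I" "x \<in> extensional I"
  shows "indicator (Pi\<^sub>E I A) x = (\<Prod>i\<in>I. indicator (A i) (x i) :: ennreal)"
proof (cases "\<forall>i\<in>I. x i \<in> A i")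
  case True
  then show ?thesis using assms by (auto simp: PiE_def intro!: prod.neutral)
next
  case False
  then have "\<exists>i\<in>I. indicator (A i) (x i) = (0::ennreal)" by (auto simp: indicator_def)
  with assms(1) have "(\<Prod>i\<in>I. indicator (A i) (x i) :: ennreal) = 0" by (rule prod_zero)
  with False show ?thesis by (auto simp: indicator_def PiE_iff)
qed

text \<open>Both sides agree on boxes, where the integral of a product factorises. This allows all
  coordinates to be tilted at once.\<close>

lemma PiM_density:
  fixes g :: "'a \<Rightarrow> ennreal"
  assumes N: "prob_space N" and g: "g \<in> borel_measurable N" and Q: "prob_space (density N g)" and I: "finite I"
  shows "density (PiM I (\<lambda>_. N)) (\<lambda>\<omega>. \<Prod>i\<in>I. g (\<omega> i)) = PiM I (\<lambda>_. density N g)"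
proof -
  interpret N: prob_space N by fact
  interpret Q: prob_space "density N g" by fact
  interpret PN: product_sigma_finite "\<lambda>_. N" ..
  interpret PQ: product_sigma_finite "\<lambda>_. density N g" ..
  note g[measurable]
  show ?thesis
  proof (rule PQ.PiM_eqI[OF I])
    show "sets (density (PiM I (\<lambda>_. N)) (\<lambda>\<omega>. \<Prod>i\<in>I. g (\<omega> i))) = sets (PiM I (\<lambda>_. density N g))"
      by (simp cong: sets_PiM_cong)
  next
    fix A assume A: "\<And>i. i \<in> I \<Longrightarrow> A i \<in> sets (density N g)"
    then have A': "A i \<in> sets N" if "i \<in> I" for i using that by simp
    have m: "(\<lambda>\<omega>. \<Prod>i\<in>I. g (\<omega> i)) \<in> borel_measurable (PiM I (\<lambda>_. N))"
      by measurable
    have "emeasure (density (PiM I (\<lambda>_. N)) (\<lambda>\<omega>. \<Prod>i\<in>I. g (\<omega> i))) (Pi\<^sub>E I A) =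
        (\<integral>\<^sup>+\<omega>. (\<Prod>i\<in>I. g (\<omega> i)) * indicator (Pi\<^sub>E I A) \<omega> \<partial>PiM I (\<lambda>_. N))"
      using A' I by (intro emeasure_density m sets_PiM_I_finite) auto
    also have "\<dots> = (\<integral>\<^sup>+\<omega>. (\<Prod>i\<in>I. g (\<omega> i) * indicator (A i) (\<omega> i)) \<partial>PiM I (\<lambda>_. N))"
    proof (intro nn_integral_cong)
      fix \<omega> assume "\<omega> \<in> space (PiM I (\<lambda>_. N))"
      then have "indicator (Pi\<^sub>E I A) \<omega> = (\<Prod>i\<in>I. indicator (A i) (\<omega> i) :: ennreal)"
        using I by (intro indicator_PiE_eq_prod) (auto simp: space_PiM PiE_def)
      then show "(\<Prod>i\<in>I. g (\<omega> i)) * indicator (Pi\<^sub>E I A) \<omega> = (\<Prod>i\<in>I. g (\<omega> i) * indicator (A i) (\<omega> i))"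
        by (simp add: prod.distrib)
    qed
    also have "\<dots> = (\<Prod>i\<in>I. \<integral>\<^sup>+z. g z * indicator (A i) z \<partial>N)"
      using A' by (intro PN.product_nn_integral_prod I) auto
    also have "\<dots> = (\<Prod>i\<in>I. emeasure (density N g) (A i))"
      using A' by (intro prod.cong refl) (simp add: emeasure_density)
    finally show "emeasure (density (PiM I (\<lambda>_. N)) (\<lambda>\<omega>. \<Prod>i\<in>I. g (\<omega> i))) (Pi\<^sub>E I A) =
        (\<Prod>i\<in>I. emeasure (density N g) (A i))" .
  qed
qed

text \<open>Tonelli on boxes. A vector of weights and an independent vector of locations become a
  vector of i.i.d. marked points.\<close>

lemma PiM_pair_measure:
  assumes M: "prob_space M" and N: "prob_space N" and I: "finite I"
  shows "distr (PiM I (\<lambda>_. M) \<Otimes>\<^sub>M PiM I (\<lambda>_. N)) (PiM I (\<lambda>_. M \<Otimes>\<^sub>M N)) (\<lambda>(x, y). \<lambda>i\<in>I. (x i, y i)) =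
    PiM I (\<lambda>_. M \<Otimes>\<^sub>M N)"
proof -
  interpret M: prob_space M by fact
  interpret N: prob_space N by fact
  interpret MN: pair_prob_space M N ..
  interpret PM: product_prob_space "\<lambda>_. M" I ..
  interpret PN: product_prob_space "\<lambda>_. N" I ..
  interpret PP: product_sigma_finite "\<lambda>_. M \<Otimes>\<^sub>M N" ..
  interpret B: pair_sigma_finite "PiM I (\<lambda>_. M)" "PiM I (\<lambda>_. N)" ..
  let ?T = "\<lambda>(x, y). \<lambda>i\<in>I. (x i, y i)"
  have T[measurable]: "?T \<in> measurable (PiM I (\<lambda>_. M) \<Otimes>\<^sub>M PiM I (\<lambda>_. N)) (PiM I (\<lambda>_. M \<Otimes>\<^sub>M N))"
    by measurable
  show ?thesis
  proof (rule PP.PiM_eqI[OF I])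
    fix A assume A[measurable]: "\<And>i. i \<in> I \<Longrightarrow> A i \<in> sets (M \<Otimes>\<^sub>M N)"
    have box: "Pi\<^sub>E I A \<in> sets (PiM I (\<lambda>_. M \<Otimes>\<^sub>M N))"
      using A I by (intro sets_PiM_I_finite) auto
    have "emeasure (distr (PiM I (\<lambda>_. M) \<Otimes>\<^sub>M PiM I (\<lambda>_. N)) (PiM I (\<lambda>_. M \<Otimes>\<^sub>M N)) ?T) (Pi\<^sub>E I A) =
        (\<integral>\<^sup>+z. indicator (Pi\<^sub>E I A) (?T z) \<partial>(PiM I (\<lambda>_. M) \<Otimes>\<^sub>M PiM I (\<lambda>_. N)))"
      using box by (simp add: nn_integral_distr[OF T, symmetric] flip: nn_integral_indicator)
    also have "\<dots> = (\<integral>\<^sup>+x. \<integral>\<^sup>+y. indicator (Pi\<^sub>E I A) (?T (x, y)) \<partial>PiM I (\<lambda>_. N) \<partial>PiM I (\<lambda>_. M))"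
      by (intro PN.nn_integral_fst[symmetric] measurable_compose[OF T borel_measurable_indicator[OF box]])
    also have "\<dots> = (\<integral>\<^sup>+x. (\<Prod>i\<in>I. \<integral>\<^sup>+v. indicator (A i) (x i, v) \<partial>N) \<partial>PiM I (\<lambda>_. M))"
    proof (intro nn_integral_cong)
      fix x assume x: "x \<in> space (PiM I (\<lambda>_. M))"
      have "(\<integral>\<^sup>+y. indicator (Pi\<^sub>E I A) (?T (x, y)) \<partial>PiM I (\<lambda>_. N)) =
          (\<integral>\<^sup>+y. (\<Prod>i\<in>I. indicator (A i) (x i, y i)) \<partial>PiM I (\<lambda>_. N))"
        using I by (intro nn_integral_cong) (simp add: indicator_PiE_eq_prod)
      also have "\<dots> = (\<Prod>i\<in>I. \<integral>\<^sup>+v. indicator (A i) (x i, v) \<partial>N)"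
      proof (rule PN.product_nn_integral_prod[OF I])
        fix i assume i: "i \<in> I"
        then have "x i \<in> space M" using x by (auto simp: space_PiM)
        then show "(\<lambda>v. indicator (A i) (x i, v) :: ennreal) \<in> borel_measurable N"
          using A[OF i] by measurable
      qed
      finally show "(\<integral>\<^sup>+y. indicator (Pi\<^sub>E I A) (?T (x, y)) \<partial>PiM I (\<lambda>_. N)) =
          (\<Prod>i\<in>I. \<integral>\<^sup>+v. indicator (A i) (x i, v) \<partial>N)" .
    qed
    also have "\<dots> = (\<Prod>i\<in>I. \<integral>\<^sup>+u. \<integral>\<^sup>+v. indicator (A i) (u, v) \<partial>N \<partial>M)"
      using A by (intro PM.product_nn_integral_prod I N.borel_measurable_nn_integral_fst) measurable
    also have "\<dots> = (\<Prod>i\<in>I. emeasure (M \<Otimes>\<^sub>M N) (A i))"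
      using A by (intro prod.cong refl) (simp add: N.nn_integral_fst)
    finally show "emeasure (distr (PiM I (\<lambda>_. M) \<Otimes>\<^sub>M PiM I (\<lambda>_. N)) (PiM I (\<lambda>_. M \<Otimes>\<^sub>M N)) ?T) (Pi\<^sub>E I A) =
        (\<Prod>i\<in>I. emeasure (M \<Otimes>\<^sub>M N) (A i))" .
  qed simp
qed

text \<open>After centring, the mixed terms of the squared sum vanish and \<open>card I\<close>
  variances remain; Markov's inequality applies to the square.\<close>

lemma PiM_Chebyshev:
  fixes f :: "'a \<Rightarrow> real"
  assumes Q: "prob_space Q" and f: "integrable Q f" "integrable Q (\<lambda>z. (f z)\<^sup>2)"
    and c: "(\<integral>z. f z \<partial>Q) = c" and I: "finite I" "I \<noteq> {}" and \<delta>: "\<delta> > 0"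
  shows "measure (PiM I (\<lambda>_. Q)) {\<omega> \<in> space (PiM I (\<lambda>_. Q)). \<bar>(\<Sum>i\<in>I. f (\<omega> i)) - real (card I) * c\<bar> \<ge> real (card I) * \<delta>}
    \<le> (\<integral>z. (f z - c)\<^sup>2 \<partial>Q) / (real (card I) * \<delta>\<^sup>2)"
proof -
  interpret Q: prob_space Q by fact
  interpret P: product_prob_space "\<lambda>_. Q" I ..
  define g where "g z = f z - c" for z
  define V where "V = (\<integral>z. (g z)\<^sup>2 \<partial>Q)"
  define n where "n = real (card I)"
  have n: "n > 0" using I by (simp add: n_def card_gt_0_iff)
  have g: "integrable Q g" "integrable Q (\<lambda>z. (g z)\<^sup>2)" "(\<integral>z. g z \<partial>Q) = 0"
  proof -
    show "integrable Q g" unfolding g_def using f by simp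
    have "(\<lambda>z. (g z)\<^sup>2) = (\<lambda>z. (f z)\<^sup>2 - 2 * c * f z + c\<^sup>2)"
      by (auto simp: g_def power2_eq_square algebra_simps)
    then show "integrable Q (\<lambda>z. (g z)\<^sup>2)" using f by simp
    show "(\<integral>z. g z \<partial>Q) = 0" unfolding g_def using f c by (simp add: Q.prob_space)
  qed
  \<comment> \<open>\<open>g (\<omega> i) * g (\<omega> j)\<close> as a product over all
    coordinates, with factor 1 away from \<open>i\<close> and \<open>j\<close> and a square when
    \<open>i = j\<close>; the product formula for integrals then covers both cases.\<close>
  define F where "F i j k z = (if k = i then g z else 1) * (if k = j then g z else 1)" for i j k :: 'b and z
  have F_int: "integrable Q (F i j k)" for i j k
    using g by (cases "k = i"; cases "k = j") (simp_all add: F_def[abs_def] power2_eq_square)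
  have F_prod: "(\<Prod>k\<in>I. F i j k (\<omega> k)) = g (\<omega> i) * g (\<omega> j)" if "i \<in> I" "j \<in> I" for i j \<omega>
    using that I by (simp add: F_def prod.distrib)
  have int2: "integrable (PiM I (\<lambda>_. Q)) (\<lambda>\<omega>. g (\<omega> i) * g (\<omega> j))" if "i \<in> I" "j \<in> I" for i j
    using P.product_integrable_prod[of I "F i j", OF I(1) F_int] by (simp add: F_prod[OF that])
  have int2_eq: "(\<integral>\<omega>. g (\<omega> i) * g (\<omega> j) \<partial>PiM I (\<lambda>_. Q)) = (if i = j then V else 0)" if "i \<in> I" "j \<in> I" for i j
  proof -
    have "(\<integral>\<omega>. g (\<omega> i) * g (\<omega> j) \<partial>PiM I (\<lambda>_. Q)) = (\<Prod>k\<in>I. \<integral>z. F i j k z \<partial>Q)"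
      using P.product_integral_prod[of I "F i j", OF I(1) F_int] by (simp add: F_prod[OF that])
    also have "\<dots> = (if i = j then V else 0)"
    proof (cases "i = j")
      case True
      then have "(\<Prod>k\<in>I. \<integral>z. F i j k z \<partial>Q) = (\<Prod>k\<in>I. if k = i then V else 1)"
        by (intro prod.cong refl) (simp add: F_def V_def power2_eq_square Q.prob_space)
      then show ?thesis using True that I by simp
    next
      case False
      then have "(\<integral>z. F i j i z \<partial>Q) = 0" using g by (simp add: F_def)
      then show ?thesis using False that I by (auto intro!: prod_zero)
    qed
    finally show ?thesis .
  qed
  define S where "S \<omega> = (\<Sum>i\<in>I. g (\<omega> i))" for \<omega> :: "'b \<Rightarrow> 'a"
  have S2: "(S \<omega>)\<^sup>2 = (\<Sum>i\<in>I. \<Sum>j\<in>I. g (\<omega> i) * g (\<omega> j))" for \<omega>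
    by (simp add: S_def power2_eq_square sum_product)
  have S_int: "integrable (PiM I (\<lambda>_. Q)) (\<lambda>\<omega>. (S \<omega>)\<^sup>2)"
    unfolding S2 by (intro Bochner_Integration.integrable_sum int2)
  have "(\<integral>\<omega>. (S \<omega>)\<^sup>2 \<partial>PiM I (\<lambda>_. Q)) = (\<Sum>i\<in>I. \<Sum>j\<in>I. if i = j then V else 0)"
    unfolding S2 by (simp add: int2 int2_eq)
  also have "\<dots> = n * V" using I by (simp add: n_def)
  finally have S_val: "(\<integral>\<omega>. (S \<omega>)\<^sup>2 \<partial>PiM I (\<lambda>_. Q)) = n * V" .
  have "{\<omega> \<in> space (PiM I (\<lambda>_. Q)). \<bar>(\<Sum>i\<in>I. f (\<omega> i)) - real (card I) * c\<bar> \<ge> real (card I) * \<delta>} =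
      {\<omega> \<in> space (PiM I (\<lambda>_. Q)). (S \<omega>)\<^sup>2 \<ge> (n * \<delta>)\<^sup>2}"
  proof -
    have "S \<omega> = (\<Sum>i\<in>I. f (\<omega> i)) - real (card I) * c" for \<omega>
      by (simp add: S_def g_def sum_subtractf)
    moreover have "\<bar>s\<bar> \<ge> n * \<delta> \<longleftrightarrow> s\<^sup>2 \<ge> (n * \<delta>)\<^sup>2" for s
      using n \<delta> abs_le_square_iff[of "n * \<delta>" s] by simp
    ultimately show ?thesis by (simp add: n_def)
  qed
  also have "measure (PiM I (\<lambda>_. Q)) \<dots> \<le> (\<integral>\<omega>. (S \<omega>)\<^sup>2 \<partial>PiM I (\<lambda>_. Q)) / (n * \<delta>)\<^sup>2"
    using n \<delta> by (intro integral_Markov_inequality_measure[of _ _ "{}"] S_int) auto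
  also have "\<dots> = V / (n * \<delta>\<^sup>2)"
    unfolding S_val using n \<delta> by (simp add: power2_eq_square field_simps)
  finally show ?thesis by (simp add: V_def g_def n_def)
qed

text \<open>The random measure \<open>W\<^sub>n\<close> may leave \<^const>\<open>M1\<close> on a null set, so it need not be a measurable map into
  \<^term>\<open>borel_sigma weak_topology\<close>; measurability of the preimages is enough to compute its law.\<close>

lemma emeasure_distr_of_measurable_vimage:
  assumes vimage: "\<And>A. A \<in> sets N \<Longrightarrow> f -` A \<inter> space M \<in> sets M" and A: "A \<in> sets N"
  shows "emeasure (distr M N f) A = emeasure M (f -` A \<inter> space M)"
  unfolding distr_def
proof (rule emeasure_measure_of_sigma)
  show "positive (sets N) (\<lambda>A. emeasure M (f -` A \<inter> space M))"
    by (auto simp: positive_def)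
  show "countably_additive (sets N) (\<lambda>A. emeasure M (f -` A \<inter> space M))"
  proof (intro countably_additiveI)
    fix B :: "nat \<Rightarrow> _" assume "range B \<subseteq> sets N" "disjoint_family B"
    then have "range (\<lambda>i. f -` B i \<inter> space M) \<subseteq> sets M" "disjoint_family (\<lambda>i. f -` B i \<inter> space M)"
      using vimage by (auto simp: disjoint_family_on_def)
    from suminf_emeasure[OF this]
    show "(\<Sum>i. emeasure M (f -` B i \<inter> space M)) = emeasure M (f -` (\<Union>i. B i) \<inter> space M)"
      by (simp add: vimage_UN)
  qed
qed (use A in \<open>auto simp: sets.sigma_algebra_axioms\<close>)

section \<open>Exponentially marked points\<close>

abbreviation exp_law :: "real measure" where
  "exp_law \<equiv> density lborel (exponential_density 1)"

lemma prob_space_exp_law: "prob_space exp_law"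
  by (rule prob_space_exponential_density) simp

lemma AE_exp_law_nonneg: "AE w in exp_law. 0 \<le> w"
  by (subst AE_density) (auto simp: exponential_density_def)

text \<open>The tilt turns the exponential density into \<open>1 / k\<close> times the one with
  parameter \<open>k\<close>, whose \<open>j\<close>-th moment is
  \<open>fact j / k ^ j\<close>.\<close>

lemma nn_integral_exp_law_tilted_moment:
  assumes "k > 0"
  shows "(\<integral>\<^sup>+w. ennreal (w ^ j * exp (w * (1 - k))) \<partial>exp_law) = ennreal (fact j / k ^ Suc j)"
proof -
  have "(\<integral>\<^sup>+w. ennreal (w ^ j * exp (w * (1 - k))) \<partial>exp_law) =
      (\<integral>\<^sup>+w. ennreal (exponential_density 1 w) * ennreal (w ^ j * exp (w * (1 - k))) \<partial>lborel)"
    by (subst nn_integral_density) auto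
  also have "\<dots> = (\<integral>\<^sup>+w. ennreal (1 / k) * ennreal (exponential_density k w * w ^ j) \<partial>lborel)"
  proof (intro nn_integral_cong)
    fix w :: real
    show "ennreal (exponential_density 1 w) * ennreal (w ^ j * exp (w * (1 - k))) =
        ennreal (1 / k) * ennreal (exponential_density k w * w ^ j)"
    proof (cases "w < 0")
      case False
      have "exp (- w) * (w ^ j * exp (w * (1 - k))) = 1 / k * (k * exp (- w * k) * w ^ j)"
        using assms by (simp add: right_diff_distrib exp_diff exp_minus field_simps)
      then show ?thesis using False assms
        by (simp add: exponential_density_def flip: ennreal_mult')
    qed (simp add: exponential_density_def)
  qed
  also have "\<dots> = ennreal (1 / k) * ennreal (fact j / k ^ j)"
    using nn_integral_erlang_ith_moment[OF assms, of 0 j] by (subst nn_integral_cmult) auto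
  also have "\<dots> = ennreal (fact j / k ^ Suc j)"
    using assms by (simp flip: ennreal_mult')
  finally show ?thesis .
qed

context reference_law
begin

definition point_law :: "(real \<times> real) measure" where
  "point_law = exp_law \<Otimes>\<^sub>M \<nu>"

lemma prob_space_point_law: "prob_space point_law"
proof -
  interpret e: prob_space exp_law by (rule prob_space_exp_law)
  interpret n: prob_space \<nu> using \<nu> by (rule M1_prob_space)
  interpret pair_prob_space exp_law \<nu> ..
  show ?thesis unfolding point_law_def by (rule prob_space_axioms)
qed

lemma measurable_fst_point_law [measurable]: "fst \<in> borel_measurable point_law"
proof -
  have "fst \<in> measurable point_law exp_law" unfolding point_law_def by (rule measurable_fst)
  then show ?thesis by simp
qed

lemma measurable_snd_point_law [measurable]: "snd \<in> measurable point_law borel_unit"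
proof -
  have "snd \<in> measurable point_law \<nu>" unfolding point_law_def by (rule measurable_snd)
  then show ?thesis by (simp add: M1_sets[OF \<nu>] cong: measurable_cong_sets)
qed

lemma measurable_continuous_snd_point_law:
  fixes f :: "real \<Rightarrow> real"
  assumes "continuous_on unit_ivl f"
  shows "(\<lambda>z. f (snd z)) \<in> borel_measurable point_law"
  using measurable_compose[OF measurable_snd_point_law borel_measurable_continuous_on_restrict[OF assms]] .

lemma snd_point_law_in_unit: "z \<in> space point_law \<Longrightarrow> snd z \<in> unit_ivl"
  by (auto simp: point_law_def space_pair_measure M1_space[OF \<nu>])

lemma AE_point_law_nonneg: "AE z in point_law. 0 \<le> fst z"
proof -
  interpret e: prob_space exp_law by (rule prob_space_exp_law)
  interpret n: prob_space \<nu> using \<nu> by (rule M1_prob_space)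
  interpret pair_sigma_finite exp_law \<nu> ..
  have "AE w in exp_law. AE y in \<nu>. 0 \<le> fst (w, y)"
    using AE_exp_law_nonneg by auto
  moreover have "{z \<in> space point_law. 0 \<le> fst z} \<in> sets point_law"
    by measurable
  ultimately show ?thesis
    unfolding point_law_def by (intro AE_pair_measure)
qed

text \<open>Tonelli: for a fixed location \<open>y\<close> the inner integral is the tilted
  exponential moment with parameter \<open>k y\<close>.\<close>

lemma nn_integral_point_law_tilted_moment:
  fixes f k :: "real \<Rightarrow> real"
  assumes f: "continuous_on unit_ivl f" "\<And>x. x \<in> unit_ivl \<Longrightarrow> f x \<ge> 0"
    and k: "continuous_on unit_ivl k" "\<And>x. x \<in> unit_ivl \<Longrightarrow> k x > 0"
  shows "(\<integral>\<^sup>+z. ennreal (f (snd z) * fst z ^ j * exp (fst z * (1 - k (snd z)))) \<partial>point_law) =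
    ennreal (\<integral>y. f y * fact j / k y ^ Suc j \<partial>\<nu>)"
proof -
  interpret e: prob_space exp_law by (rule prob_space_exp_law)
  interpret n: prob_space \<nu> using \<nu> by (rule M1_prob_space)
  interpret pair_sigma_finite exp_law \<nu> ..
  note [measurable] = measurable_continuous_snd_point_law[OF f(1)] measurable_continuous_snd_point_law[OF k(1)]
  have m: "(\<lambda>z. ennreal (f (snd z) * fst z ^ j * exp (fst z * (1 - k (snd z))))) \<in> borel_measurable point_law"
    by measurable
  have "(\<integral>\<^sup>+z. ennreal (f (snd z) * fst z ^ j * exp (fst z * (1 - k (snd z)))) \<partial>point_law) =
      (\<integral>\<^sup>+y. \<integral>\<^sup>+w. ennreal (f y * w ^ j * exp (w * (1 - k y))) \<partial>exp_law \<partial>\<nu>)"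
    using nn_integral_snd[OF m[unfolded point_law_def]] by (simp add: point_law_def)
  also have "\<dots> = (\<integral>\<^sup>+y. ennreal (f y * fact j / k y ^ Suc j) \<partial>\<nu>)"
  proof (intro nn_integral_cong)
    fix y assume "y \<in> space \<nu>"
    then have y: "y \<in> unit_ivl" using M1_space[OF \<nu>] by simp
    have "(\<integral>\<^sup>+w. ennreal (f y * w ^ j * exp (w * (1 - k y))) \<partial>exp_law) =
        (\<integral>\<^sup>+w. ennreal (f y) * ennreal (w ^ j * exp (w * (1 - k y))) \<partial>exp_law)"
      using f(2)[OF y] by (simp add: mult.assoc flip: ennreal_mult')
    also have "\<dots> = ennreal (f y) * ennreal (fact j / k y ^ Suc j)"
      by (subst nn_integral_cmult) (auto simp: nn_integral_exp_law_tilted_moment[OF k(2)[OF y]])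
    also have "\<dots> = ennreal (f y * fact j / k y ^ Suc j)"
      using f(2)[OF y] by (simp flip: ennreal_mult')
    finally show "(\<integral>\<^sup>+w. ennreal (f y * w ^ j * exp (w * (1 - k y))) \<partial>exp_law) =
        ennreal (f y * fact j / k y ^ Suc j)" .
  qed
  also have "\<dots> = ennreal (\<integral>y. f y * fact j / k y ^ Suc j \<partial>\<nu>)"
  proof (intro nn_integral_eq_integral M1_integrable[OF \<nu>] AE_I2)
    show "continuous_on unit_ivl (\<lambda>y. f y * fact j / k y ^ Suc j)"
      using k(2) by (intro continuous_intros f k) force
    show "0 \<le> f y * fact j / k y ^ Suc j" if "y \<in> space \<nu>" for y
      using f(2)[of y] k(2)[of y] that M1_space[OF \<nu>] by simp
  qed
  finally show ?thesis .
qed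

text \<open>A signed \<open>f\<close> is the difference of the nonnegative functions
  \<open>f + B\<close> and \<open>B\<close>. The cases \<open>j = 0, 1, 2\<close> later give total
  mass, means and second moments of the tilted law.\<close>

lemma has_bochner_integral_point_law_tilted_moment:
  fixes f k :: "real \<Rightarrow> real"
  assumes f: "continuous_on unit_ivl f"
    and k: "continuous_on unit_ivl k" "\<And>x. x \<in> unit_ivl \<Longrightarrow> k x > 0"
  shows "has_bochner_integral point_law (\<lambda>z. f (snd z) * fst z ^ j * exp (fst z * (1 - k (snd z))))
    (\<integral>y. f y * fact j / k y ^ Suc j \<partial>\<nu>)"
proof -
  have nonneg: "has_bochner_integral point_law (\<lambda>z. f (snd z) * fst z ^ j * exp (fst z * (1 - k (snd z))))
    (\<integral>y. f y * fact j / k y ^ Suc j \<partial>\<nu>)"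
    if f: "continuous_on unit_ivl f" "\<And>x. x \<in> unit_ivl \<Longrightarrow> f x \<ge> 0" for f
  proof (rule has_bochner_integral_nn_integral)
    note [measurable] = measurable_continuous_snd_point_law[OF f(1)] measurable_continuous_snd_point_law[OF k(1)]
    show "(\<lambda>z. f (snd z) * fst z ^ j * exp (fst z * (1 - k (snd z)))) \<in> borel_measurable point_law"
      by measurable
    show "AE z in point_law. 0 \<le> f (snd z) * fst z ^ j * exp (fst z * (1 - k (snd z)))"
      using AE_point_law_nonneg by (rule AE_mp) (auto intro!: AE_I2 mult_nonneg_nonneg f(2) snd_point_law_in_unit simp del: atLeastAtMost_iff)
    show "0 \<le> (\<integral>y. f y * fact j / k y ^ Suc j \<partial>\<nu>)"
    proof (rule integral_nonneg_AE, rule AE_I2)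
      show "0 \<le> f y * fact j / k y ^ Suc j" if "y \<in> space \<nu>" for y
        using f(2)[of y] k(2)[of y] that M1_space[OF \<nu>] by simp
    qed
    show "(\<integral>\<^sup>+z. ennreal (f (snd z) * fst z ^ j * exp (fst z * (1 - k (snd z)))) \<partial>point_law) =
        ennreal (\<integral>y. f y * fact j / k y ^ Suc j \<partial>\<nu>)"
      by (rule nn_integral_point_law_tilted_moment[OF f k])
  qed
  obtain B where B: "B > 0" "\<And>x. x \<in> unit_ivl \<Longrightarrow> \<bar>f x\<bar> \<le> B"
    using continuous_on_unit_bounded[OF f] by metis
  have shifted: "continuous_on unit_ivl (\<lambda>y. f y + B)" "f x + B \<ge> 0" if "x \<in> unit_ivl" for x
    using B(2)[OF that] by (auto intro!: continuous_intros f)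
  have "has_bochner_integral point_law (\<lambda>z. (f (snd z) + B) * fst z ^ j * exp (fst z * (1 - k (snd z))) -
      B * fst z ^ j * exp (fst z * (1 - k (snd z))))
    ((\<integral>y. (f y + B) * fact j / k y ^ Suc j \<partial>\<nu>) - (\<integral>y. B * fact j / k y ^ Suc j \<partial>\<nu>))"
    using shifted B(1) by (intro has_bochner_integral_diff nonneg) (auto intro!: continuous_intros f)
  moreover have "(\<integral>y. (f y + B) * fact j / k y ^ Suc j \<partial>\<nu>) - (\<integral>y. B * fact j / k y ^ Suc j \<partial>\<nu>) =
      (\<integral>y. f y * fact j / k y ^ Suc j \<partial>\<nu>)"
  proof -
    have kk: "k x ^ Suc j \<noteq> 0" if "x \<in> unit_ivl" for x using k(2)[OF that] by simp
    have "(\<integral>y. (f y + B) * fact j / k y ^ Suc j \<partial>\<nu>) - (\<integral>y. B * fact j / k y ^ Suc j \<partial>\<nu>) =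
        (\<integral>y. (f y + B) * fact j / k y ^ Suc j - B * fact j / k y ^ Suc j \<partial>\<nu>)"
      using kk by (intro Bochner_Integration.integral_diff[symmetric] M1_integrable[OF \<nu>] continuous_intros f k) auto
    also have "\<dots> = (\<integral>y. f y * fact j / k y ^ Suc j \<partial>\<nu>)"
      by (simp add: algebra_simps add_divide_distrib)
    finally show ?thesis .
  qed
  ultimately show ?thesis by (simp add: algebra_simps)
qed

end

section \<open>Measurability\<close>

lemma openin_in_sets_borel_sigma: "openin T U \<Longrightarrow> U \<in> sets (borel_sigma T)"
  unfolding borel_sigma_def by (subst sets_measure_of) (auto dest: openin_subset)

lemma closedin_in_sets_borel_sigma:
  assumes "closedin T C"
  shows "C \<in> sets (borel_sigma T)"
proof -
  have "topspace T - (topspace T - C) \<in> sets (borel_sigma T)"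
    using assms by (intro sets.Diff openin_in_sets_borel_sigma) (auto simp: closedin_def)
  then show ?thesis using closedin_subset[OF assms] by (simp add: double_diff)
qed

text \<open>For an open set, membership means that the truncated weights sum to 1 and that the
  moments lie in an open set, both measurable conditions. Induction over the generated sigma-algebra
  does the rest.\<close>

lemma weighted_empirical_vimage_measurable:
  assumes x: "\<And>i. i \<in> {1..n} \<Longrightarrow> x i \<in> borel_measurable M"
    and y: "\<And>i. i \<in> {1..n} \<Longrightarrow> y i \<in> measurable M borel_unit"
    and A: "A \<in> sets (borel_sigma weak_topology)"
  shows "{\<omega> \<in> space M. weighted_empirical n (\<lambda>i. x i \<omega>) (\<lambda>i. y i \<omega>) \<in> A} \<in> sets M"
proof -
  define W where "W \<omega> = weighted_empirical n (\<lambda>i. x i \<omega>) (\<lambda>i. y i \<omega>)" for \<omega>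
  have yu: "y i \<omega> \<in> unit_ivl" if "\<omega> \<in> space M" "i \<in> {1..n}" for i \<omega>
    using measurable_space[OF y[OF that(2)] that(1)] by simp
  have y': "y i \<in> borel_measurable M" if "i \<in> {1..n}" for i
    using y[OF that] by (simp add: measurable_restrict_space2_iff)
  have open_case: "{\<omega> \<in> space M. W \<omega> \<in> G} \<in> sets M" if G: "openin weak_topology G" for G
  proof -
    obtain V where V: "open V" "G = {\<mu> \<in> M1. moments \<mu> \<in> V}"
      using weak_topology_pullback_moments[OF G] .
    define S where "S \<omega> = (\<Sum>i=1..n. max 0 (x i \<omega>))" for \<omega>
    define m where "m \<omega> k = (\<Sum>i=1..n. max 0 (x i \<omega>) * y i \<omega> ^ k)" for \<omega> k
    have S: "S \<in> borel_measurable M" unfolding S_def using x by simp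
    have m: "m \<in> borel_measurable M"
      unfolding m_def using x y' by (intro measurable_coordinatewise_then_product borel_measurable_sum) auto
    have "W \<omega> \<in> G \<longleftrightarrow> S \<omega> = 1 \<and> m \<omega> \<in> V" if "\<omega> \<in> space M" for \<omega>
    proof -
      have "W \<omega> \<in> M1 \<longleftrightarrow> S \<omega> = 1"
        unfolding W_def S_def by (rule weighted_empirical_in_M1_iff) (rule yu[OF that])
      moreover have "moments (W \<omega>) = m \<omega>"
        unfolding W_def moments_def m_def
        by (intro ext integral_weighted_empirical yu[OF that] continuous_intros)
      ultimately show ?thesis using V by simp
    qed
    then have "{\<omega> \<in> space M. W \<omega> \<in> G} = {\<omega> \<in> space M. S \<omega> = 1} \<inter> (m -` V \<inter> space M)" by auto
    also have "\<dots> \<in> sets M"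
      using S m V(1) by (intro sets.Int measurable_sets[OF m]) auto
    finally show ?thesis .
  qed
  have "A \<in> sigma_sets M1 {U. openin weak_topology U}"
  proof -
    have "{U. openin weak_topology U} \<subseteq> Pow M1"
      using openin_subset[of weak_topology] by auto
    then show ?thesis using A by (simp add: borel_sigma_def)
  qed
  then have "{\<omega> \<in> space M. W \<omega> \<in> A} \<in> sets M"
  proof induction
    case (Compl a)
    \<comment> \<open>Complements are taken within \<open>M1\<close>, which \<open>W\<close> may
      leave, so the event \<open>W \<omega> \<in> M1\<close> enters.\<close>
    have "{\<omega> \<in> space M. W \<omega> \<in> M1 - a} = {\<omega> \<in> space M. W \<omega> \<in> M1} - {\<omega> \<in> space M. W \<omega> \<in> a}" by auto
    moreover have "{\<omega> \<in> space M. W \<omega> \<in> M1} \<in> sets M"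
      using open_case[OF openin_topspace] by simp
    ultimately show ?case using Compl.IH by simp
  next
    case (Union a)
    have "{\<omega> \<in> space M. W \<omega> \<in> (\<Union>i. a i)} = (\<Union>i. {\<omega> \<in> space M. W \<omega> \<in> a i})" by auto
    then show ?case using Union.IH by auto
  qed (use open_case in auto)
  then show ?thesis by (simp add: W_def)
qed

section \<open>Chernoff bound and change of measure for the normalised marked points\<close>

context reference_law
begin

definition marked_law :: "nat \<Rightarrow> (nat \<Rightarrow> real \<times> real) measure" where
  "marked_law n = PiM {1..n} (\<lambda>_. point_law)"

definition normalized :: "nat \<Rightarrow> (nat \<Rightarrow> real \<times> real) \<Rightarrow> real measure" where
  "normalized n z = weighted_empirical n (\<lambda>i. fst (z i) / (\<Sum>k=1..n. fst (z k))) (\<lambda>i. snd (z i))"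

lemma prob_space_marked_law: "prob_space (marked_law n)"
  unfolding marked_law_def by (intro prob_space_PiM prob_space_point_law)

lemma measurable_component_marked_law:
  "i \<in> {1..n} \<Longrightarrow> (\<lambda>z. z i) \<in> measurable (marked_law n) point_law"
  unfolding marked_law_def by (rule measurable_component_singleton)

lemma measurable_fst_marked_law: "i \<in> {1..n} \<Longrightarrow> (\<lambda>z. fst (z i)) \<in> borel_measurable (marked_law n)"
  using measurable_compose[OF measurable_component_marked_law measurable_fst_point_law] by blast

lemma measurable_snd_marked_law: "i \<in> {1..n} \<Longrightarrow> (\<lambda>z. snd (z i)) \<in> measurable (marked_law n) borel_unit"
  using measurable_compose[OF measurable_component_marked_law measurable_snd_point_law] by blast

lemma measurable_continuous_marked_law:
  fixes f :: "real \<Rightarrow> real"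
  shows "continuous_on unit_ivl f \<Longrightarrow> i \<in> {1..n} \<Longrightarrow> (\<lambda>z. f (snd (z i))) \<in> borel_measurable (marked_law n)"
  using measurable_compose[OF measurable_component_marked_law measurable_continuous_snd_point_law] by blast

lemma marked_law_snd_in_unit: "z \<in> space (marked_law n) \<Longrightarrow> i \<in> {1..n} \<Longrightarrow> snd (z i) \<in> unit_ivl"
  using measurable_space[OF measurable_snd_marked_law] by simp

lemma AE_marked_law_nonneg: "AE z in marked_law n. \<forall>i\<in>{1..n}. 0 \<le> fst (z i)"
proof (rule AE_finite_allI)
  fix i assume "i \<in> {1..n}"
  then show "AE z in marked_law n. 0 \<le> fst (z i)"
    unfolding marked_law_def by (intro AE_PiM_component prob_space_point_law AE_point_law_nonneg)
qed simp

lemma normalized_vimage_measurable: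
  assumes "A \<in> sets (borel_sigma weak_topology)"
  shows "{z \<in> space (marked_law n). normalized n z \<in> A} \<in> sets (marked_law n)"
  unfolding normalized_def
proof (rule weighted_empirical_vimage_measurable[OF _ _ assms])
  show "(\<lambda>z. fst (z i) / (\<Sum>k=1..n. fst (z k))) \<in> borel_measurable (marked_law n)" if "i \<in> {1..n}" for i
    using that by (intro borel_measurable_divide borel_measurable_sum measurable_fst_marked_law)
qed (rule measurable_snd_marked_law)

text \<open>Chernoff bound: \<open>\<langle>W\<^sub>n, h\<rangle> < s\<close> is the event \<open>\<Sum>\<^sub>i w\<^sub>i (1 - h(y\<^sub>i) / s) > 0\<close>, in which the random
  normalisation no longer occurs.\<close>

lemma normalized_upper_bound:
  assumes h: "continuous_on unit_ivl h" "\<And>x. x \<in> unit_ivl \<Longrightarrow> h x > 0" and s: "s > 0"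
  shows "measure (marked_law n) {z \<in> space (marked_law n). normalized n z \<in> {\<mu> \<in> M1. (\<integral>x. h x \<partial>\<mu>) \<in> {..<s}}}
    \<le> (s * (\<integral>x. 1 / h x \<partial>\<nu>)) ^ n"
proof -
  interpret P: prob_space "marked_law n" by (rule prob_space_marked_law)
  interpret point_law: prob_space point_law by (rule prob_space_point_law)
  interpret product_sigma_finite "\<lambda>_. point_law" ..
  let ?E = "{z \<in> space (marked_law n). normalized n z \<in> {\<mu> \<in> M1. (\<integral>x. h x \<partial>\<mu>) \<in> {..<s}}}"
  define T where "T z = ennreal (exp (fst z * (1 - h (snd z) / s)))" for z
  have E: "?E \<in> sets (marked_law n)"
    by (intro normalized_vimage_measurable openin_in_sets_borel_sigma openin_weak_topology_basic h) simp
  have T: "T \<in> borel_measurable point_law"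
    unfolding T_def using measurable_continuous_snd_point_law[OF h(1)] by measurable
  have Z: "(\<integral>x. 1 / h x \<partial>\<nu>) \<ge> 0"
    using h(2) by (intro integral_nonneg_AE AE_I2) (auto simp: M1_space[OF \<nu>] less_imp_le)
  have "emeasure (marked_law n) ?E = (\<integral>\<^sup>+z. indicator ?E z \<partial>marked_law n)"
    using E by simp
  also have "\<dots> \<le> (\<integral>\<^sup>+z. (\<Prod>i\<in>{1..n}. T (z i)) \<partial>marked_law n)"
  proof (rule nn_integral_mono_AE)
    show "AE z in marked_law n. indicator ?E z \<le> (\<Prod>i\<in>{1..n}. T (z i))"
      using AE_marked_law_nonneg[of n]
    proof eventually_elim
      case (elim z)
      show ?case
      proof (cases "z \<in> ?E")
        case True
        define b where "b = (\<Sum>k=1..n. fst (z k))"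
        have yu: "snd (z i) \<in> unit_ivl" if "i \<in> {1..n}" for i
          using True that marked_law_snd_in_unit by blast
        have b: "b \<ge> 0" unfolding b_def using elim by (intro sum_nonneg) auto
        have x: "max 0 (fst (z i) / b) = fst (z i) / b" if "i \<in> {1..n}" for i
          using elim b that by (simp add: max_absorb2)
        have "normalized n z \<in> M1" and less: "(\<integral>x. h x \<partial>normalized n z) < s" using True by auto
        then have "(\<Sum>i=1..n. max 0 (fst (z i) / b)) = 1"
          using weighted_empirical_in_M1_iff[of n "\<lambda>i. snd (z i)"] yu by (simp add: normalized_def b_def)
        \<comment> \<open>For \<open>b = 0\<close> every quotient would be 0, as division by zero
          yields 0, and the sum could not be 1.\<close>
        then have "b \<noteq> 0" by auto
        with b have b: "b > 0" by simp
        have "(\<integral>x. h x \<partial>normalized n z) = (\<Sum>i=1..n. max 0 (fst (z i) / b) * h (snd (z i)))"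
          unfolding normalized_def b_def by (intro integral_weighted_empirical yu h)
        also have "\<dots> = (\<Sum>i=1..n. fst (z i) * h (snd (z i))) / b"
          by (simp add: x sum_divide_distrib)
        finally have "(\<Sum>i=1..n. fst (z i) * h (snd (z i))) / b < s"
          using less by simp
        then have "(\<Sum>i=1..n. fst (z i) * h (snd (z i))) < s * b"
          using b by (simp only: pos_divide_less_eq)
        then have "0 \<le> b - (\<Sum>i=1..n. fst (z i) * h (snd (z i))) / s"
          using s by (simp add: field_simps)
        also have "\<dots> = (\<Sum>i=1..n. fst (z i) * (1 - h (snd (z i)) / s))"
          by (simp add: b_def algebra_simps sum_subtractf sum_divide_distrib)
        finally have "1 \<le> exp (\<Sum>i=1..n. fst (z i) * (1 - h (snd (z i)) / s))" by simp
        then show ?thesis using True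
          by (simp add: T_def exp_sum prod_ennreal)
      qed simp
    qed
  qed
  also have "\<dots> = (\<Prod>i\<in>{1..n}. \<integral>\<^sup>+z. T z \<partial>point_law)"
    unfolding marked_law_def by (intro product_nn_integral_prod T) simp
  \<comment> \<open>This is the tilted moment with \<open>j = 0\<close> and
    \<open>k = h / s\<close>.\<close>
  also have "(\<integral>\<^sup>+z. T z \<partial>point_law) = ennreal (s * (\<integral>x. 1 / h x \<partial>\<nu>))"
  proof -
    have "continuous_on unit_ivl (\<lambda>x. h x / s)"
      using s by (intro continuous_intros h) auto
    then have "(\<integral>\<^sup>+z. T z \<partial>point_law) = ennreal (\<integral>y. 1 * fact 0 / (h y / s) ^ Suc 0 \<partial>\<nu>)"
      using nn_integral_point_law_tilted_moment[of "\<lambda>_. 1" "\<lambda>x. h x / s" 0] h s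
      by (auto simp: T_def)
    then show ?thesis by (simp add: divide_inverse mult.commute)
  qed
  also have "(\<Prod>i\<in>{1..n}. ennreal (s * (\<integral>x. 1 / h x \<partial>\<nu>))) = ennreal ((s * (\<integral>x. 1 / h x \<partial>\<nu>)) ^ n)"
    using s Z by (simp add: ennreal_power)
  finally show ?thesis
    using s Z by (simp add: P.emeasure_eq_measure)
qed

text \<open>Change of measure: under the tilted law \<open>Q\<close> the points \<open>(w, y)\<close> have mean measure \<open>g \<nu>\<close>, and
  the weights satisfy \<open>\<Sum>\<^sub>i w\<^sub>i \<approx> n \<approx> \<Sum>\<^sub>i w\<^sub>i h(y\<^sub>i)\<close>, so that the likelihood ratio on a typical event
  is \<open>r\<^bsup>2n\<^esup>\<close> up to subexponential factors.\<close>

lemma normalized_lower_bound: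
  assumes g: "continuous_on unit_ivl g" "\<And>x. x \<in> unit_ivl \<Longrightarrow> g x > 0" "(\<integral>x. g x \<partial>\<nu>) = 1"
    and G: "openin weak_topology G" "density \<nu> (\<lambda>x. ennreal (g x)) \<in> G" and \<eta>: "\<eta> > 0"
  shows "\<forall>\<^sub>F n in sequentially. exp (real n * (2 * ln (\<integral>x. sqrt (g x) \<partial>\<nu>) - \<eta>)) / 2
    \<le> measure (marked_law n) {z \<in> space (marked_law n). normalized n z \<in> G}"
proof -
  define r where "r = (\<integral>x. sqrt (g x) \<partial>\<nu>)"
  have r: "r > 0"
    unfolding r_def using g by (intro M1_integral_pos \<nu> continuous_intros) auto
  \<comment> \<open>The tilted mean weight at \<open>y\<close> is
    \<open>1 / (h y)\<^sup>2 = r\<^sup>2 * g y\<close>, and the total mass of the tilt is the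
    integral of \<open>1 / h\<close>, which is \<open>r\<^sup>2\<close>. After normalisation the
    mean measure is therefore \<open>g \<nu>\<close>.\<close>
  define h where "h y = 1 / (r * sqrt (g y))" for y
  have h: "continuous_on unit_ivl h" "\<And>x. x \<in> unit_ivl \<Longrightarrow> h x > 0"
  proof -
    have "r * sqrt (g x) \<noteq> 0" if "x \<in> unit_ivl" for x using g(2)[OF that] r by simp
    then show "continuous_on unit_ivl h"
      unfolding h_def by (intro continuous_intros g) auto
    show "h x > 0" if "x \<in> unit_ivl" for x using g(2)[OF that] r by (simp add: h_def)
  qed
  have h_inv: "1 / h x = r * sqrt (g x)" for x by (simp add: h_def)
  have h_inv2: "1 / (h x)\<^sup>2 = r\<^sup>2 * g x" if "x \<in> unit_ivl" for x
    using g(2)[OF that] by (simp add: h_def power_divide power_mult_distrib)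
  define L where "L z = exp (fst z * (1 - h (snd z))) / r\<^sup>2" for z
  have L_pos: "L z > 0" for z using r by (simp add: L_def)
  have L_meas: "L \<in> borel_measurable point_law"
    unfolding L_def using measurable_continuous_snd_point_law[OF h(1)] by measurable
  define Q where "Q = density point_law (\<lambda>z. ennreal (L z))"
  have moment: "has_bochner_integral Q (\<lambda>z. f (snd z) * fst z ^ j) ((\<integral>y. f y * fact j / h y ^ Suc j \<partial>\<nu>) / r\<^sup>2)"
    if f: "continuous_on unit_ivl f" for f j
  proof -
    have "has_bochner_integral point_law (\<lambda>z. L z *\<^sub>R (f (snd z) * fst z ^ j)) ((\<integral>y. f y * fact j / h y ^ Suc j \<partial>\<nu>) / r\<^sup>2)"
      using has_bochner_integral_divide_zero[OF has_bochner_integral_point_law_tilted_moment[OF f h, of j], of "r\<^sup>2"]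
      by (simp add: L_def mult_ac)
    moreover have "(\<lambda>z. f (snd z) * fst z ^ j) \<in> borel_measurable point_law"
      using measurable_continuous_snd_point_law[OF f] by measurable
    ultimately show ?thesis
      unfolding Q_def using L_meas L_pos by (intro has_bochner_integral_density) (auto simp: less_imp_le)
  qed
  have Q: "prob_space Q"
  proof
    have "emeasure Q (space Q) = (\<integral>\<^sup>+z. 1 \<partial>Q)" by simp
    also have "\<dots> = ennreal ((\<integral>y. 1 / h y \<partial>\<nu>) / r\<^sup>2)"
      using nn_integral_eq_integral[of Q "\<lambda>_. 1"] moment[of "\<lambda>_. 1" 0]
      by (simp add: has_bochner_integral_iff)
    also have "(\<integral>y. 1 / h y \<partial>\<nu>) / r\<^sup>2 = 1"
      using r by (simp add: h_inv r_def power2_eq_square)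
    finally show "emeasure Q (space Q) = 1" by simp
  qed
  interpret Q: prob_space Q by fact
  define \<mu> where "\<mu> = density \<nu> (\<lambda>x. ennreal (g x))"
  define c where "c f = (\<integral>x. g x * f x \<partial>\<nu>)" for f
  have c: "c f = (\<integral>x. f x \<partial>\<mu>)" if "continuous_on unit_ivl f" for f
    unfolding \<mu>_def c_def using g that by (subst integral_density_M1[OF \<nu>]) (auto simp: less_imp_le)
  have mean: "integrable Q (\<lambda>z. f (snd z) * fst z)" "(\<integral>z. f (snd z) * fst z \<partial>Q) = c f"
    "integrable Q (\<lambda>z. (f (snd z) * fst z)\<^sup>2)" if f: "continuous_on unit_ivl f" for f
  proof -
    show "integrable Q (\<lambda>z. f (snd z) * fst z)"
      using moment[OF f, of 1] by (simp add: has_bochner_integral_iff)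
    show "integrable Q (\<lambda>z. (f (snd z) * fst z)\<^sup>2)"
      using moment[of "\<lambda>x. (f x)\<^sup>2" 2] f
      by (auto simp: has_bochner_integral_iff power_mult_distrib intro!: continuous_intros)
    have "(\<integral>z. f (snd z) * fst z \<partial>Q) = (\<integral>y. f y * (1 / (h y)\<^sup>2) \<partial>\<nu>) / r\<^sup>2"
      using moment[OF f, of 1] by (simp add: has_bochner_integral_iff power2_eq_square)
    also have "(\<integral>y. f y * (1 / (h y)\<^sup>2) \<partial>\<nu>) = (\<integral>y. r\<^sup>2 * (g y * f y) \<partial>\<nu>)"
      by (intro Bochner_Integration.integral_cong refl) (simp only: M1_space[OF \<nu>] h_inv2 mult_ac)
    also have "\<dots> / r\<^sup>2 = c f" using r by (simp add: c_def)
    finally show "(\<integral>z. f (snd z) * fst z \<partial>Q) = c f" .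
  qed
  have c1: "c (\<lambda>_. 1) = 1" using g(3) by (simp add: c_def)
  have ch: "c h = 1"
  proof -
    have "c h = (\<integral>x. sqrt (g x) / r \<partial>\<nu>)"
      unfolding c_def
    proof (intro Bochner_Integration.integral_cong refl)
      fix x assume "x \<in> space \<nu>"
      then have "g x > 0" using g(2) M1_space[OF \<nu>] by simp
      then have "g x = sqrt (g x) * sqrt (g x)" by simp
      then show "g x * h x = sqrt (g x) / r" using \<open>g x > 0\<close> r by (simp add: h_def field_simps)
    qed
    then show ?thesis using r by (simp add: r_def)
  qed
  obtain F :: "(real \<Rightarrow> real) set" and \<delta>0 where F: "finite F" "\<forall>f\<in>F. continuous_on unit_ivl f" "\<delta>0 > 0"
    "\<forall>\<mu>'\<in>M1. (\<forall>f\<in>F. \<bar>(\<integral>x. f x \<partial>\<mu>') - (\<integral>x. f x \<partial>\<mu>)\<bar> < \<delta>0) \<longrightarrow> \<mu>' \<in> G"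
    using weak_topology_nbhd[OF G(1), of \<mu>] G(2) unfolding \<mu>_def by blast
  define K where "K = (\<Sum>f\<in>F. \<bar>c f\<bar>)"
  have K: "\<bar>c f\<bar> \<le> K" if "f \<in> F" for f
    unfolding K_def using F(1) that by (intro member_le_sum) auto
  have K0: "K \<ge> 0" unfolding K_def by (intro sum_nonneg) auto
  \<comment> \<open>The bound 1/4 keeps the total weight above \<open>n / 2\<close>,
    \<open>\<eta> / 2\<close> limits the exponent of the likelihood ratio, and the last term limits
    the error of the normalised integrals.\<close>
  define \<delta> where "\<delta> = min (1 / 4) (min (\<eta> / 2) (\<delta>0 / (2 * (1 + K))))"
  have \<delta>: "\<delta> > 0" "\<delta> \<le> 1 / 4" "2 * \<delta> \<le> \<eta>" "2 * \<delta> * (1 + K) \<le> \<delta>0"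
  proof -
    show "\<delta> > 0" using \<eta> F(3) K0 by (simp add: \<delta>_def)
    show "\<delta> \<le> 1 / 4" "2 * \<delta> \<le> \<eta>" unfolding \<delta>_def by linarith+
    have "\<delta> \<le> \<delta>0 / (2 * (1 + K))" unfolding \<delta>_def by linarith
    moreover have "2 * (1 + K) > 0" using K0 by simp
    ultimately show "2 * \<delta> * (1 + K) \<le> \<delta>0" by (simp add: pos_le_divide_eq mult_ac)
  qed
  \<comment> \<open>The constant controls the total weight, its difference from \<open>h\<close> the
    likelihood ratio, and \<open>F\<close> the membership in \<open>G\<close>.\<close>
  define F' where "F' = insert (\<lambda>_. 1) (insert h F)"
  have F': "finite F'" "\<And>f. f \<in> F' \<Longrightarrow> continuous_on unit_ivl f"
    using F h by (auto simp: F'_def)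
  define S where "S n f z = (\<Sum>i\<in>{1..n}. f (snd (z i)) * fst (z i))" for n f and z :: "nat \<Rightarrow> real \<times> real"
  define E where "E n = {z \<in> space (marked_law n). \<forall>f\<in>F'. \<bar>S n f z - real n * c f\<bar> < real n * \<delta>}" for n
  have S_meas: "S n f \<in> borel_measurable (marked_law n)" if "continuous_on unit_ivl f" for n f
    unfolding S_def
    by (intro borel_measurable_sum borel_measurable_times measurable_continuous_marked_law
        measurable_fst_marked_law that)
  have E_meas: "E n \<in> sets (marked_law n)" for n
  proof -
    have "{z \<in> space (marked_law n). \<bar>S n f z - real n * c f\<bar> < real n * \<delta>} \<in> sets (marked_law n)"
      if "f \<in> F'" for f
      using S_meas[OF F'(2)[OF that]] by measurable
    then show ?thesis
      unfolding E_def using F'(1) by (intro sets.sets_Collect_finite_All) auto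
  qed
  \<comment> \<open>Chebyshev and a union bound over \<open>F'\<close>: the exceptional probability
    is at most a constant divided by \<open>n\<close>.\<close>
  have typical: "\<forall>\<^sub>F n in sequentially. measure (PiM {1..n} (\<lambda>_. Q)) (E n) \<ge> 1 / 2"
  proof -
    define V where "V f = (\<integral>z. (f (snd z) * fst z - c f)\<^sup>2 \<partial>Q)" for f
    have "(\<lambda>n. (\<Sum>f\<in>F'. V f) / \<delta>\<^sup>2 / real n) \<longlonglongrightarrow> 0"
      by (rule lim_const_over_n)
    then have "\<forall>\<^sub>F n in sequentially. (\<Sum>f\<in>F'. V f) / \<delta>\<^sup>2 / real n < 1 / 2"
      by (rule order_tendstoD(2)) simp
    then show ?thesis
      using eventually_ge_at_top[of 1]
    proof eventually_elim
      case (elim n)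
      let ?P = "PiM {1..n} (\<lambda>_. Q)"
      interpret P: prob_space ?P by (intro prob_space_PiM Q)
      have sets_P: "sets ?P = sets (marked_law n)"
        unfolding marked_law_def Q_def by (intro sets_PiM_cong) auto
      have space_P: "space ?P = space (marked_law n)" by (rule sets_eq_imp_space_eq[OF sets_P])
      define B where "B f = {z \<in> space ?P. \<bar>S n f z - real n * c f\<bar> \<ge> real n * \<delta>}" for f
      have B_meas: "B f \<in> sets ?P" if "f \<in> F'" for f
        unfolding B_def space_P sets_P using S_meas[OF F'(2)[OF that]] by measurable
      have "P.prob (B f) \<le> V f / (real n * \<delta>\<^sup>2)" if "f \<in> F'" for f
        using PiM_Chebyshev[OF Q mean(1,3,2)[OF F'(2)[OF that]], of "{1..n}" \<delta>] \<delta>(1) elim(2)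
        by (simp add: B_def S_def V_def)
      then have "P.prob (\<Union>f\<in>F'. B f) \<le> (\<Sum>f\<in>F'. V f / (real n * \<delta>\<^sup>2))"
        using B_meas F'(1)
        by (intro order_trans[OF P.finite_measure_subadditive_finite] sum_mono) auto
      also have "\<dots> = (\<Sum>f\<in>F'. V f) / \<delta>\<^sup>2 / real n" by (simp add: sum_divide_distrib mult.commute)
      finally have le: "P.prob (\<Union>f\<in>F'. B f) < 1 / 2" using elim(1) by linarith
      have "E n = space ?P - (\<Union>f\<in>F'. B f)"
        unfolding E_def B_def space_P by (auto simp: not_le)
      then have "P.prob (E n) = 1 - P.prob (\<Union>f\<in>F'. B f)"
        using B_meas F'(1) by (simp only: P.prob_compl sets.finite_UN)
      then show ?case using le by linarith
    qed
  qed
  show ?thesis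
    unfolding r_def[symmetric] using typical eventually_ge_at_top[of 1]
  proof eventually_elim
    case (elim n)
    interpret P: prob_space "marked_law n" by (rule prob_space_marked_law)
    interpret PQ: prob_space "PiM {1..n} (\<lambda>_. Q)" by (intro prob_space_PiM Q)
    have n: "real n > 0" using elim(2) by simp
    have "PiM {1..n} (\<lambda>_. Q) = density (marked_law n) (\<lambda>z. \<Prod>i\<in>{1..n}. ennreal (L (z i)))"
      unfolding Q_def marked_law_def using L_meas Q
      by (intro PiM_density[symmetric] prob_space_point_law) (auto simp: Q_def)
    then have "emeasure (PiM {1..n} (\<lambda>_. Q)) (E n) =
        (\<integral>\<^sup>+z. (\<Prod>i\<in>{1..n}. ennreal (L (z i))) * indicator (E n) z \<partial>marked_law n)"
      using measurable_compose[OF measurable_component_marked_law L_meas, of _ n] E_meas[of n]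
      by (simp add: emeasure_density)
    \<comment> \<open>On \<open>E n\<close> the likelihood ratio is the exponential of
      \<open>S n (\<lambda>_. 1) z - S n h z\<close> over \<open>(r\<^sup>2) ^ n\<close>, and both
      sums are within \<open>real n * \<delta>\<close> of \<open>n\<close>.\<close>
    also have "\<dots> \<le> (\<integral>\<^sup>+z. ennreal (exp (2 * \<delta> * real n) / (r\<^sup>2) ^ n) * indicator (E n) z \<partial>marked_law n)"
    proof (intro nn_integral_mono)
      fix z assume "z \<in> space (marked_law n)"
      show "(\<Prod>i\<in>{1..n}. ennreal (L (z i))) * indicator (E n) z
          \<le> ennreal (exp (2 * \<delta> * real n) / (r\<^sup>2) ^ n) * indicator (E n) z"
      proof (cases "z \<in> E n")
        case True
        then have dev: "\<bar>S n (\<lambda>_. 1) z - real n * 1\<bar> < real n * \<delta>" "\<bar>S n h z - real n * 1\<bar> < real n * \<delta>"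
          using c1 ch by (auto simp: E_def F'_def)
        have "(\<Prod>i\<in>{1..n}. L (z i)) = exp (\<Sum>i\<in>{1..n}. fst (z i) * (1 - h (snd (z i)))) / (r\<^sup>2) ^ n"
          by (simp add: L_def prod_dividef exp_sum)
        also have "(\<Sum>i\<in>{1..n}. fst (z i) * (1 - h (snd (z i)))) = S n (\<lambda>_. 1) z - S n h z"
          by (simp add: S_def algebra_simps sum_subtractf)
        also have "exp (S n (\<lambda>_. 1) z - S n h z) / (r\<^sup>2) ^ n \<le> exp (2 * \<delta> * real n) / (r\<^sup>2) ^ n"
          using dev r by (intro divide_right_mono) (auto simp: abs_less_iff algebra_simps)
        finally have "(\<Prod>i\<in>{1..n}. L (z i)) \<le> exp (2 * \<delta> * real n) / (r\<^sup>2) ^ n" .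
        then show ?thesis using True L_pos by (simp add: prod_ennreal less_imp_le ennreal_leI)
      qed simp
    qed
    also have "\<dots> = ennreal (exp (2 * \<delta> * real n) / (r\<^sup>2) ^ n * P.prob (E n))"
      using E_meas[of n] r
      by (simp add: nn_integral_cmult_indicator P.emeasure_eq_measure flip: ennreal_mult')
    finally have "measure (PiM {1..n} (\<lambda>_. Q)) (E n) \<le> exp (2 * \<delta> * real n) / (r\<^sup>2) ^ n * P.prob (E n)"
      unfolding PQ.emeasure_eq_measure using r by (subst (asm) ennreal_le_iff) auto
    then have "1 / 2 \<le> exp (2 * \<delta> * real n) / (r\<^sup>2) ^ n * P.prob (E n)" using elim(1) by linarith
    also have "exp (2 * \<delta> * real n) / (r\<^sup>2) ^ n = exp (- (real n * (2 * ln r - 2 * \<delta>)))"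
    proof -
      have "(r\<^sup>2) ^ n = exp (real n * (2 * ln r))"
        using r by (simp add: exp_of_nat_mult exp_double)
      then show ?thesis by (simp add: algebra_simps flip: exp_diff)
    qed
    finally have "exp (real n * (2 * ln r - 2 * \<delta>)) * (1 / 2) \<le>
        exp (real n * (2 * ln r - 2 * \<delta>)) * (exp (- (real n * (2 * ln r - 2 * \<delta>))) * P.prob (E n))"
      by (intro mult_left_mono) auto
    then have "exp (real n * (2 * ln r - 2 * \<delta>)) / 2 \<le> P.prob (E n)"
      unfolding mult.assoc[symmetric] exp_minus_inverse by simp
    moreover have "exp (real n * (2 * ln r - \<eta>)) \<le> exp (real n * (2 * ln r - 2 * \<delta>))"
      using n \<delta>(3) by simp
    moreover have "P.prob (E n) \<le> P.prob {z \<in> space (marked_law n). normalized n z \<in> G}"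
    proof (rule P.finite_measure_mono_AE)
      show "{z \<in> space (marked_law n). normalized n z \<in> G} \<in> sets (marked_law n)"
        by (intro normalized_vimage_measurable openin_in_sets_borel_sigma G)
      \<comment> \<open>The inclusion holds almost everywhere, since dropping the truncation
        \<open>max 0\<close> uses nonnegative weights.\<close>
      show "AE z in marked_law n. z \<in> E n \<longrightarrow> z \<in> {z \<in> space (marked_law n). normalized n z \<in> G}"
        using AE_marked_law_nonneg[of n]
      proof eventually_elim
        case (elim z)
        show ?case
        proof
          assume z: "z \<in> E n"
          then have zs: "z \<in> space (marked_law n)" by (simp add: E_def)
          define b where "b = (\<Sum>k=1..n. fst (z k))"
          have b_eq: "S n (\<lambda>_. 1) z = b" by (simp add: S_def b_def)
          have dev: "\<bar>S n f z - real n * c f\<bar> < real n * \<delta>" if "f \<in> F'" for f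
            using z that by (auto simp: E_def)
          have bn: "\<bar>b - real n\<bar> < real n * \<delta>"
            using dev[of "\<lambda>_. 1"] by (simp add: F'_def b_eq c1)
          have "real n * \<delta> \<le> real n * (1 / 4)" using \<delta>(2) n by (intro mult_left_mono) auto
          then have b: "b > real n / 2" "b > 0" using bn n by linarith+
          have x: "max 0 (fst (z i) / b) = fst (z i) / b" if "i \<in> {1..n}" for i
            using elim b that by (simp add: max_absorb2)
          have yu: "snd (z i) \<in> unit_ivl" if "i \<in> {1..n}" for i
            using marked_law_snd_in_unit[OF zs that] .
          have "(\<Sum>i=1..n. max 0 (fst (z i) / b)) = (\<Sum>i=1..n. fst (z i)) / b"
            by (simp add: x sum_divide_distrib)
          also have "\<dots> = 1" using b by (simp add: b_def)
          finally have "normalized n z \<in> M1"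
            unfolding normalized_def b_def[symmetric]
            using weighted_empirical_in_M1_iff[of n "\<lambda>i. snd (z i)"] yu by blast
          moreover have "\<bar>(\<integral>x. f x \<partial>normalized n z) - (\<integral>x. f x \<partial>\<mu>)\<bar> < \<delta>0" if f: "f \<in> F" for f
          proof -
            have fc: "continuous_on unit_ivl f" using F(2) f by blast
            have fF': "f \<in> F'" using f by (simp add: F'_def)
            have "(\<integral>x. f x \<partial>normalized n z) = (\<Sum>i=1..n. max 0 (fst (z i) / b) * f (snd (z i)))"
              unfolding normalized_def b_def by (intro integral_weighted_empirical yu fc)
            also have "\<dots> = S n f z / b"
              by (simp add: x S_def sum_divide_distrib mult.commute)
            finally have eq: "(\<integral>x. f x \<partial>normalized n z) = S n f z / b" .
            \<comment> \<open>The integral is the quotient \<open>S n f z / b\<close>. Its numerator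
              differs from \<open>c f * b\<close> by less than
              \<open>real n * \<delta> * (1 + K)\<close>, and \<open>b > real n / 2\<close> turns
              this into a bound by \<open>\<delta>0 * b\<close>.\<close>
            have "\<bar>S n f z - c f * b\<bar> \<le> \<bar>S n f z - real n * c f\<bar> + \<bar>c f\<bar> * \<bar>b - real n\<bar>"
            proof -
              have "S n f z - c f * b = (S n f z - real n * c f) - c f * (b - real n)"
                by (simp add: algebra_simps)
              then show ?thesis by (metis abs_mult abs_triangle_ineq4)
            qed
            also have "\<dots> < real n * \<delta> + K * (real n * \<delta>)"
              using dev[OF fF'] bn K[OF f] by (intro add_less_le_mono mult_mono) auto
            also have "\<dots> = (2 * \<delta> * (1 + K)) * (real n / 2)" by (simp add: algebra_simps)
            also have "\<dots> \<le> \<delta>0 * b"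
              using \<delta> b n F(3) by (intro mult_mono) auto
            finally have "\<bar>S n f z - c f * b\<bar> / b < \<delta>0" using b by (simp add: pos_divide_less_eq)
            moreover have "\<bar>S n f z / b - c f\<bar> = \<bar>S n f z - c f * b\<bar> / b"
            proof -
              have "S n f z / b - c f = (S n f z - c f * b) / b"
                using b by (simp add: diff_divide_distrib)
              then show ?thesis using b by simp
            qed
            ultimately show ?thesis using eq c[OF fc] by simp
          qed
          ultimately have "normalized n z \<in> G" using F(4) by blast
          then show "z \<in> {z \<in> space (marked_law n). normalized n z \<in> G}" using zs by simp
        qed
      qed
    qed
    ultimately show ?case by linarith
  qed
qed

end

text \<open>Transfer to the space of marked points: Dirichlet weights are normalised independent
  exponentials, independence makes the joint law of weights and locations a product, and pairing the
  coordinates turns the unnormalised product into \<open>marked_law n\<close>.\<close>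

lemma (in reference_law) law_weighted_empirical:
  fixes P :: "'a measure" and \<xi> :: "nat \<Rightarrow> 'a \<Rightarrow> real" and X :: "nat \<Rightarrow> 'a \<Rightarrow> real"
  assumes P: "prob_space P"
    and indep: "prob_space.indep_vars P (\<lambda>_. borel_unit) \<xi> {1..}"
    and \<xi>_law: "\<And>i. i \<ge> 1 \<Longrightarrow> distr P borel_unit (\<xi> i) = \<nu>"
    and X_law: "distr P (\<Pi>\<^sub>M i\<in>{1..n}. borel) (\<lambda>\<omega>. \<lambda>i\<in>{1..n}. X i \<omega>) = dirichlet_ones n"
    and X_\<xi>_indep: "prob_space.indep_var P
             (\<Pi>\<^sub>M i\<in>{1..n}. borel) (\<lambda>\<omega>. \<lambda>i\<in>{1..n}. X i \<omega>)
             (\<Pi>\<^sub>M i\<in>{1..}. borel_unit) (\<lambda>\<omega>. \<lambda>i\<in>{1..}. \<xi> i \<omega>)"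
    and n: "n \<ge> 1" and A: "A \<in> sets (borel_sigma weak_topology)"
  shows "measure (distr P (borel_sigma weak_topology)
      (\<lambda>\<omega>. weighted_empirical n (\<lambda>i. X i \<omega>) (\<lambda>i. \<xi> i \<omega>))) A =
    measure (marked_law n) {z \<in> space (marked_law n). normalized n z \<in> A}"
proof -
  interpret P: prob_space P by (rule P)
  interpret e: prob_space exp_law by (rule prob_space_exp_law)
  interpret nu: prob_space \<nu> using \<nu> by (rule M1_prob_space)
  let ?I = "{1..n}"
  let ?PX = "\<Pi>\<^sub>M i\<in>?I. (borel :: real measure)" and ?PY = "\<Pi>\<^sub>M i\<in>?I. borel_unit"
  let ?X = "\<lambda>\<omega>. \<lambda>i\<in>?I. X i \<omega>" and ?Y = "\<lambda>\<omega>. \<lambda>i\<in>?I. \<xi> i \<omega>"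
  let ?W = "\<lambda>x y. weighted_empirical n x y"
  \<comment> \<open>Restricting the infinite sequence of locations to its first \<open>n\<close>
    members preserves independence.\<close>
  have "P.indep_var ?PX ((\<lambda>f. f) \<circ> ?X) ?PY ((\<lambda>f. restrict f ?I) \<circ> (\<lambda>\<omega>. \<lambda>i\<in>{1..}. \<xi> i \<omega>))"
    using X_\<xi>_indep by (rule P.indep_var_compose) (auto intro!: measurable_restrict_subset)
  moreover have "((\<lambda>f. restrict f ?I) \<circ> (\<lambda>\<omega>. \<lambda>i\<in>{1..}. \<xi> i \<omega>)) = ?Y"
    by (auto simp: fun_eq_iff)
  ultimately have "P.indep_var ?PX ?X ?PY ?Y" by (simp add: comp_def)
  then have X[measurable]: "?X \<in> measurable P ?PX" and Y[measurable]: "?Y \<in> measurable P ?PY"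
    and joint: "distr P ?PX ?X \<Otimes>\<^sub>M distr P ?PY ?Y = distr P (?PX \<Otimes>\<^sub>M ?PY) (\<lambda>\<omega>. (?X \<omega>, ?Y \<omega>))"
    unfolding P.indep_var_distribution_eq by auto
  have Xi: "X i \<in> borel_measurable P" if "i \<in> ?I" for i
    using measurable_compose[OF X measurable_component_singleton[OF that]] that by simp
  have Yi: "\<xi> i \<in> measurable P borel_unit" if "i \<in> ?I" for i
    using measurable_compose[OF Y measurable_component_singleton[OF that]] that by simp
  have Y_law: "distr P ?PY ?Y = (\<Pi>\<^sub>M i\<in>?I. \<nu>)"
  proof -
    have "P.indep_vars (\<lambda>_. borel_unit) \<xi> ?I"
      by (rule P.indep_vars_subset[OF indep]) auto
    then have "distr P ?PY ?Y = (\<Pi>\<^sub>M i\<in>?I. distr P borel_unit (\<xi> i))"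
      using n Yi by (subst (asm) P.indep_vars_iff_distr_eq_PiM') auto
    also have "\<dots> = (\<Pi>\<^sub>M i\<in>?I. \<nu>)" by (intro PiM_cong \<xi>_law) auto
    finally show ?thesis .
  qed
  let ?E = "\<Pi>\<^sub>M i\<in>?I. exp_law" and ?N = "\<Pi>\<^sub>M i\<in>?I. \<nu>"
  define norm where "norm w = (\<lambda>i\<in>?I. w i / (\<Sum>k=1..n. w k))" for w :: "nat \<Rightarrow> real"
  define T where "T = (\<lambda>(w :: nat \<Rightarrow> real, y :: nat \<Rightarrow> real). \<lambda>i\<in>?I. (w i, y i))"
  have norm[measurable]: "norm \<in> measurable ?E ?PX"
    unfolding norm_def by measurable
  have N_PY: "sets ?N = sets ?PY" by (intro sets_PiM_cong refl M1_sets \<nu>)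
  have id: "(\<lambda>y. y) \<in> measurable ?N ?PY" using N_PY by (simp cong: measurable_cong_sets)
  have law: "distr P (?PX \<Otimes>\<^sub>M ?PY) (\<lambda>\<omega>. (?X \<omega>, ?Y \<omega>)) =
      distr (?E \<Otimes>\<^sub>M ?N) (?PX \<Otimes>\<^sub>M ?PY) (\<lambda>(w, y). (norm w, y))"
  proof -
    have "distr P (?PX \<Otimes>\<^sub>M ?PY) (\<lambda>\<omega>. (?X \<omega>, ?Y \<omega>)) = distr ?E ?PX norm \<Otimes>\<^sub>M distr ?N ?PY (\<lambda>y. y)"
      using joint X_law Y_law distr_id2[OF N_PY[symmetric]]
      by (simp add: dirichlet_ones_def norm_def[abs_def])
    also have "\<dots> = distr (?E \<Otimes>\<^sub>M ?N) (?PX \<Otimes>\<^sub>M ?PY) (\<lambda>(w, y). (norm w, y))"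
      using prob_space_PiM[of ?I "\<lambda>_. \<nu>"] nu.prob_space_axioms distr_id2[OF N_PY[symmetric]]
      by (intro pair_measure_distr norm id) (simp add: prob_space_imp_sigma_finite)
    finally show ?thesis .
  qed
  have T: "T \<in> measurable (?E \<Otimes>\<^sub>M ?N) (marked_law n)"
    unfolding marked_law_def point_law_def T_def by measurable
  have T_law: "distr (?E \<Otimes>\<^sub>M ?N) (marked_law n) T = marked_law n"
    unfolding marked_law_def point_law_def T_def
    by (intro PiM_pair_measure e.prob_space_axioms nu.prob_space_axioms) simp
  define S where "S = {p \<in> space (?PX \<Otimes>\<^sub>M ?PY). ?W (fst p) (snd p) \<in> A}"
  have S: "S \<in> sets (?PX \<Otimes>\<^sub>M ?PY)"
    unfolding S_def
  proof (rule weighted_empirical_vimage_measurable[OF _ _ A])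
    fix i assume "i \<in> ?I"
    then show "(\<lambda>p. fst p i) \<in> borel_measurable (?PX \<Otimes>\<^sub>M ?PY)"
      "(\<lambda>p. snd p i) \<in> measurable (?PX \<Otimes>\<^sub>M ?PY) borel_unit"
      by measurable
  qed
  \<comment> \<open>\<open>weighted_empirical\<close> reads only the indices from 1 to
    \<open>n\<close>, so the values outside \<open>?I\<close> created by restriction are
    harmless.\<close>
  have W_cong: "?W x y = ?W x' y'" if "\<And>i. i \<in> ?I \<Longrightarrow> x i = x' i" "\<And>i. i \<in> ?I \<Longrightarrow> y i = y' i" for x y x' y'
    unfolding weighted_empirical_def
    by (rule arg_cong[of _ _ "measure_of (space borel_unit) (sets borel_unit)"], rule ext, rule sum.cong)
       (use that in auto)
  define f where "f \<omega> = ?W (\<lambda>i. X i \<omega>) (\<lambda>i. \<xi> i \<omega>)" for \<omega>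
  have vimage: "f -` B \<inter> space P \<in> sets P" if "B \<in> sets (borel_sigma weak_topology)" for B
    using weighted_empirical_vimage_measurable[of n X P \<xi> B] Xi Yi that
    by (simp add: f_def[abs_def] vimage_def Int_def conj_commute)
  have "emeasure (distr P (borel_sigma weak_topology) f) A = emeasure P (f -` A \<inter> space P)"
    by (rule emeasure_distr_of_measurable_vimage[OF vimage A])
  also have "f -` A \<inter> space P = (\<lambda>\<omega>. (?X \<omega>, ?Y \<omega>)) -` S \<inter> space P"
  proof -
    have "f \<omega> = ?W (?X \<omega>) (?Y \<omega>)" for \<omega> unfolding f_def by (rule W_cong) auto
    moreover have "(?X \<omega>, ?Y \<omega>) \<in> space (?PX \<Otimes>\<^sub>M ?PY)" if "\<omega> \<in> space P" for \<omega>
      using measurable_space[OF X that] measurable_space[OF Y that] by (simp add: space_pair_measure)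
    ultimately show ?thesis unfolding S_def by auto
  qed
  also have "emeasure P \<dots> = emeasure (distr P (?PX \<Otimes>\<^sub>M ?PY) (\<lambda>\<omega>. (?X \<omega>, ?Y \<omega>))) S"
    by (rule emeasure_distr[OF measurable_Pair[OF X Y] S, symmetric])
  also have "\<dots> = emeasure (?E \<Otimes>\<^sub>M ?N) ((\<lambda>(w, y). (norm w, y)) -` S \<inter> space (?E \<Otimes>\<^sub>M ?N))"
  proof -
    have "(\<lambda>p. (norm (fst p), snd p)) \<in> measurable (?E \<Otimes>\<^sub>M ?N) (?PX \<Otimes>\<^sub>M ?PY)"
      by (intro measurable_Pair measurable_compose[OF measurable_fst norm] measurable_compose[OF measurable_snd id])
    then show ?thesis unfolding law using S by (intro emeasure_distr) (auto simp: case_prod_beta')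
  qed
  also have "(\<lambda>(w, y). (norm w, y)) -` S \<inter> space (?E \<Otimes>\<^sub>M ?N) =
      T -` {z \<in> space (marked_law n). normalized n z \<in> A} \<inter> space (?E \<Otimes>\<^sub>M ?N)"
  proof -
    have "(norm w, y) \<in> S \<longleftrightarrow> T (w, y) \<in> {z \<in> space (marked_law n). normalized n z \<in> A}"
      if wy: "(w, y) \<in> space (?E \<Otimes>\<^sub>M ?N)" for w y
    proof -
      have "normalized n (T (w, y)) = ?W (norm w) y"
        unfolding normalized_def by (rule W_cong) (auto simp: T_def norm_def)
      moreover have "(norm w, y) \<in> space (?PX \<Otimes>\<^sub>M ?PY)"
        using wy measurable_space[OF norm, of w] measurable_space[OF id, of y]
        by (simp add: space_pair_measure)
      moreover have "T (w, y) \<in> space (marked_law n)" using measurable_space[OF T wy] .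
      ultimately show ?thesis by (simp add: S_def)
    qed
    then show ?thesis by auto
  qed
  also have "emeasure (?E \<Otimes>\<^sub>M ?N) \<dots> =
      emeasure (distr (?E \<Otimes>\<^sub>M ?N) (marked_law n) T) {z \<in> space (marked_law n). normalized n z \<in> A}"
    by (rule emeasure_distr[OF T normalized_vimage_measurable[OF A], symmetric])
  finally show ?thesis
    unfolding T_law by (simp add: measure_def f_def[abs_def])
qed

section \<open>The large deviation principle\<close>

text \<open>The constant contributes \<open>ln C / real n\<close>, which vanishes in the limit. For
  \<open>p = 0\<close> the left side is \<open>-\<infinity>\<close>, as \<open>1 / real n\<close> is
  positive when \<open>n \<ge> 1\<close>.\<close>

lemma scaled_log_prob_le:
  assumes n: "n \<ge> 1" and C: "C > 0" and p: "0 \<le> p" "p \<le> C * exp (- a) ^ n"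
  shows "ereal (1 / real n) * log_prob p \<le> ereal (ln C / real n - a)"
proof (cases "p = 0")
  case True
  then show ?thesis using n by (simp add: log_prob_def)
next
  case False
  then have "ln p \<le> ln (C * exp (- a) ^ n)" using p C by (subst ln_le_cancel_iff) auto
  also have "\<dots> = ln C - real n * a" using C by (simp add: ln_mult ln_realpow)
  finally have "1 / real n * ln p \<le> 1 / real n * (ln C - real n * a)" using n by (intro mult_left_mono) auto
  also have "\<dots> = ln C / real n - a" using n by (simp add: field_simps)
  finally show ?thesis using False by (simp add: log_prob_def)
qed

lemma scaled_log_prob_ge:
  assumes n: "n \<ge> 1" and p: "exp (real n * a) / 2 \<le> p"
  shows "ereal (a - ln 2 / real n) \<le> ereal (1 / real n) * log_prob p"
proof -
  have pos: "exp (real n * a) / 2 > 0" by simp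
  then have "ln (exp (real n * a) / 2) \<le> ln p" using p by (subst ln_le_cancel_iff) linarith+
  then have "real n * a - ln 2 \<le> ln p" by (simp add: ln_div)
  then have "1 / real n * (real n * a - ln 2) \<le> 1 / real n * ln p" using n by (intro mult_left_mono) auto
  moreover have "1 / real n * (real n * a - ln 2) = a - ln 2 / real n" using n by (simp add: field_simps)
  moreover have "p \<noteq> 0" using p pos by linarith
  ultimately show ?thesis by (simp add: log_prob_def)
qed

context full_support
begin

text \<open>\<open>q\<close> is tied to the marked points from \<open>n = 1\<close> on, where the
  Dirichlet laws are prescribed; the limit superior ignores the first term.\<close>

lemma large_deviation_upper_bound:
  assumes C: "closedin weak_topology C"
    and q: "\<And>n. n \<ge> 1 \<Longrightarrow> q n = measure (marked_law n) {z \<in> space (marked_law n). normalized n z \<in> C}"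
  shows "limsup (\<lambda>n. ereal (1 / real n) * log_prob (q n)) \<le> - (INF \<mu>\<in>C. J \<mu> \<nu>)"
proof (rule dense_ge)
  \<comment> \<open>A bound by every \<open>b\<close> above the right side suffices. Such a
    \<open>b\<close> is real or \<open>\<infinity>\<close>, and the latter case is trivial.\<close>
  fix b :: ereal assume b: "- (INF \<mu>\<in>C. J \<mu> \<nu>) < b"
  show "limsup (\<lambda>n. ereal (1 / real n) * log_prob (q n)) \<le> b"
  proof (cases b)
    case (real r)
    define a where "a = - r"
    have CM1: "C \<subseteq> M1" using closedin_subset[OF C] by simp
    have "ereal a < (INF \<mu>\<in>C. J \<mu> \<nu>)" using b real by (simp add: a_def ereal_uminus_less_reorder)
    then have J: "ereal a < J \<mu> \<nu>" if "\<mu> \<in> C" for \<mu> using that by (auto dest: less_INF_D)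
    define \<U> where "\<U> = {U. \<exists>h s. U = {\<mu> \<in> M1. (\<integral>x. h x \<partial>\<mu>) \<in> {..<s}} \<and> continuous_on unit_ivl h \<and>
      (\<forall>x\<in>unit_ivl. h x > 0) \<and> s > 0 \<and> s * (\<integral>x. 1 / h x \<partial>\<nu>) \<le> exp (- a)}"
    have \<U>_open: "openin weak_topology U" if "U \<in> \<U>" for U
      using that unfolding \<U>_def by (auto intro!: openin_weak_topology_basic simp del: lessThan_iff)
    have \<U>_cover: "C \<subseteq> \<Union>\<U>"
    proof
      fix \<mu> assume \<mu>: "\<mu> \<in> C"
      with CM1 have "\<mu> \<in> M1" by blast
      obtain h s where "continuous_on unit_ivl h" "\<And>x. x \<in> unit_ivl \<Longrightarrow> h x > 0" "s > 0"
        "(\<integral>x. h x \<partial>\<mu>) < s" "s * (\<integral>x. 1 / h x \<partial>\<nu>) \<le> exp (- a)"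
        using J_gt_nbhd[OF \<open>\<mu> \<in> M1\<close> J[OF \<mu>]] by metis
      then have "{\<mu> \<in> M1. (\<integral>x. h x \<partial>\<mu>) \<in> {..<s}} \<in> \<U>" "\<mu> \<in> {\<mu> \<in> M1. (\<integral>x. h x \<partial>\<mu>) \<in> {..<s}}"
        using \<open>\<mu> \<in> M1\<close> unfolding \<U>_def by blast+
      then show "\<mu> \<in> \<Union>\<U>" by blast
    qed
    have "compactin weak_topology C"
      by (rule closed_compactin[OF compactin_M1 CM1 C])
    then obtain \<F> where \<F>: "finite \<F>" "\<F> \<subseteq> \<U>" "C \<subseteq> \<Union>\<F>"
      using \<U>_open \<U>_cover unfolding compactin_def by meson
    \<comment> \<open>The added 1 keeps \<open>K\<close> positive when the cover is empty, so that
      \<open>ln K\<close> is meaningful.\<close>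
    define K where "K = real (card \<F>) + 1"
    have K: "K > 0" by (simp add: K_def)
    have qK: "q n \<le> K * exp (- a) ^ n" "q n \<ge> 0" if n: "n \<ge> 1" for n
    proof -
      interpret P: prob_space "marked_law n" by (rule prob_space_marked_law)
      define E where "E U = {z \<in> space (marked_law n). normalized n z \<in> U}" for U
      have E: "E U \<in> sets (marked_law n)" if "U \<in> \<F>" for U
        unfolding E_def using that \<F> \<U>_open
        by (intro normalized_vimage_measurable openin_in_sets_borel_sigma) auto
      have E_le: "P.prob (E U) \<le> exp (- a) ^ n" if "U \<in> \<F>" for U
      proof -
        have "U \<in> \<U>" using that \<F> by blast
        then obtain h s where h: "U = {\<mu> \<in> M1. (\<integral>x. h x \<partial>\<mu>) \<in> {..<s}}" "continuous_on unit_ivl h"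
          "\<And>x. x \<in> unit_ivl \<Longrightarrow> h x > 0" "s > 0" "s * (\<integral>x. 1 / h x \<partial>\<nu>) \<le> exp (- a)"
          unfolding \<U>_def mem_Collect_eq by (elim exE conjE) blast
        have "P.prob (E U) \<le> (s * (\<integral>x. 1 / h x \<partial>\<nu>)) ^ n"
          unfolding E_def h(1) by (rule normalized_upper_bound[OF h(2-4)])
        also have "\<dots> \<le> exp (- a) ^ n"
        proof (rule power_mono[OF h(5)])
          show "0 \<le> s * (\<integral>x. 1 / h x \<partial>\<nu>)"
            using h(3,4) by (intro mult_nonneg_nonneg integral_nonneg_AE AE_I2) (auto simp: M1_space[OF \<nu>] less_imp_le)
        qed
        finally show ?thesis .
      qed
      have "q n = P.prob (E C)" using q[OF n] by (simp add: E_def)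
      also have "\<dots> \<le> P.prob (\<Union>U\<in>\<F>. E U)"
        using \<F> E by (intro P.finite_measure_mono) (auto simp: E_def)
      also have "\<dots> \<le> (\<Sum>U\<in>\<F>. P.prob (E U))"
        using \<F> E by (intro P.finite_measure_subadditive_finite) auto
      also have "\<dots> \<le> (\<Sum>U\<in>\<F>. exp (- a) ^ n)" by (intro sum_mono E_le)
      also have "\<dots> \<le> K * exp (- a) ^ n" by (simp add: K_def)
      finally show "q n \<le> K * exp (- a) ^ n" .
      show "q n \<ge> 0" using q[OF n] by simp
    qed
    have "limsup (\<lambda>n. ereal (1 / real n) * log_prob (q n)) \<le> limsup (\<lambda>n. ereal (ln K / real n - a))"
    proof (rule Limsup_mono)
      show "\<forall>\<^sub>F n in sequentially. ereal (1 / real n) * log_prob (q n) \<le> ereal (ln K / real n - a)"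
        using eventually_ge_at_top[of 1] by eventually_elim (intro scaled_log_prob_le K qK)
    qed
    also have "\<dots> = ereal (0 - a)"
      by (intro lim_imp_Limsup tendsto_ereal tendsto_diff lim_const_over_n tendsto_const) simp
    finally show ?thesis using real by (simp add: a_def)
  qed (use b in auto)
qed

text \<open>It suffices to compare the limit inferior with each single \<open>\<mu>\<close> in
  \<open>G\<close>. Points of infinite rate impose nothing, and for the others the estimate for a
  nearby continuous density applies.\<close>

lemma large_deviation_lower_bound:
  assumes G: "openin weak_topology G"
    and q: "\<And>n. n \<ge> 1 \<Longrightarrow> q n = measure (marked_law n) {z \<in> space (marked_law n). normalized n z \<in> G}"
  shows "- (INF \<mu>\<in>G. J \<mu> \<nu>) \<le> liminf (\<lambda>n. ereal (1 / real n) * log_prob (q n))" (is "_ \<le> ?L")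
proof -
  have "- ?L \<le> J \<mu> \<nu>" if \<mu>G: "\<mu> \<in> G" for \<mu>
  proof -
    have \<mu>: "\<mu> \<in> M1" using openin_subset[OF G] \<mu>G by auto
    show ?thesis
    proof (cases "J \<mu> \<nu>")
      case (real r)
      have "ereal (- r) \<le> ?L"
      proof (rule ereal_le_epsilon2)
        fix e :: real assume "e > 0"
        then have e: "e / 2 > 0" by simp
        \<comment> \<open>The error \<open>e\<close> is split: half goes to this approximation, half
          to the change of measure.\<close>
        obtain g where g: "continuous_on unit_ivl g" "\<And>x. x \<in> unit_ivl \<Longrightarrow> g x > 0" "(\<integral>x. g x \<partial>\<nu>) = 1"
          "density \<nu> (\<lambda>x. ennreal (g x)) \<in> G" "- 2 * ln (\<integral>x. sqrt (g x) \<partial>\<nu>) \<le> r + e / 2"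
          by (rule approximation_by_continuous_density[OF G \<mu>G, of r "e / 2"]) (use real e in auto)
        define a where "a = 2 * ln (\<integral>x. sqrt (g x) \<partial>\<nu>) - e / 2"
        have a: "- r - e \<le> a" using g(5) by (simp add: a_def)
        have lower: "\<forall>\<^sub>F n in sequentially. exp (real n * a) / 2
            \<le> measure (marked_law n) {z \<in> space (marked_law n). normalized n z \<in> G}"
          unfolding a_def by (rule normalized_lower_bound[OF g(1,2,3) G g(4) e])
        have "ereal (a - 0) = liminf (\<lambda>n. ereal (a - ln 2 / real n))"
          by (intro lim_imp_Liminf[symmetric] tendsto_ereal tendsto_diff lim_const_over_n tendsto_const) simp
        also have "\<dots> \<le> ?L"
        proof (rule Liminf_mono)
          show "\<forall>\<^sub>F n in sequentially. ereal (a - ln 2 / real n) \<le> ereal (1 / real n) * log_prob (q n)"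
            using lower eventually_ge_at_top[of 1]
            by eventually_elim (rule scaled_log_prob_ge; simp add: q)
        qed
        finally have "ereal a \<le> ?L" by simp
        moreover have "ereal (- r) \<le> ereal a + ereal e" using a by simp
        ultimately show "ereal (- r) \<le> ?L + ereal e"
          by (meson add_right_mono order_trans)
      qed
      then show ?thesis using real by (metis ereal_uminus_le_reorder uminus_ereal.simps(1))
    qed (use J_nonneg[OF \<mu> \<nu>] in auto)
  qed
  then have "- ?L \<le> (INF \<mu>\<in>G. J \<mu> \<nu>)" by (rule INF_greatest)
  then show ?thesis by (simp add: ereal_uminus_le_reorder)
qed

end

theorem theorem3p3:
  fixes P :: "'a measure"
    and \<nu>0 :: "real measure"
    and \<xi> :: "nat \<Rightarrow> 'a \<Rightarrow> real"
    and X :: "nat \<Rightarrow> nat \<Rightarrow> 'a \<Rightarrow> real"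
  assumes "prob_space P"
    and "\<nu>0 \<in> M1"
    and "topological_support \<nu>0 = unit_ivl"
    and "prob_space.indep_vars P (\<lambda>_. borel_unit) \<xi> {1..}"
    and "\<And>i. i \<ge> 1 \<Longrightarrow> distr P borel_unit (\<xi> i) = \<nu>0"
    and "\<And>n. n \<ge> 1 \<Longrightarrow>
           distr P (\<Pi>\<^sub>M i\<in>{1..n}. borel) (\<lambda>\<omega>. \<lambda>i\<in>{1..n}. X n i \<omega>) = dirichlet_ones n"
    and "\<And>n. n \<ge> 1 \<Longrightarrow>
           prob_space.indep_var P
             (\<Pi>\<^sub>M i\<in>{1..n}. borel) (\<lambda>\<omega>. \<lambda>i\<in>{1..n}. X n i \<omega>)
             (\<Pi>\<^sub>M i\<in>{1..}. borel_unit) (\<lambda>\<omega>. \<lambda>i\<in>{1..}. \<xi> i \<omega>)"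
  shows "good_rate_function weak_topology (\<lambda>\<mu>. J \<mu> \<nu>0) \<and>
         LDP_speed_n weak_topology
           (\<lambda>n. distr P (borel_sigma weak_topology)
                  (\<lambda>\<omega>. weighted_empirical n (\<lambda>i. X n i \<omega>) (\<lambda>i. \<xi> i \<omega>)))
           (\<lambda>\<mu>. J \<mu> \<nu>0)"
proof -
  interpret full_support \<nu>0 by unfold_locales (fact assms)+
  have law: "measure (distr P (borel_sigma weak_topology)
      (\<lambda>\<omega>. weighted_empirical n (\<lambda>i. X n i \<omega>) (\<lambda>i. \<xi> i \<omega>))) A =
    measure (marked_law n) {z \<in> space (marked_law n). normalized n z \<in> A}"
    if "n \<ge> 1" "A \<in> sets (borel_sigma weak_topology)" for n A
    using assms(1,4,5) assms(6,7)[OF that(1)] that by (rule law_weighted_empirical)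
  show ?thesis
    unfolding LDP_speed_n_def
  proof (intro conjI allI impI good_rate_function_J)
    fix C assume C: "closedin weak_topology C"
    show "limsup (\<lambda>n. ereal (1 / real n) * log_prob (measure (distr P (borel_sigma weak_topology)
        (\<lambda>\<omega>. weighted_empirical n (\<lambda>i. X n i \<omega>) (\<lambda>i. \<xi> i \<omega>))) C)) \<le> - (INF \<mu>\<in>C. J \<mu> \<nu>0)"
      by (rule large_deviation_upper_bound[OF C]) (intro law closedin_in_sets_borel_sigma C)
  next
    fix G assume G: "openin weak_topology G"
    show "- (INF \<mu>\<in>G. J \<mu> \<nu>0) \<le> liminf (\<lambda>n. ereal (1 / real n) * log_prob (measure (distr P (borel_sigma weak_topology)
        (\<lambda>\<omega>. weighted_empirical n (\<lambda>i. X n i \<omega>) (\<lambda>i. \<xi> i \<omega>))) G))"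
      by (rule large_deviation_lower_bound[OF G]) (intro law openin_in_sets_borel_sigma G)
  qed
qed

end
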